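(* Let $\mathcal{C}$ be the space of all stable and sequentially continuous functions $f:(L^0)^d\to L^0$, and let $L:\mathcal{C}\to L^0$ be stable, $L^0$-linear and such that $L(f)\ge0$ whenever $f\ge0$. Then there exists a conditionally regular finite stable measure $\mu$ on $\mathcal{B}^d$ such that $$L(f)=\int_{(L^0)^d}f\,d\mu\quad\text{for all }f\in\mathcal{C}.$$
   Context: $(\Omega,\mathscr{F},\mathbb{P})$ is a complete probability space; $A,B\in\mathscr{F}$ are identified if $\mathbb{P}(A\Delta B)=0$, and inclusions and (in)equalities between (extended) random variables are understood a.s. $L^0$, $L^0_+$, $\bar L^0_+$ are the sets of measurable functions on $\Omega$ with values in $\mathbb{R}$, $[0,\infty)$, $[0,\infty]$; $L^0_{++}=\{x\in L^0:x>0\}$. Suprema of families in $\mathscr{F}$ and in $\bar L^0_+$ are essential suprema. A partition (of $\Omega$) is a countable pairwise disjoint family $(A_k)$ in $\mathscr{F}$ with union $\Omega$. For a function $x$ on $\Omega$ and $A\in\mathscr{F}$, $x|A$ is the restriction to $A$; $x|A$ and $y|B$ are identified if $\mathbb{P}(A\Delta B)=0$ and $x=y$ a.e. on $A\cap B$. $\sum x_k|A_k$ is the function equal to $x_k$ on $A_k$ for each $k$ (so $r|A+0|A^c$ equals $r$ on $A$ and $0$ on $A^c$). For a set $X$ of functions on $\Omega$, $X|A:=\{x|A: x\in X\}$, $(X|A)|B:=X|A\cap B$, $X|\emptyset=\{\ast\}$, $X|\Omega=X$. A set $X$ of functions on $\Omega$ with values in a fixed set is stable if $X\neq\emptyset$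 and $\sum x_k|A_k\in X$ for all partitions $(A_k)$ and sequences $(x_k)$ in $X$. $\mathcal{P}(X)$ is the collection of all conditional subsets $V|A$, $V\subseteq X$ stable, $A\in\mathscr{F}$. For stable $V_k\subseteq X$, $\sum V_k|A_k:=\{\sum x_k|A_k: x_k\in V_k\ \forall k\}$, and $\sum (V_k|B_k)|A_k:=(\sum V_k|A_k)|\bigcup_k(A_k\cap B_k)$. A subset of $\mathcal{P}(X)$ is a stable collection if nonempty and closed under such countable concatenations. $V|A\sqsubseteq W|B$ iff $A\subseteq B$ and $V|A\subseteq W|A$. $(\mathcal{P}(X),\sqsubseteq)$ is a complete Boolean algebra with greatest element $X$ and least element $\{\ast\}$; $\sqcup,\sqcap,{}^\sqsubset$ are its supremum, infimum, complement; disjoint means $V|A\sqcap W|B=\{\ast\}$. A stable collection $\mathcal{X}$ is a stable $\sigma$-algebra if $X\in\mathcal{X}$ and it is closed under ${}^\sqsubset$ and countable $\sqcup$. A stable measure on a stable $\sigma$-algebra $\mathcal{X}$ is a function $\mu:\mathcal{X}\to\bar L^0_+$ with $\mu(\sum(V_k|B_k)|A_k)=\sum\mu(V_k|B_k)|A_k$ (stability), (M1) $\mu(V|A)=\mu(V|A)|A+0|A^c$, and (M2) $\mu(\sqcup_k(V_k|A_k))=\sum_{k}\mu(V_k|A_k)$ for sequences of pairwise disjoint elements of $\mathcal{X}$; it is finite if $\mu(X)<\infty$ (a.s.). A function $f:X\to Y$ between stable sets is stable if $f(\sum x_k|A_k)=\sum f(x_k)|A_k$. For $W|A\in\mathcal{P}(Y)$,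 with $C_\ast:=\sup\{A'\subseteq A:\exists x\in X,\ f(x)|A'\in W|A'\}$ (attained), $f^{-1}(W|A):=\{x\in X:f(x)|C_\ast\in W|C_\ast\}|C_\ast$. A stable function is stably measurable if preimages of elements of the stable $\sigma$-algebra on $Y$ belong to that on $X$. The stable indicator function is $1_{V|A}(x):=1|A_x+0|A_x^c$, with $A_x:=\sup\{A'\subseteq A: x|A'\in V|A'\}$. A stable elementary function is $\sum_{k\le n}r_k1_{V_k|A_k}$ with $r_k\in L^0_+$ and pairwise disjoint $V_k|A_k\in\mathcal{X}$ with $\sqcup_kV_k|A_k=X$; its integral is $\sum_{k\le n}r_k\mu(V_k|A_k)\in\bar L^0_+$ ($0\cdot\infty=0$). For stably measurable $f:X\to L^0_+$, $\int_Xf\,d\mu:=\sup_n\int_Xf_n\,d\mu$ for any increasing sequence $(f_n)$ of stable elementary functions with $\sup_nf_n=f$ pointwise (exists; independent of the choice). A stably measurable $f:X\to L^0$ is integrable if $\int_X f^\pm d\mu\in L^0$, and then $\int_Xf\,d\mu:=\int_Xf^+d\mu-\int_Xf^-d\mu$. $(L^0)^d=L^0(\mathbb{R}^d)$ (measurable functions $\Omega\to\mathbb{R}^d$) carries the $L^0$-valued Euclidean norm $\|x\|(\omega):=\|x(\omega)\|$. $\mathcal{B}^d$ is the stable $\sigma$-algebra on $(L^0)^d$ generated by the stable open balls $\{y:\|x-y\|<r\}$, $x\in(L^0)^d$, $r\in L^0_{++}$; $\mathcal{B}(L^0)$, the stable $\sigma$-algebra on $L^0$, is the case $d=1$. A conditional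 subset $V|A$ of $(L^0)^d$ is $L^0$-bounded if there is $M\in L^0_+$ with $\|x\||A\le M|A$ for all $x|A\in V|A$; sequentially closed if it contains the limit of every a.s. convergent sequence in $V|A$; stably compact if it is $L^0$-bounded and sequentially closed. A function $f:(L^0)^d\to L^0$ is sequentially continuous if $f(x_n)\to f(x)$ a.s. whenever $x_n\to x$ a.s. For functions, $f\ge0$ means $f(x)\ge0$ for all $x$, and $(\sum f_k|A_k)(x):=\sum f_k(x)|A_k$. $L:\mathcal{C}\to L^0$ is stable if $L(\sum f_k|A_k)=\sum L(f_k)|A_k$ for all sequences $(f_k)$ in $\mathcal{C}$ and partitions $(A_k)$; $L^0$-linear if $L(f+rg)=L(f)+rL(g)$ for all $f,g\in\mathcal{C}$, $r\in L^0$. A stable measure $\mu$ on $\mathcal{B}^d$ is conditionally regular if $\mu(V|A)=\sup\{\mu(W|B):W|B\sqsubseteq V|A\text{ stably compact}\}$ for all $V|A\in\mathcal{B}^d$. *)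

theory Defs
  imports "HOL-Probability.Probability" "HOL-Algebra.Complete_Lattice"
begin

text \<open>
  Elements of \<open>L\<^sup>0\<close> are represented by measurable functions, and identification is expressed
  by \<open>AE \<omega> in M\<close>. A restriction \<open>x|A\<close> is represented by the partial function
  \<open>(Some \<circ> x) |` A\<close>: by completeness of \<open>M\<close>, two such partial functions agree almost everywhere
  iff \<open>M (A \<triangle> B) = 0\<close> and \<open>x = y\<close> a.e.\ on \<open>A \<inter> B\<close>.
\<close>

definition is_partition :: "'a measure \<Rightarrow> (nat \<Rightarrow> 'a set) \<Rightarrow> bool" where
  "is_partition M A \<longleftrightarrow>
     range A \<subseteq> sets M \<and> disjoint_family A \<and> (\<Union>k. A k) = space M"

text \<open>\<open>is_concat M A x y\<close> says that \<open>y\<close> is (a version of) \<open>\<Sum>x\<^sub>k|A\<^sub>k\<close>. It is used for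
  functions as well as for partial functions.\<close>

definition is_concat ::
    "'a measure \<Rightarrow> (nat \<Rightarrow> 'a set) \<Rightarrow> (nat \<Rightarrow> 'a \<Rightarrow> 'b) \<Rightarrow> ('a \<Rightarrow> 'b) \<Rightarrow> bool" where
  "is_concat M A x y \<longleftrightarrow> (\<forall>k. AE \<omega> in M. \<omega> \<in> A k \<longrightarrow> y \<omega> = x k \<omega>)"

text \<open>Taking the trivial partition, a stable set is closed under almost sure equality.\<close>

definition stable_set :: "'a measure \<Rightarrow> ('a \<Rightarrow> 'b) set \<Rightarrow> bool" where
  "stable_set M X \<longleftrightarrow> X \<noteq> {} \<and>
     (\<forall>A x y. is_partition M A \<and> (\<forall>k. x k \<in> X) \<and> is_concat M A x y \<longrightarrow> y \<in> X)"

text \<open>The conditional set \<open>V|A\<close>, as the set of all versions of the restrictions \<open>x|A\<close> with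
  \<open>x \<in> V\<close>. Hence \<open>V|A\<close> and \<open>W|B\<close> are identified iff they are equal as HOL sets.\<close>

type_synonym ('a, 'b) cset = "('a \<Rightarrow> 'b option) set"

definition crestr :: "'a measure \<Rightarrow> ('a \<Rightarrow> 'b) set \<Rightarrow> 'a set \<Rightarrow> ('a, 'b) cset" where
  "crestr M V A = {u. \<exists>x\<in>V. AE \<omega> in M. u \<omega> = ((Some \<circ> x) |` A) \<omega>}"

definition cond_pair :: "'a measure \<Rightarrow> ('a \<Rightarrow> 'b) set \<Rightarrow> ('a \<Rightarrow> 'b) set \<Rightarrow> 'a set \<Rightarrow> bool" where
  "cond_pair M X V A \<longleftrightarrow> V \<subseteq> X \<and> stable_set M V \<and> A \<in> sets M"

definition cond_le :: "'a measure \<Rightarrow> ('a \<Rightarrow> 'b) set \<Rightarrow> ('a, 'b) cset \<Rightarrow> ('a, 'b) cset \<Rightarrow> bool" where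
  "cond_le M X P Q \<longleftrightarrow>
     (\<exists>V A W B. cond_pair M X V A \<and> cond_pair M X W B \<and> P = crestr M V A \<and> Q = crestr M W B \<and>
        (AE \<omega> in M. \<omega> \<in> A \<longrightarrow> \<omega> \<in> B) \<and> crestr M V A \<subseteq> crestr M W A)"

text \<open>The ordered set of conditional subsets of \<open>X\<close>; suprema and infima in it are those of
  \<open>HOL-Algebra\<close>.\<close>

definition csubsets :: "'a measure \<Rightarrow> ('a \<Rightarrow> 'b) set \<Rightarrow> ('a, 'b) cset gorder" where
  "csubsets M X =
     \<lparr>carrier = {crestr M V A |V A. cond_pair M X V A}, eq = (=), le = cond_le M X\<rparr>"

abbreviation ctop :: "'a measure \<Rightarrow> ('a \<Rightarrow> 'b) set \<Rightarrow> ('a, 'b) cset" where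
  "ctop M X \<equiv> crestr M X (space M)"

abbreviation cbot :: "'a measure \<Rightarrow> ('a \<Rightarrow> 'b) set \<Rightarrow> ('a, 'b) cset" where
  "cbot M X \<equiv> crestr M X {}"

definition cdisjoint :: "'a measure \<Rightarrow> ('a \<Rightarrow> 'b) set \<Rightarrow> ('a, 'b) cset \<Rightarrow> ('a, 'b) cset \<Rightarrow> bool" where
  "cdisjoint M X P Q \<longleftrightarrow> P \<sqinter>\<^bsub>csubsets M X\<^esub> Q = cbot M X"

definition ccompl :: "'a measure \<Rightarrow> ('a \<Rightarrow> 'b) set \<Rightarrow> ('a, 'b) cset \<Rightarrow> ('a, 'b) cset" where
  "ccompl M X P = (THE Q. Q \<in> carrier (csubsets M X) \<and>
     P \<sqinter>\<^bsub>csubsets M X\<^esub> Q = cbot M X \<and> P \<squnion>\<^bsub>csubsets M X\<^esub> Q = ctop M X)"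

text \<open>On \<open>A\<^sub>k\<close> an element of \<open>(\<Sum>V\<^sub>k|A\<^sub>k)|\<Union>\<^sub>k(A\<^sub>k \<inter> B\<^sub>k)\<close> coincides, as a partial function, with
  \<open>x\<^sub>k|B\<^sub>k\<close> for some \<open>x\<^sub>k \<in> V\<^sub>k\<close>, and conversely; so \<open>\<Sum>(V\<^sub>k|B\<^sub>k)|A\<^sub>k\<close> consists of the
  concatenations of elements of the \<open>V\<^sub>k|B\<^sub>k\<close>.\<close>

definition cconcat ::
    "'a measure \<Rightarrow> (nat \<Rightarrow> 'a set) \<Rightarrow> (nat \<Rightarrow> ('a, 'b) cset) \<Rightarrow> ('a, 'b) cset" where
  "cconcat M A P = {u. \<exists>v. (\<forall>k. v k \<in> P k) \<and> is_concat M A v u}"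

definition stable_collection ::
    "'a measure \<Rightarrow> ('a \<Rightarrow> 'b) set \<Rightarrow> ('a, 'b) cset set \<Rightarrow> bool" where
  "stable_collection M X \<X> \<longleftrightarrow> \<X> \<subseteq> carrier (csubsets M X) \<and> \<X> \<noteq> {} \<and>
     (\<forall>A P. is_partition M A \<and> (\<forall>k. P k \<in> \<X>) \<longrightarrow> cconcat M A P \<in> \<X>)"

definition stable_sigma_algebra ::
    "'a measure \<Rightarrow> ('a \<Rightarrow> 'b) set \<Rightarrow> ('a, 'b) cset set \<Rightarrow> bool" where
  "stable_sigma_algebra M X \<X> \<longleftrightarrow>
     stable_collection M X \<X> \<and> ctop M X \<in> \<X> \<and>
     (\<forall>P\<in>\<X>. ccompl M X P \<in> \<X>) \<and>
     (\<forall>P :: nat \<Rightarrow> _. (\<forall>k. P k \<in> \<X>) \<longrightarrow> \<Squnion>\<^bsub>csubsets M X\<^esub> (range P) \<in> \<X>)"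

definition stable_measure ::
    "'a measure \<Rightarrow> ('a \<Rightarrow> 'b) set \<Rightarrow> ('a, 'b) cset set \<Rightarrow> (('a, 'b) cset \<Rightarrow> 'a \<Rightarrow> ennreal) \<Rightarrow> bool"
where
  "stable_measure M X \<X> \<mu> \<longleftrightarrow>
     (\<forall>P\<in>\<X>. \<mu> P \<in> borel_measurable M) \<and>
     (\<forall>A P. is_partition M A \<and> (\<forall>k. P k \<in> \<X>) \<longrightarrow>
        is_concat M A (\<lambda>k. \<mu> (P k)) (\<mu> (cconcat M A P))) \<and>
     (\<forall>V A. cond_pair M X V A \<and> crestr M V A \<in> \<X> \<longrightarrow>
        (AE \<omega> in M. \<mu> (crestr M V A) \<omega> = (if \<omega> \<in> A then \<mu> (crestr M V A) \<omega> else 0))) \<and>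
     (\<forall>P :: nat \<Rightarrow> _. (\<forall>k. P k \<in> \<X>) \<and> (\<forall>i j. i \<noteq> j \<longrightarrow> cdisjoint M X (P i) (P j)) \<longrightarrow>
        (AE \<omega> in M. \<mu> (\<Squnion>\<^bsub>csubsets M X\<^esub> (range P)) \<omega> = (\<Sum>k. \<mu> (P k) \<omega>)))"

definition finite_stable_measure ::
    "'a measure \<Rightarrow> ('a \<Rightarrow> 'b) set \<Rightarrow> ('a, 'b) cset set \<Rightarrow> (('a, 'b) cset \<Rightarrow> 'a \<Rightarrow> ennreal) \<Rightarrow> bool"
where
  "finite_stable_measure M X \<X> \<mu> \<longleftrightarrow>
     stable_measure M X \<X> \<mu> \<and> (AE \<omega> in M. \<mu> (ctop M X) \<omega> < \<infinity>)"

text \<open>Essential suprema, of a family of events and of a family of extended random variables.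
  The former is unique only up to null sets, so \<open>ess_Sup_sets\<close> chooses a version; its uses below
  do not depend on the choice up to identification.\<close>

definition ess_Sup_sets :: "'a measure \<Rightarrow> 'a set set \<Rightarrow> 'a set" where
  "ess_Sup_sets M \<A> = (SOME C. C \<in> sets M \<and>
     (\<forall>A\<in>\<A>. AE \<omega> in M. \<omega> \<in> A \<longrightarrow> \<omega> \<in> C) \<and>
     (\<forall>D\<in>sets M. (\<forall>A\<in>\<A>. AE \<omega> in M. \<omega> \<in> A \<longrightarrow> \<omega> \<in> D) \<longrightarrow> (AE \<omega> in M. \<omega> \<in> C \<longrightarrow> \<omega> \<in> D)))"

definition is_ess_Sup :: "'a measure \<Rightarrow> ('a \<Rightarrow> ennreal) set \<Rightarrow> ('a \<Rightarrow> ennreal) \<Rightarrow> bool" where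
  "is_ess_Sup M F s \<longleftrightarrow> s \<in> borel_measurable M \<and>
     (\<forall>g\<in>F. AE \<omega> in M. g \<omega> \<le> s \<omega>) \<and>
     (\<forall>h\<in>borel_measurable M. (\<forall>g\<in>F. AE \<omega> in M. g \<omega> \<le> h \<omega>) \<longrightarrow> (AE \<omega> in M. s \<omega> \<le> h \<omega>))"

text \<open>Functions between stable sets are represented by operations on representatives; stability
  (with the trivial partition) makes them compatible with almost sure equality.\<close>

definition stable_fun ::
    "'a measure \<Rightarrow> ('a \<Rightarrow> 'b) set \<Rightarrow> ('a \<Rightarrow> 'c) set \<Rightarrow> (('a \<Rightarrow> 'b) \<Rightarrow> 'a \<Rightarrow> 'c) \<Rightarrow> bool" where
  "stable_fun M X Y f \<longleftrightarrow> (\<forall>x\<in>X. f x \<in> Y) \<and>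
     (\<forall>A x y. is_partition M A \<and> (\<forall>k. x k \<in> X) \<and> y \<in> X \<and> is_concat M A x y \<longrightarrow>
        is_concat M A (\<lambda>k. f (x k)) (f y))"

definition cpreimage ::
    "'a measure \<Rightarrow> ('a \<Rightarrow> 'b) set \<Rightarrow> (('a \<Rightarrow> 'b) \<Rightarrow> 'a \<Rightarrow> 'c) \<Rightarrow> ('a \<Rightarrow> 'c) set \<Rightarrow> 'a set \<Rightarrow> ('a, 'b) cset"
where
  "cpreimage M X f W A =
     (let C = ess_Sup_sets M {A'. A' \<in> sets M \<and> A' \<subseteq> A \<and>
                (\<exists>x\<in>X. (Some \<circ> f x) |` A' \<in> crestr M W A')}
      in crestr M {x \<in> X. (Some \<circ> f x) |` C \<in> crestr M W C} C)"

definition stably_measurable ::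
    "'a measure \<Rightarrow> ('a \<Rightarrow> 'b) set \<Rightarrow> ('a, 'b) cset set \<Rightarrow> ('a \<Rightarrow> 'c) set \<Rightarrow> ('a, 'c) cset set \<Rightarrow>
      (('a \<Rightarrow> 'b) \<Rightarrow> 'a \<Rightarrow> 'c) \<Rightarrow> bool"
where
  "stably_measurable M X \<X> Y \<Y> f \<longleftrightarrow> stable_fun M X Y f \<and>
     (\<forall>W A. cond_pair M Y W A \<and> crestr M W A \<in> \<Y> \<longrightarrow> cpreimage M X f W A \<in> \<X>)"

definition stable_indicator ::
    "'a measure \<Rightarrow> ('a \<Rightarrow> 'b) set \<Rightarrow> 'a set \<Rightarrow> ('a \<Rightarrow> 'b) \<Rightarrow> 'a \<Rightarrow> real" where
  "stable_indicator M V A x =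
     indicator (ess_Sup_sets M {A'. A' \<in> sets M \<and> A' \<subseteq> A \<and> (Some \<circ> x) |` A' \<in> crestr M V A'})"

text \<open>\<open>f\<close> is a stable elementary function with integral \<open>I\<close>. Independence of the representation is
  not built into this relation.\<close>

definition has_elementary_integral ::
    "'a measure \<Rightarrow> ('a \<Rightarrow> 'b) set \<Rightarrow> ('a, 'b) cset set \<Rightarrow> (('a, 'b) cset \<Rightarrow> 'a \<Rightarrow> ennreal) \<Rightarrow>
      (('a \<Rightarrow> 'b) \<Rightarrow> 'a \<Rightarrow> real) \<Rightarrow> ('a \<Rightarrow> ennreal) \<Rightarrow> bool"
where
  "has_elementary_integral M X \<X> \<mu> f I \<longleftrightarrow>
     (\<exists>(n::nat) r V A.
        (\<forall>k<n. r k \<in> borel_measurable M \<and> (AE \<omega> in M. 0 \<le> r k \<omega>) \<and>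
               cond_pair M X (V k) (A k) \<and> crestr M (V k) (A k) \<in> \<X>) \<and>
        (\<forall>i<n. \<forall>j<n. i \<noteq> j \<longrightarrow> cdisjoint M X (crestr M (V i) (A i)) (crestr M (V j) (A j))) \<and>
        \<Squnion>\<^bsub>csubsets M X\<^esub> ((\<lambda>k. crestr M (V k) (A k)) ` {..<n}) = ctop M X \<and>
        (\<forall>x\<in>X. AE \<omega> in M. f x \<omega> = (\<Sum>k<n. r k \<omega> * stable_indicator M (V k) (A k) x \<omega>)) \<and>
        (AE \<omega> in M. I \<omega> = (\<Sum>k<n. ennreal (r k \<omega>) * \<mu> (crestr M (V k) (A k)) \<omega>)))"

text \<open>The integral of a stably measurable \<open>f\<close> with \<open>f \<ge> 0\<close>; it does not depend on the
  approximating sequence, so that \<open>stable_nn_integral\<close> is determined a.s.\<close>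

definition has_stable_nn_integral ::
    "'a measure \<Rightarrow> ('a \<Rightarrow> 'b) set \<Rightarrow> ('a, 'b) cset set \<Rightarrow> (('a, 'b) cset \<Rightarrow> 'a \<Rightarrow> ennreal) \<Rightarrow>
      (('a \<Rightarrow> 'b) \<Rightarrow> 'a \<Rightarrow> real) \<Rightarrow> ('a \<Rightarrow> ennreal) \<Rightarrow> bool"
where
  "has_stable_nn_integral M X \<X> \<mu> f I \<longleftrightarrow>
     (\<exists>(fs :: nat \<Rightarrow> _) Is.
        (\<forall>n. has_elementary_integral M X \<X> \<mu> (fs n) (Is n)) \<and>
        (\<forall>n. \<forall>x\<in>X. AE \<omega> in M. fs n x \<omega> \<le> fs (Suc n) x \<omega>) \<and>
        (\<forall>x\<in>X. AE \<omega> in M. (SUP n. ennreal (fs n x \<omega>)) = ennreal (f x \<omega>)) \<and>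
        (AE \<omega> in M. I \<omega> = (SUP n. Is n \<omega>)))"

definition stable_nn_integral ::
    "'a measure \<Rightarrow> ('a \<Rightarrow> 'b) set \<Rightarrow> ('a, 'b) cset set \<Rightarrow> (('a, 'b) cset \<Rightarrow> 'a \<Rightarrow> ennreal) \<Rightarrow>
      (('a \<Rightarrow> 'b) \<Rightarrow> 'a \<Rightarrow> real) \<Rightarrow> 'a \<Rightarrow> ennreal"
where
  "stable_nn_integral M X \<X> \<mu> f = (SOME I. has_stable_nn_integral M X \<X> \<mu> f I)"

text \<open>The stable Borel \<open>\<sigma>\<close>-algebra on \<open>L\<^sup>0(\<real>\<^sup>d)\<close>; the type \<open>real\<close> gives \<open>\<B>(L\<^sup>0)\<close>.\<close>

definition stable_ball ::
    "'a measure \<Rightarrow> ('a \<Rightarrow> 'b::euclidean_space) \<Rightarrow> ('a \<Rightarrow> real) \<Rightarrow> ('a \<Rightarrow> 'b) set" where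
  "stable_ball M x r = {y \<in> borel_measurable M. AE \<omega> in M. norm (x \<omega> - y \<omega>) < r \<omega>}"

definition stable_borel :: "'a measure \<Rightarrow> ('a, 'b::euclidean_space) cset set" where
  "stable_borel M = \<Inter>{\<X>. stable_sigma_algebra M (borel_measurable M) \<X> \<and>
     (\<forall>x\<in>borel_measurable M. \<forall>r\<in>borel_measurable M. (AE \<omega> in M. 0 < r \<omega>) \<longrightarrow>
        crestr M (stable_ball M x r) (space M) \<in> \<X>)}"

definition stably_integrable ::
    "'a measure \<Rightarrow> ('a \<Rightarrow> 'b) set \<Rightarrow> ('a, 'b) cset set \<Rightarrow> (('a, 'b) cset \<Rightarrow> 'a \<Rightarrow> ennreal) \<Rightarrow>
      (('a \<Rightarrow> 'b) \<Rightarrow> 'a \<Rightarrow> real) \<Rightarrow> bool"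
where
  "stably_integrable M X \<X> \<mu> f \<longleftrightarrow>
     stably_measurable M X \<X> (borel_measurable M) (stable_borel M) f \<and>
     (AE \<omega> in M. stable_nn_integral M X \<X> \<mu> (\<lambda>x \<omega>. max (f x \<omega>) 0) \<omega> < \<infinity>) \<and>
     (AE \<omega> in M. stable_nn_integral M X \<X> \<mu> (\<lambda>x \<omega>. max (- f x \<omega>) 0) \<omega> < \<infinity>)"

definition stable_integral ::
    "'a measure \<Rightarrow> ('a \<Rightarrow> 'b) set \<Rightarrow> ('a, 'b) cset set \<Rightarrow> (('a, 'b) cset \<Rightarrow> 'a \<Rightarrow> ennreal) \<Rightarrow>
      (('a \<Rightarrow> 'b) \<Rightarrow> 'a \<Rightarrow> real) \<Rightarrow> 'a \<Rightarrow> real"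
where
  "stable_integral M X \<X> \<mu> f = (\<lambda>\<omega>.
     enn2real (stable_nn_integral M X \<X> \<mu> (\<lambda>x \<omega>. max (f x \<omega>) 0) \<omega>) -
     enn2real (stable_nn_integral M X \<X> \<mu> (\<lambda>x \<omega>. max (- f x \<omega>) 0) \<omega>))"

definition L0_bounded :: "'a measure \<Rightarrow> ('a \<Rightarrow> 'b::euclidean_space) set \<Rightarrow> 'a set \<Rightarrow> bool" where
  "L0_bounded M V A \<longleftrightarrow> (\<exists>K\<in>borel_measurable M. (AE \<omega> in M. 0 \<le> K \<omega>) \<and>
     (\<forall>x\<in>V. AE \<omega> in M. \<omega> \<in> A \<longrightarrow> norm (x \<omega>) \<le> K \<omega>))"

definition sequentially_closed ::
    "'a measure \<Rightarrow> ('a \<Rightarrow> 'b::euclidean_space) set \<Rightarrow> 'a set \<Rightarrow> bool" where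
  "sequentially_closed M V A \<longleftrightarrow>
     (\<forall>xs x. (\<forall>n. xs n \<in> V) \<and> x \<in> borel_measurable M \<and>
        (AE \<omega> in M. \<omega> \<in> A \<longrightarrow> (\<lambda>n. xs n \<omega>) \<longlonglongrightarrow> x \<omega>) \<longrightarrow>
        (Some \<circ> x) |` A \<in> crestr M V A)"

definition stably_compact :: "'a measure \<Rightarrow> ('a \<Rightarrow> 'b::euclidean_space) set \<Rightarrow> 'a set \<Rightarrow> bool" where
  "stably_compact M V A \<longleftrightarrow> L0_bounded M V A \<and> sequentially_closed M V A"

definition conditionally_regular ::
    "'a measure \<Rightarrow> (('a, 'b::euclidean_space) cset \<Rightarrow> 'a \<Rightarrow> ennreal) \<Rightarrow> bool" where
  "conditionally_regular M \<mu> \<longleftrightarrow>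
     (\<forall>P\<in>stable_borel M. is_ess_Sup M
        {\<mu> (crestr M W B) |W B. cond_pair M (borel_measurable M) W B \<and>
           crestr M W B \<in> stable_borel M \<and> cond_le M (borel_measurable M) (crestr M W B) P \<and>
           stably_compact M W B}
        (\<mu> P))"

definition stable_seq_continuous ::
    "'a measure \<Rightarrow> (('a \<Rightarrow> 'b::euclidean_space) \<Rightarrow> 'a \<Rightarrow> real) set" where
  "stable_seq_continuous M =
     {f. stable_fun M (borel_measurable M) (borel_measurable M) f \<and>
         (\<forall>xs x. (\<forall>n. xs n \<in> borel_measurable M) \<and> x \<in> borel_measurable M \<and>
            (AE \<omega> in M. (\<lambda>n. xs n \<omega>) \<longlonglongrightarrow> x \<omega>) \<longrightarrow>
            (AE \<omega> in M. (\<lambda>n. f (xs n) \<omega>) \<longlonglongrightarrow> f x \<omega>))}"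

text \<open>Here \<open>g\<close> is (a version of) the function \<open>\<Sum>f\<^sub>k|A\<^sub>k\<close>. With the trivial partition the
  condition says that \<open>L\<close> respects the identification of functions in \<open>\<C>\<close>.\<close>

definition stable_functional ::
    "'a measure \<Rightarrow> (('a \<Rightarrow> 'b::euclidean_space) \<Rightarrow> 'a \<Rightarrow> real) set \<Rightarrow>
      ((('a \<Rightarrow> 'b) \<Rightarrow> 'a \<Rightarrow> real) \<Rightarrow> 'a \<Rightarrow> real) \<Rightarrow> bool"
where
  "stable_functional M \<C> L \<longleftrightarrow>
     (\<forall>A f g. is_partition M A \<and> (\<forall>k. f k \<in> \<C>) \<and> g \<in> \<C> \<and>
        (\<forall>x\<in>borel_measurable M. is_concat M A (\<lambda>k. f k x) (g x)) \<longrightarrow>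
        is_concat M A (\<lambda>k. L (f k)) (L g))"

definition L0_linear ::
    "'a measure \<Rightarrow> (('a \<Rightarrow> 'b::euclidean_space) \<Rightarrow> 'a \<Rightarrow> real) set \<Rightarrow>
      ((('a \<Rightarrow> 'b) \<Rightarrow> 'a \<Rightarrow> real) \<Rightarrow> 'a \<Rightarrow> real) \<Rightarrow> bool"
where
  "L0_linear M \<C> L \<longleftrightarrow>
     (\<forall>f\<in>\<C>. \<forall>g\<in>\<C>. \<forall>r\<in>borel_measurable M.
        AE \<omega> in M. L (\<lambda>x \<omega>. f x \<omega> + r \<omega> * g x \<omega>) \<omega> = L f \<omega> + r \<omega> * L g \<omega>)"

end

theory Submission
  imports Defs
begin

text \<open>
  A conditional subset of \<open>L\<^sup>0(\<real>\<^sup>d)\<close> is determined by its local sections, the pairs \<open>(A, x)\<close> with \<open>x|A\<close>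
  in it. A set \<open>G\<close> in \<open>\<F> \<otimes> borel\<close> defines the conditional set of all \<open>x|A\<close> whose graph lies in \<open>G\<close> over
  \<open>A\<close>. This assignment respects countable unions, complements and concatenations, and its range is the
  stable Borel \<open>\<sigma>\<close>-algebra. It forgets exactly the sets that contain no measurable graph over
  an event of positive probability.

  Compactness enters once: if \<open>f\<^sub>n(x)\<close> decreases to \<open>0\<close> a.s. for every \<open>x\<close>, then a nested random choice
  among the points of a countable dense set shows that the convergence is uniform on balls, and as
  \<open>f\<^sub>n \<le> f\<^sub>0 \<parallel>\<cdot>\<parallel>/R\<close> outside the ball of radius \<open>R\<close>, \<open>L f\<^sub>n\<close> decreases to \<open>0\<close>. Hence \<open>F \<mapsto> E[L F / (1 + \<bar>L 1\<bar>)]\<close>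
  is a Daniell functional on jointly measurable versions of bounded \<open>F \<in> \<C>\<close>. It extends to a measure \<open>m\<close> on
  \<open>\<Omega> \<times> \<real>\<^sup>d\<close>, for which sets without measurable graphs are null. The stable measure of the conditional set
  of \<open>G\<close> is the Radon-Nikodym density of \<open>A \<mapsto> m(G \<inter> (A \<times> \<real>\<^sup>d))\<close> with respect to
  the measure with density \<open>1 / (1 + \<bar>L 1\<bar>)\<close>.
\<close>

section \<open>The Daniell extension theorem\<close>

text \<open>\<open>L f\<close> is determined only up to a null set depending on \<open>f\<close>,
  and there are uncountably many \<open>f\<close>, so a representation separately for each \<omega>
  is out of reach; integrating over the probability space leaves one real functional. The weight
  makes this integral finite although \<open>L 1\<close> may fail to be integrable, and being
  positive it keeps the null sets of \<open>M\<close>. A second obstacle: elements of the function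
  space act on whole random points and are not given as functions of a pair (\<omega>, y). Stability
  makes them local on random points with countably many values, and continuity carries this over to
  all, which yields a jointly measurable version. Finally, hypotheses are available only along
  random points. Continuity at \<open>0\<close> is therefore proved for convergence along random
  points, which is weaker than convergence on the product. It serves three times: for the condition
  of Daniell, for the null sets without graphs, and for passing from bounded to unbounded functions.
  Outer regularity by cozero sets, inherited from the Daniell construction, gives the null sets as
  well as conditional regularity.\<close>

locale daniell_functional =
  fixes S :: "'x set" and H :: "('x \<Rightarrow> real) set" and I :: "('x \<Rightarrow> real) \<Rightarrow> real"
  assumes H_const: "(\<lambda>_. c) \<in> H"
    and H_add: "f \<in> H \<Longrightarrow> g \<in> H \<Longrightarrow> (\<lambda>x. f x + g x) \<in> H"
    and H_scale: "f \<in> H \<Longrightarrow> (\<lambda>x. c * f x) \<in> H"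
    and H_max: "f \<in> H \<Longrightarrow> g \<in> H \<Longrightarrow> (\<lambda>x. max (f x) (g x)) \<in> H"
    and H_UN: "(\<And>n::nat. F n \<in> H) \<Longrightarrow> \<exists>g\<in>H. \<forall>x\<in>S. 0 < g x \<longleftrightarrow> (\<exists>n. 0 < F n x)"
    and I_add: "f \<in> H \<Longrightarrow> g \<in> H \<Longrightarrow> I (\<lambda>x. f x + g x) = I f + I g"
    and I_scale: "f \<in> H \<Longrightarrow> I (\<lambda>x. c * f x) = c * I f"
    and I_nonneg: "f \<in> H \<Longrightarrow> (\<And>x. x \<in> S \<Longrightarrow> 0 \<le> f x) \<Longrightarrow> 0 \<le> I f"
    and I_cont: "(\<And>n::nat. F n \<in> H) \<Longrightarrow> (\<And>n x. x \<in> S \<Longrightarrow> F (Suc n) x \<le> F n x) \<Longrightarrow>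
       (\<And>x. x \<in> S \<Longrightarrow> (\<lambda>n. F n x) \<longlonglongrightarrow> 0) \<Longrightarrow> (\<lambda>n. I (F n)) \<longlonglongrightarrow> 0"
begin

lemma H_diff: "f \<in> H \<Longrightarrow> g \<in> H \<Longrightarrow> (\<lambda>x. f x - g x) \<in> H"
  using H_add[of f "\<lambda>x. -1 * g x"] H_scale[of g "-1"] by simp

lemma I_diff: "f \<in> H \<Longrightarrow> g \<in> H \<Longrightarrow> I (\<lambda>x. f x - g x) = I f - I g"
  using I_add[of f "\<lambda>x. -1 * g x"] I_scale[of g "-1"] H_scale[of g "-1"] by simp

lemma H_min: "f \<in> H \<Longrightarrow> g \<in> H \<Longrightarrow> (\<lambda>x. min (f x) (g x)) \<in> H"
proof -
  assume "f \<in> H" "g \<in> H"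
  then have "(\<lambda>x. -1 * max (-1 * f x) (-1 * g x)) \<in> H" by (intro H_scale H_max)
  moreover have "(\<lambda>x. -1 * max (-1 * f x) (-1 * g x)) = (\<lambda>x. min (f x) (g x))"
    by (auto simp: fun_eq_iff min_def max_def)
  ultimately show ?thesis by simp
qed

lemma I_mono: "f \<in> H \<Longrightarrow> g \<in> H \<Longrightarrow> (\<And>x. x \<in> S \<Longrightarrow> f x \<le> g x) \<Longrightarrow> I f \<le> I g"
  using I_nonneg[of "\<lambda>x. g x - f x"] H_diff[of g f] I_diff[of g f] by simp

lemma H_sum: "(\<And>i. i < (n::nat) \<Longrightarrow> F i \<in> H) \<Longrightarrow> (\<lambda>x. \<Sum>i<n. F i x) \<in> H"
  by (induction n) (auto intro: H_const H_add)

lemma I_zero: "I (\<lambda>_. 0) = 0"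
  using I_scale[of "\<lambda>_. 0" 0] H_const by simp

lemma I_sum: "(\<And>i. i < (n::nat) \<Longrightarrow> F i \<in> H) \<Longrightarrow> I (\<lambda>x. \<Sum>i<n. F i x) = (\<Sum>i<n. I (F i))"
  by (induction n) (auto simp: I_add H_sum I_zero)

section \<open>The outer measure generated by cozero sets\<close>

definition coz :: "('x \<Rightarrow> real) \<Rightarrow> 'x set" where
  "coz f = {x \<in> S. 0 < f x}"

text \<open>The construction follows the Riesz representation theorem, with the cozero sets of
  \<open>H\<close> in the place of the open sets; \<open>H_min\<close> and \<open>H_UN\<close> close
  them under finite intersections and countable unions.\<close>

definition inner :: "'x set \<Rightarrow> ennreal" where
  "inner U = (SUP g \<in> {g \<in> H. \<forall>x\<in>S. 0 \<le> g x \<and> g x \<le> indicator U x}. ennreal (I g))"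

definition outer :: "'x set \<Rightarrow> ennreal" where
  "outer E = (INF f \<in> {f \<in> H. E \<subseteq> coz f}. inner (coz f))"

lemma innerI: "g \<in> H \<Longrightarrow> (\<And>x. x \<in> S \<Longrightarrow> 0 \<le> g x) \<Longrightarrow> (\<And>x. x \<in> S \<Longrightarrow> g x \<le> indicator U x) \<Longrightarrow>
    ennreal (I g) \<le> inner U"
  unfolding inner_def by (rule SUP_upper) auto

lemma inner_mono: "U \<subseteq> V \<Longrightarrow> inner U \<le> inner V"
  unfolding inner_def
  by (intro SUP_subset_mono order.refl Collect_mono) (meson indicator_leI order.trans subsetD)

lemma outer_coz: "f \<in> H \<Longrightarrow> outer (coz f) = inner (coz f)"
  unfolding outer_def by (rule antisym) (auto intro!: INF_lower INF_greatest inner_mono)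

lemma outer_mono: "E \<subseteq> E' \<Longrightarrow> outer E \<le> outer E'"
  unfolding outer_def by (rule INF_superset_mono) auto

lemma inner_le: "inner U \<le> ennreal (I (\<lambda>_. 1))"
  unfolding inner_def
  by (rule SUP_least, rule ennreal_leI, rule I_mono)
     (auto intro: H_const order.trans[OF _ indicator_le_1])

lemma outer_finite: "E \<subseteq> S \<Longrightarrow> outer E < \<infinity>"
proof -
  assume "E \<subseteq> S"
  then have "outer E \<le> inner (coz (\<lambda>_. 1))"
    unfolding outer_def by (intro INF_lower) (auto simp: H_const coz_def)
  also have "\<dots> \<le> ennreal (I (\<lambda>_. 1))" by (rule inner_le)
  finally show ?thesis by (simp add: order_le_less_trans)
qed

lemma coz_empty: "inner {} = 0"
proof -
  have "inner {} \<le> ennreal (I (\<lambda>_. 0))"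
    unfolding inner_def by (rule SUP_least, rule ennreal_leI, rule I_mono) (auto intro: H_const)
  then show ?thesis by (simp add: I_zero)
qed

text \<open>A test function below the union is the increasing limit of functions dominated by finite
  sums of test functions of the single sets; \<open>I_cont\<close>, applied to the differences, lets
  \<open>I\<close> pass to the limit.\<close>

lemma inner_UN:
  assumes "\<And>i::nat. F i \<in> H"
  shows "inner (\<Union>i. coz (F i)) \<le> (\<Sum>i. inner (coz (F i)))"
  unfolding inner_def[of "\<Union>i. coz (F i)"]
proof (rule SUP_least, safe)
  fix g assume g: "g \<in> H" and gb: "\<forall>x\<in>S. 0 \<le> g x \<and> g x \<le> indicator (\<Union>i. coz (F i)) x"
  \<comment> \<open>\<open>h k i\<close> increases with \<open>k\<close> to the indicator of
    \<open>coz (F i)\<close>. The same \<open>k\<close> is slope and number of summands, so that one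
    limit suffices.\<close>
  define h where "h k i x = min 1 (real k * max 0 (F i x))" for k i x
  define G where "G k x = min (g x) (\<Sum>i<k. h k i x)" for k x
  have hH: "h k i \<in> H" for k i unfolding h_def by (intro H_min H_const H_scale H_max assms)
  have GH: "G k \<in> H" for k unfolding G_def by (intro H_min g H_sum hH)
  have h0: "0 \<le> h k i x" for k i x unfolding h_def by auto
  have hmono: "h k i x \<le> h (Suc k) i x" for k i x
    unfolding h_def by (intro min.mono mult_right_mono) auto
  have Gmono: "G k x \<le> G (Suc k) x" for k x
    unfolding G_def
    by (intro min.mono order.refl, simp, intro add_increasing2 sum_mono hmono h0)
  have Glim: "(\<lambda>k. G k x) \<longlonglongrightarrow> g x" if x: "x \<in> S" for x
  proof (cases "\<exists>i. x \<in> coz (F i)")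
    case False
    then have "g x = 0" using gb x by (metis UN_iff indicator_simps(2) order_antisym)
    then have "G k x = 0" for k unfolding G_def by (simp add: min_def sum_nonneg h0 antisym)
    with \<open>g x = 0\<close> show ?thesis by simp
  next
    case True
    then obtain i where i: "0 < F i x" by (auto simp: coz_def)
    have "eventually (\<lambda>k. G k x = g x) sequentially"
    proof (rule eventually_sequentiallyI)
      fix k assume k: "max (Suc i) (nat \<lceil>1 / F i x\<rceil>) \<le> k"
      then have "1 / F i x \<le> real k" by linarith
      then have "1 \<le> real k * F i x" using i by (simp add: field_simps)
      then have "h k i x = 1" unfolding h_def using i by auto
      then have "1 \<le> (\<Sum>i<k. h k i x)"
        using member_le_sum[of i "{..<k}" "\<lambda>i. h k i x"] k h0 by auto
      moreover have "g x \<le> 1" using gb x by (meson indicator_le_1 order.trans)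
      ultimately show "G k x = g x" unfolding G_def by auto
    qed
    then show ?thesis by (rule tendsto_eventually)
  qed
  have "(\<lambda>k. I (\<lambda>x. g x - G k x)) \<longlonglongrightarrow> 0"
    by (rule I_cont) (auto intro!: H_diff g GH Gmono tendsto_eq_intros Glim)
  then have "(\<lambda>k. I g - I (G k)) \<longlonglongrightarrow> 0" by (simp add: I_diff g GH)
  then have "(\<lambda>k. I g - (I g - I (G k))) \<longlonglongrightarrow> I g - 0" by (intro tendsto_intros)
  then have lim: "(\<lambda>k. ennreal (I (G k))) \<longlonglongrightarrow> ennreal (I g)" by simp
  show "ennreal (I g) \<le> (\<Sum>i. inner (coz (F i)))"
  proof (rule LIMSEQ_le_const2[OF lim], intro exI allI impI)
    fix k :: nat
    have "ennreal (I (G k)) \<le> ennreal (\<Sum>i<k. I (h k i))"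
      unfolding I_sum[OF hH, symmetric]
      by (intro ennreal_leI I_mono GH H_sum hH) (simp add: G_def)
    also have "\<dots> = (\<Sum>i<k. ennreal (I (h k i)))"
      by (rule sum_ennreal[symmetric]) (auto intro: I_nonneg hH h0)
    also have "\<dots> \<le> (\<Sum>i<k. inner (coz (F i)))"
      by (intro sum_mono innerI hH h0) (auto simp: h_def coz_def indicator_def)
    also have "\<dots> \<le> (\<Sum>i. inner (coz (F i)))" by (rule sum_le_suminf) auto
    finally show "ennreal (I (G k)) \<le> (\<Sum>i. inner (coz (F i)))" .
  qed
qed

lemma outer_approx:
  assumes "E \<subseteq> S" and "0 < e"
  shows "\<exists>f\<in>H. E \<subseteq> coz f \<and> inner (coz f) \<le> outer E + ennreal e"
proof -
  have "outer E < outer E + ennreal e"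
    using outer_finite[OF assms(1)] assms(2) by (simp add: ennreal_add_left_cancel_less[of "outer E" 0, simplified])
  then obtain f where "f \<in> H" "E \<subseteq> coz f" "inner (coz f) < outer E + ennreal e"
    unfolding outer_def by (subst (asm) (1) INF_less_iff) auto
  then show ?thesis by (auto intro: less_imp_le)
qed

lemma coz_UN: "(\<And>i::nat. F i \<in> H) \<Longrightarrow> \<exists>g\<in>H. coz g = (\<Union>i. coz (F i))"
  using H_UN[of F] unfolding coz_def by fastforce

lemma outer_measure_space_outer: "outer_measure_space (Pow S) outer"
  unfolding outer_measure_space_def
proof (intro conjI)
  have "outer {} = inner {}" using outer_coz[OF H_const[of 0]] by (simp add: coz_def)
  then show "positive (Pow S) outer" by (simp add: positive_def coz_empty)
  show "increasing (Pow S) outer" by (auto simp: increasing_def intro: outer_mono)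
  show "countably_subadditive (Pow S) outer"
    unfolding countably_subadditive_def
  proof (intro allI impI)
    fix A :: "nat \<Rightarrow> 'x set" assume A: "range A \<subseteq> Pow S"
    show "outer (\<Union>i. A i) \<le> (\<Sum>i. outer (A i))"
    proof (rule ennreal_le_epsilon)
      fix e :: real assume e: "0 < e"
      have "\<exists>f\<in>H. A i \<subseteq> coz f \<and> inner (coz f) \<le> outer (A i) + ennreal (e * (1/2)^Suc i)" for i
        using A e by (intro outer_approx) auto
      then obtain F where F: "\<And>i. F i \<in> H" "\<And>i. A i \<subseteq> coz (F i)"
        "\<And>i. inner (coz (F i)) \<le> outer (A i) + ennreal (e * (1/2)^Suc i)"
        by metis
      obtain g where g: "g \<in> H" "coz g = (\<Union>i. coz (F i))" using coz_UN F(1) by blast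
      have "outer (\<Union>i. A i) \<le> outer (coz g)" using F(2) g by (intro outer_mono) auto
      also have "\<dots> \<le> (\<Sum>i. inner (coz (F i)))"
        unfolding outer_coz[OF g(1)] unfolding g(2) by (rule inner_UN[OF F(1)])
      also have "\<dots> \<le> (\<Sum>i. outer (A i) + ennreal (e * (1/2)^Suc i))"
        by (intro suminf_le F(3)) auto
      also have "\<dots> = (\<Sum>i. outer (A i)) + (\<Sum>i. ennreal (e * (1/2)^Suc i))"
        by (rule suminf_add[symmetric]) auto
      also have "(\<Sum>i. ennreal (e * (1/2)^Suc i)) = ennreal e"
        using e sums_mult[OF power_half_series, of e]
        by (intro suminf_ennreal_eq) (auto intro!: mult_nonneg_nonneg)
      finally show "outer (\<Union>i. A i) \<le> (\<Sum>i. outer (A i)) + ennreal e" .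
    qed
  qed
qed

section \<open>Caratheodory measurability of cozero sets\<close>

text \<open>A test function \<open>f\<close> of \<open>coz u \<inter> coz v\<close> may leave no
  room for test functions on the part of \<open>coz v\<close> outside \<open>coz u\<close>. Lowering
  it by a level \<open>d\<close> makes room: its support becomes disjoint from a cozero set that
  contains the rest of \<open>E\<close>, at a cost of at most
  \<open>d * I (\<lambda>_. 1)\<close>.\<close>

lemma coz_in_lambda_system:
  assumes u: "u \<in> H"
  shows "coz u \<in> lambda_system S (Pow S) outer"
  unfolding lambda_system_def
proof (safe)
  fix x assume "x \<in> coz u" then show "x \<in> S" by (simp add: coz_def)
next
  fix E assume E: "E \<subseteq> S"
  show "outer (coz u \<inter> E) + outer ((S - coz u) \<inter> E) = outer E"
  proof (rule antisym)
    have sub: "subadditive (Pow S) outer"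
      using outer_measure_space_outer ring_of_sets.countably_subadditive_subadditive[of S "Pow S" outer]
      by (auto simp: outer_measure_space_def ring_of_sets_Pow)
    have "outer E = outer ((coz u \<inter> E) \<union> ((S - coz u) \<inter> E))"
      using E by (intro arg_cong[where f=outer]) auto
    also have "\<dots> \<le> outer (coz u \<inter> E) + outer ((S - coz u) \<inter> E)"
      by (rule subadditiveD[OF sub]) (use E in auto)
    finally show "outer E \<le> outer (coz u \<inter> E) + outer ((S - coz u) \<inter> E)" .
    show "outer (coz u \<inter> E) + outer ((S - coz u) \<inter> E) \<le> outer E"
      unfolding outer_def[of E]
    proof (rule INF_greatest, safe)
      fix v assume v: "v \<in> H" and Ev: "E \<subseteq> coz v"
      define w where "w x = min (u x) (v x)" for x
      have w: "w \<in> H" unfolding w_def by (intro H_min u v)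
      have cw: "coz w = coz u \<inter> coz v" unfolding coz_def w_def by auto
      have *: "ennreal (I f) + outer ((S - coz u) \<inter> E) \<le> inner (coz v)"
        if f: "f \<in> H" "\<And>x. x \<in> S \<Longrightarrow> 0 \<le> f x" "\<And>x. x \<in> S \<Longrightarrow> f x \<le> indicator (coz w) x" for f
      proof (rule ennreal_le_epsilon)
        fix e :: real assume e: "0 < e"
        \<comment> \<open>The summand \<open>1\<close> in the denominator covers the case that the
          total mass is \<open>0\<close>.\<close>
        define d where "d = e / (I (\<lambda>_. 1) + 1)"
        have I1: "0 \<le> I (\<lambda>_. 1)" by (rule I_nonneg) (auto intro: H_const)
        have d: "0 < d" "d * I (\<lambda>_. 1) \<le> e"
          using e I1 by (auto simp: d_def field_simps add_pos_nonneg add_nonneg_pos)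
        \<comment> \<open>\<open>z\<close> is positive only where \<open>f < d\<close>, and
          \<open>fd\<close> below only where \<open>f > d\<close>; so a test function of
          \<open>coz z\<close> added to \<open>fd\<close> stays below the indicator of
          \<open>coz v\<close>.\<close>
        define z where "z x = min (v x) (max 0 (d - f x))" for x
        have z: "z \<in> H" unfolding z_def by (intro H_min H_max H_diff H_const f v)
        define fd where "fd x = max 0 (f x - d)" for x
        have fd: "fd \<in> H" unfolding fd_def by (intro H_max H_diff H_const f)
        have le: "ennreal (I fd) + inner (coz z) \<le> inner (coz v)"
          unfolding inner_def[of "coz z"]
        proof (subst ennreal_SUP_add_right)
          show "{g \<in> H. \<forall>x\<in>S. 0 \<le> g x \<and> g x \<le> indicator (coz z) x} \<noteq> {}"
            using H_const[of 0] by force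
          show "(SUP g \<in> {g \<in> H. \<forall>x\<in>S. 0 \<le> g x \<and> g x \<le> indicator (coz z) x}. ennreal (I fd) + ennreal (I g)) \<le> inner (coz v)"
          proof (rule SUP_least, safe)
            fix g assume g: "g \<in> H" "\<forall>x\<in>S. 0 \<le> g x \<and> g x \<le> indicator (coz z) x"
            have "ennreal (I fd) + ennreal (I g) = ennreal (I (\<lambda>x. fd x + g x))"
              using g by (subst ennreal_plus[symmetric]) (auto simp: I_add fd intro!: I_nonneg, simp add: fd_def)
            also have "\<dots> \<le> inner (coz v)"
            proof (rule innerI)
              show "(\<lambda>x. fd x + g x) \<in> H" by (intro H_add fd g)
              fix x assume x: "x \<in> S"
              show "0 \<le> fd x + g x" using g x by (auto simp: fd_def)
              have "f x \<le> indicator (coz w) x" "0 \<le> f x" "g x \<le> indicator (coz z) x" "0 \<le> g x"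
                using f g x by auto
              then show "fd x + g x \<le> indicator (coz v) x"
                using x d by (cases "0 < v x"; cases "0 < u x"; cases "f x < d")
                  (auto simp: w_def fd_def z_def coz_def indicator_def)
            qed
            finally show "ennreal (I fd) + ennreal (I g) \<le> inner (coz v)" .
          qed
        qed
        have "(S - coz u) \<inter> E \<subseteq> coz z"
        proof
          fix x assume x: "x \<in> (S - coz u) \<inter> E"
          then have "f x \<le> indicator (coz w) x" "x \<notin> coz w" "0 < v x" "x \<in> S"
            using f(3)[of x] Ev by (auto simp: cw, auto simp: coz_def)
          then show "x \<in> coz z" using d by (auto simp: coz_def z_def)
        qed
        then have "outer ((S - coz u) \<inter> E) \<le> inner (coz z)"
          using outer_mono[of _ "coz z"] outer_coz[OF z] by auto
        moreover have "I f \<le> I fd + e"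
        proof -
          have "I f \<le> I (\<lambda>x. fd x + d * 1)"
            by (intro I_mono f H_add fd H_const) (auto simp: fd_def)
          also have "\<dots> = I fd + d * I (\<lambda>_. 1)"
            using I_scale[OF H_const, of d 1] I_add[OF fd H_const, of d] by simp
          finally show ?thesis using d by linarith
        qed
        then have "ennreal (I f) \<le> ennreal (I fd) + ennreal e"
          using e I_nonneg[OF fd] ennreal_leI[of "I f" "I fd + e"] by (simp add: fd_def)
        ultimately have "ennreal (I f) + outer ((S - coz u) \<inter> E) \<le> (ennreal (I fd) + ennreal e) + inner (coz z)"
          by (intro add_mono)
        also have "\<dots> = (ennreal (I fd) + inner (coz z)) + ennreal e" by (simp add: ac_simps)
        also have "\<dots> \<le> inner (coz v) + ennreal e" by (intro add_mono le order.refl)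
        finally show "ennreal (I f) + outer ((S - coz u) \<inter> E) \<le> inner (coz v) + ennreal e" .
      qed
      have "outer (coz u \<inter> E) \<le> inner (coz w)"
        using outer_mono[of _ "coz w"] outer_coz[OF w] Ev cw by (metis inf_mono order.refl)
      then have "outer (coz u \<inter> E) + outer ((S - coz u) \<inter> E) \<le> inner (coz w) + outer ((S - coz u) \<inter> E)"
        by (intro add_mono) auto
      also have "\<dots> \<le> inner (coz v)"
        unfolding inner_def[of "coz w"]
      proof (subst ennreal_SUP_add_left[symmetric], goal_cases)
        case 1 show ?case using H_const[of 0] by force
      next
        case 2 show ?case by (rule SUP_least) (auto intro!: *)
      qed
      finally show "outer (coz u \<inter> E) + outer ((S - coz u) \<inter> E) \<le> inner (coz v)" .
    qed
  qed
qed

text \<open>The integral formula rests on one inequality, applied to \<open>f\<close> and to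
  \<open>1 - f\<close>. The last conjunct, outer regularity by cozero sets, is inherited from the
  definition of \<open>outer\<close>.\<close>

theorem daniell:
  "\<exists>m. space m = S \<and> sets m = sigma_sets S (coz ` H) \<and> finite_measure m \<and>
     (\<forall>f\<in>H. (\<forall>x\<in>S. 0 \<le> f x \<and> f x \<le> 1) \<longrightarrow> (\<integral>\<^sup>+x. ennreal (f x) \<partial>m) = ennreal (I f)) \<and>
     (\<forall>E\<in>sets m. \<forall>e>0. \<exists>f\<in>H. E \<subseteq> coz f \<and> emeasure m (coz f) \<le> emeasure m E + ennreal e)"
proof -
  define L where "L = lambda_system S (Pow S) outer"
  have ms: "measure_space S L outer"
    unfolding L_def
    by (rule sigma_algebra.caratheodory_lemma[OF sigma_algebra_Pow outer_measure_space_outer])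
  have saL: "sigma_algebra S L" using ms by (simp add: measure_space_def)
  have cozL: "coz ` H \<subseteq> L" using coz_in_lambda_system by (auto simp: L_def)
  have cozS: "coz ` H \<subseteq> Pow S" by (auto simp: coz_def)
  have sub: "sigma_sets S (coz ` H) \<subseteq> L"
    by (rule sigma_algebra.sigma_sets_subset[OF saL cozL])
  have ms': "measure_space S (sigma_sets S (coz ` H)) outer"
    by (rule measure_down[OF ms sigma_algebra_sigma_sets[OF cozS] sub])
  define m where "m = measure_of S (coz ` H) outer"
  have sp: "space m = S" and st: "sets m = sigma_sets S (coz ` H)"
    unfolding m_def using cozS by (auto simp: space_measure_of sets_measure_of)
  have em: "emeasure m E = outer E" if "E \<in> sets m" for E
    unfolding m_def
    using that ms' cozS st
    by (intro emeasure_measure_of) (auto simp: m_def[symmetric] measure_space_def)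
  have cozm: "coz f \<in> sets m" if "f \<in> H" for f using that st by auto
  have fin: "finite_measure m"
    by (rule finite_measureI) (use em[OF sets.top] outer_finite[of S] sp in auto)
  have meas: "f \<in> borel_measurable m" if "f \<in> H" for f
  proof (rule borel_measurableI_greater)
    fix y
    have "{x \<in> space m. y < f x} = coz (\<lambda>x. f x - y)" by (auto simp: sp coz_def)
    then show "{x \<in> space m. y < f x} \<in> sets m" using cozm H_diff[OF that H_const] by simp
  qed
  have eS: "emeasure m S = ennreal (I (\<lambda>_. 1))"
  proof -
    have "S = coz (\<lambda>_. 1)" by (auto simp: coz_def)
    then have "emeasure m S = inner S" using em cozm outer_coz H_const by metis
    moreover have "ennreal (I (\<lambda>_. 1)) \<le> inner S" by (rule innerI) (auto intro: H_const)
    ultimately show ?thesis using inner_le antisym by metis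
  qed
  \<comment> \<open>Layer cake: \<open>n * f\<close> is a sum of slices \<open>s k\<close> of height
    \<open>1\<close>, each with \<open>I (s k)\<close> at most the mass of the level set
    \<open>c k\<close>; the number of level sets that contain a point exceeds \<open>n * f\<close>
    by at most \<open>1\<close>, an error that disappears after division by
    \<open>n\<close>.\<close>
  have le: "I f \<le> (\<integral>x. f x \<partial>m)" if f: "f \<in> H" and fb: "\<forall>x\<in>S. 0 \<le> f x \<and> f x \<le> 1" for f
  proof -
    interpret finite_measure m by fact
    have ib: "integrable m g" if "g \<in> borel_measurable m" "\<And>x. x \<in> S \<Longrightarrow> 0 \<le> g x \<and> g x \<le> 2" for g :: "'x \<Rightarrow> real"
      by (rule integrable_const_bound[where B=2]) (use that sp in \<open>auto intro!: AE_I2\<close>)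
    have "I f \<le> (\<integral>x. f x \<partial>m) + (1 / real n) * measure m S" if n: "0 < n" for n :: nat
    proof -
      define s where "s k x = min (max 0 (real n * f x - real k)) 1" for k x
      have sH: "s k \<in> H" for k unfolding s_def by (intro H_min H_max H_diff H_scale H_const f)
      have sum_s: "(\<Sum>k<j. s k x) = min (real n * f x) (real j)" if "x \<in> S" for x j
      proof (induction j)
        case 0 then show ?case using fb that by simp
      next
        case (Suc j) then show ?case by (auto simp: s_def min_def max_def)
      qed
      define c where "c k = coz (\<lambda>x. real n * f x - real k)" for k
      have cm: "c k \<in> sets m" for k unfolding c_def by (intro cozm H_diff H_scale H_const f)
      have "real n * I f = I (\<lambda>x. real n * f x)" using f by (simp add: I_scale)
      also have "\<dots> \<le> I (\<lambda>x. \<Sum>k<n. s k x)"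
        by (intro I_mono H_scale H_sum f sH) (use sum_s fb in \<open>auto simp: mult_left_le\<close>)
      also have "\<dots> = (\<Sum>k<n. I (s k))" by (rule I_sum) (rule sH)
      also have "\<dots> \<le> (\<Sum>k<n. measure m (c k))"
      proof (rule sum_mono)
        fix k
        have "ennreal (I (s k)) \<le> inner (c k)"
          by (intro innerI sH) (auto simp: s_def c_def coz_def indicator_def)
        also have "\<dots> = emeasure m (c k)"
          using em[OF cm, of k] outer_coz unfolding c_def by (simp add: H_diff H_scale H_const f)
        also have "\<dots> = ennreal (measure m (c k))" by (simp add: emeasure_eq_measure)
        finally show "I (s k) \<le> measure m (c k)" by (simp add: ennreal_le_iff)
      qed
      also have "\<dots> = (\<integral>x. (\<Sum>k<n. indicator (c k) x) \<partial>m)"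
        by (subst Bochner_Integration.integral_sum) (auto simp: cm emeasure_eq_measure)
      also have "\<dots> \<le> (\<integral>x. real n * f x + 1 \<partial>m)"
      proof (rule integral_mono)
        show "integrable m (\<lambda>x. \<Sum>k<n. indicator (c k) x :: real)"
          by (auto intro!: Bochner_Integration.integrable_sum simp: cm emeasure_eq_measure)
        show "integrable m (\<lambda>x. real n * f x + 1)"
          using ib[OF meas[OF f]] fb by (fastforce intro: order.trans)
        fix x assume "x \<in> space m"
        then have x: "x \<in> S" by (simp add: sp)
        \<comment> \<open>Induction on the number \<open>j\<close> of levels: at a point of
          \<open>c j\<close> the trivial count \<open>j + 1\<close> is already small enough.\<close>
        have "(\<Sum>k<j. indicator (c k) x) \<le> real n * f x + 1" for j
        proof (induction j)
          case 0 then show ?case using fb x by simp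
        next
          case (Suc j)
          show ?case
          proof (cases "x \<in> c j")
            case True
            have "(\<Sum>k<Suc j. indicator (c k) x) \<le> (\<Sum>k<Suc j. 1::real)"
              by (rule sum_mono) (auto simp: indicator_def)
            also have "\<dots> = real j + 1" by simp
            also have "\<dots> \<le> real n * f x + 1" using True by (auto simp: c_def coz_def)
            finally show ?thesis .
          qed (use Suc in simp)
        qed
        then show "(\<Sum>k<n. indicator (c k) x) \<le> real n * f x + 1" .
      qed
      also have "\<dots> = real n * (\<integral>x. f x \<partial>m) + measure m S"
        using ib[OF meas[OF f]] fb sp by (fastforce intro: order.trans)
      finally show ?thesis using n by (simp add: field_simps)
    qed
    then have "eventually (\<lambda>n. I f \<le> (\<integral>x. f x \<partial>m) + (1 / real n) * measure m S) sequentially"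
      by (intro eventually_sequentiallyI[of 1]) auto
    moreover have "(\<lambda>n. (\<integral>x. f x \<partial>m) + (1 / real n) * measure m S) \<longlonglongrightarrow> (\<integral>x. f x \<partial>m) + 0 * measure m S"
      by (intro tendsto_intros lim_1_over_n)
    ultimately show ?thesis
      using tendsto_lowerbound[of _ "(\<integral>x. f x \<partial>m) + 0 * measure m S" sequentially "I f"] by simp
  qed
  have eq: "(\<integral>\<^sup>+x. ennreal (f x) \<partial>m) = ennreal (I f)"
    if f: "f \<in> H" and fb: "\<forall>x\<in>S. 0 \<le> f x \<and> f x \<le> 1" for f
  proof -
    interpret finite_measure m by fact
    have int: "integrable m f"
      by (rule integrable_const_bound[where B=1]) (use fb sp meas[OF f] in \<open>auto intro!: AE_I2\<close>)
    \<comment> \<open>The converse inequality is the previous one for \<open>1 - f\<close>, as the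
      total masses agree.\<close>
    have "I (\<lambda>x. 1 - f x) \<le> (\<integral>x. 1 - f x \<partial>m)"
      by (rule le) (use fb in \<open>auto intro: H_diff H_const f\<close>)
    also have "\<dots> = I (\<lambda>_. 1) - (\<integral>x. f x \<partial>m)"
      using int eS I_nonneg[OF H_const, of 1] sp by (simp add: emeasure_eq_measure)
    finally have "(\<integral>x. f x \<partial>m) \<le> I f" by (simp add: I_diff H_const f)
    with le[OF f fb] have "(\<integral>x. f x \<partial>m) = I f" by simp
    then show ?thesis using int fb sp by (subst nn_integral_eq_integral) (auto intro!: AE_I2)
  qed
  have reg: "\<exists>f\<in>H. E \<subseteq> coz f \<and> emeasure m (coz f) \<le> emeasure m E + ennreal e"
    if "E \<in> sets m" "0 < e" for E e
    using outer_approx[of E e] that em cozm outer_coz sets.sets_into_space[OF that(1)] sp by auto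
  show ?thesis
    by (rule exI[of _ m]) (use sp st fin eq reg in auto)
qed

end

section \<open>Conditional integrals\<close>

text \<open>A conditional expectation of \<open>g\<close> given the first coordinate. It stands for
  the integral of \<open>g (\<omega>, y)\<close> over y against a kernel, but no disintegration of
  \<open>m\<close> is chosen; it is determined up to null sets and may be infinite.\<close>

definition cint :: "'a measure \<Rightarrow> ('a \<times> 'b) measure \<Rightarrow> ('a \<times> 'b \<Rightarrow> ennreal) \<Rightarrow> 'a \<Rightarrow> ennreal" where
  "cint Q m g = RN_deriv Q (distr (density m g) Q fst)"

locale cond_integral = finite_measure Q for Q :: "'a measure" +
  fixes m :: "('a \<times> 'b) measure"
  assumes fst_meas [measurable]: "fst \<in> measurable m Q"
    and fst_ac: "\<And>A. A \<in> null_sets Q \<Longrightarrow> fst -` A \<inter> space m \<in> null_sets m"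
begin

lemma cint_measurable [measurable]: "cint Q m g \<in> borel_measurable Q"
  unfolding cint_def by simp

lemma density_cint:
  assumes g [measurable]: "g \<in> borel_measurable m"
  shows "density Q (cint Q m g) = distr (density m g) Q fst"
  unfolding cint_def
proof (rule density_RN_deriv)
  show "absolutely_continuous Q (distr (density m g) Q fst)"
    unfolding absolutely_continuous_def
  proof
    fix A assume A: "A \<in> null_sets Q"
    then have [measurable]: "A \<in> sets Q" by auto
    have "AE z in m. z \<notin> fst -` A \<inter> space m" using fst_ac[OF A] by (rule AE_not_in)
    then have "emeasure (density m g) (fst -` A \<inter> space m) = 0"
      by (subst emeasure_density, measurable, subst nn_integral_0_iff_AE) (auto simp: indicator_def)
    then show "A \<in> null_sets (distr (density m g) Q fst)"
      by (auto simp: null_sets_def emeasure_distr)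
  qed
qed simp

lemma cint_set_integral:
  assumes [measurable]: "g \<in> borel_measurable m" "r \<in> borel_measurable Q"
  shows "(\<integral>\<^sup>+\<omega>. cint Q m g \<omega> * r \<omega> \<partial>Q) = (\<integral>\<^sup>+z. g z * r (fst z) \<partial>m)"
proof -
  have "(\<integral>\<^sup>+\<omega>. cint Q m g \<omega> * r \<omega> \<partial>Q) = (\<integral>\<^sup>+\<omega>. r \<omega> \<partial>density Q (cint Q m g))"
    by (subst nn_integral_density) auto
  also have "\<dots> = (\<integral>\<^sup>+z. r (fst z) \<partial>density m g)"
    unfolding density_cint[OF assms(1)] by (subst nn_integral_distr) auto
  also have "\<dots> = (\<integral>\<^sup>+z. g z * r (fst z) \<partial>m)"
    by (subst nn_integral_density) auto
  finally show ?thesis .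
qed

lemma cint_integral:
  "g \<in> borel_measurable m \<Longrightarrow> (\<integral>\<^sup>+\<omega>. cint Q m g \<omega> \<partial>Q) = (\<integral>\<^sup>+z. g z \<partial>m)"
  using cint_set_integral[of g "\<lambda>_. 1"] by simp

text \<open>Densities with respect to a finite measure are unique almost everywhere; the remaining
  rules of calculation reduce to this characterization by integrals over events.\<close>

lemma cint_eqI:
  assumes [measurable]: "g \<in> borel_measurable m" "k \<in> borel_measurable Q"
    and eq: "\<And>A. A \<in> sets Q \<Longrightarrow> (\<integral>\<^sup>+\<omega>. k \<omega> * indicator A \<omega> \<partial>Q) = (\<integral>\<^sup>+z. g z * indicator A (fst z) \<partial>m)"
  shows "AE \<omega> in Q. cint Q m g \<omega> = k \<omega>"
proof -
  have "density Q (cint Q m g) = density Q k"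
  proof (rule measure_eqI)
    fix A assume "A \<in> sets (density Q (cint Q m g))"
    then have [measurable]: "A \<in> sets Q" by simp
    show "emeasure (density Q (cint Q m g)) A = emeasure (density Q k) A"
      by (simp add: emeasure_density eq cint_set_integral)
  qed simp
  then show ?thesis by (subst (asm) density_unique_iff) auto
qed

lemma cint_cong_AE:
  assumes [measurable]: "g \<in> borel_measurable m" "h \<in> borel_measurable m"
    and "AE z in m. g z = h z"
  shows "AE \<omega> in Q. cint Q m g \<omega> = cint Q m h \<omega>"
proof (rule cint_eqI)
  fix A assume [measurable]: "A \<in> sets Q"
  show "(\<integral>\<^sup>+\<omega>. cint Q m h \<omega> * indicator A \<omega> \<partial>Q) = (\<integral>\<^sup>+z. g z * indicator A (fst z) \<partial>m)"
    unfolding cint_set_integral[OF assms(2) borel_measurable_indicator[OF \<open>A \<in> sets Q\<close>]]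
    by (rule nn_integral_cong_AE) (use assms(3) in eventually_elim, simp)
qed auto

lemma cint_mult:
  assumes [measurable]: "g \<in> borel_measurable m" "r \<in> borel_measurable Q"
  shows "AE \<omega> in Q. cint Q m (\<lambda>z. r (fst z) * g z) \<omega> = r \<omega> * cint Q m g \<omega>"
proof (rule cint_eqI)
  fix A assume [measurable]: "A \<in> sets Q"
  have "(\<integral>\<^sup>+\<omega>. r \<omega> * cint Q m g \<omega> * indicator A \<omega> \<partial>Q) = (\<integral>\<^sup>+\<omega>. cint Q m g \<omega> * (r \<omega> * indicator A \<omega>) \<partial>Q)"
    by (simp add: ac_simps)
  also have "\<dots> = (\<integral>\<^sup>+z. g z * (r (fst z) * indicator A (fst z)) \<partial>m)"
    by (rule cint_set_integral) auto
  finally show "(\<integral>\<^sup>+\<omega>. r \<omega> * cint Q m g \<omega> * indicator A \<omega> \<partial>Q) =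
      (\<integral>\<^sup>+z. r (fst z) * g z * indicator A (fst z) \<partial>m)" by (simp add: ac_simps)
qed auto

lemma cint_suminf:
  assumes [measurable]: "\<And>n::nat. g n \<in> borel_measurable m"
  shows "AE \<omega> in Q. cint Q m (\<lambda>z. \<Sum>n. g n z) \<omega> = (\<Sum>n. cint Q m (g n) \<omega>)"
proof (rule cint_eqI)
  fix A assume [measurable]: "A \<in> sets Q"
  have "(\<integral>\<^sup>+\<omega>. (\<Sum>n. cint Q m (g n) \<omega>) * indicator A \<omega> \<partial>Q) = (\<Sum>n. \<integral>\<^sup>+\<omega>. cint Q m (g n) \<omega> * indicator A \<omega> \<partial>Q)"
    by (simp add: nn_integral_suminf[symmetric])
  also have "\<dots> = (\<Sum>n. \<integral>\<^sup>+z. g n z * indicator A (fst z) \<partial>m)"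
    by (simp add: cint_set_integral)
  also have "\<dots> = (\<integral>\<^sup>+z. (\<Sum>n. g n z) * indicator A (fst z) \<partial>m)"
    by (simp add: nn_integral_suminf[symmetric])
  finally show "(\<integral>\<^sup>+\<omega>. (\<Sum>n. cint Q m (g n) \<omega>) * indicator A \<omega> \<partial>Q) =
    (\<integral>\<^sup>+z. (\<Sum>n. g n z) * indicator A (fst z) \<partial>m)" .
qed auto

lemma cint_add:
  assumes [measurable]: "g \<in> borel_measurable m" "h \<in> borel_measurable m"
  shows "AE \<omega> in Q. cint Q m (\<lambda>z. g z + h z) \<omega> = cint Q m g \<omega> + cint Q m h \<omega>"
  by (rule cint_eqI) (auto simp: cint_set_integral nn_integral_add distrib_right)

lemma cint_sum:
  assumes "\<And>k. k < n \<Longrightarrow> g k \<in> borel_measurable m"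
  shows "AE \<omega> in Q. cint Q m (\<lambda>z. \<Sum>k<(n::nat). g k z) \<omega> = (\<Sum>k<n. cint Q m (g k) \<omega>)"
  using assms
proof (induction n)
  case 0
  show ?case by (simp, rule cint_eqI) auto
next
  case (Suc n)
  have "AE \<omega> in Q. cint Q m (\<lambda>z. (\<Sum>k<n. g k z) + g n z) \<omega> = cint Q m (\<lambda>z. \<Sum>k<n. g k z) \<omega> + cint Q m (g n) \<omega>"
    using Suc.prems by (intro cint_add borel_measurable_sum) auto
  moreover have "AE \<omega> in Q. cint Q m (\<lambda>z. \<Sum>k<n. g k z) \<omega> = (\<Sum>k<n. cint Q m (g k) \<omega>)"
    by (rule Suc.IH) (simp add: Suc.prems)
  ultimately show ?case unfolding sum.lessThan_Suc by eventually_elim simp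
qed

lemma cint_mono:
  assumes [measurable]: "g \<in> borel_measurable m" "h \<in> borel_measurable m"
    and le: "AE z in m. g z \<le> h z"
  shows "AE \<omega> in Q. cint Q m g \<omega> \<le> cint Q m h \<omega>"
proof -
  have "AE \<omega> in Q. cint Q m h \<omega> = cint Q m (\<lambda>z. g z + (h z - g z)) \<omega>"
  proof (rule cint_cong_AE)
    show "AE z in m. h z = g z + (h z - g z)"
      using le by eventually_elim (rule add_diff_inverse_ennreal[symmetric])
  qed auto
  moreover have "AE \<omega> in Q. cint Q m (\<lambda>z. g z + (h z - g z)) \<omega> = cint Q m g \<omega> + cint Q m (\<lambda>z. h z - g z) \<omega>"
    by (rule cint_add) auto
  ultimately show ?thesis by eventually_elim simp
qed

lemma cint_SUP:
  assumes [measurable]: "\<And>n::nat. g n \<in> borel_measurable m"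
    and mono: "AE z in m. \<forall>n. g n z \<le> g (Suc n) z"
  shows "AE \<omega> in Q. cint Q m (\<lambda>z. SUP n. g n z) \<omega> = (SUP n. cint Q m (g n) \<omega>)"
proof (rule cint_eqI)
  fix A assume [measurable]: "A \<in> sets Q"
  have "AE \<omega> in Q. \<forall>n. cint Q m (g n) \<omega> \<le> cint Q m (g (Suc n)) \<omega>"
    unfolding AE_all_countable by (intro allI cint_mono) (use mono in auto)
  then have "(\<integral>\<^sup>+\<omega>. (SUP n. cint Q m (g n) \<omega>) * indicator A \<omega> \<partial>Q) = (SUP n. \<integral>\<^sup>+\<omega>. cint Q m (g n) \<omega> * indicator A \<omega> \<partial>Q)"
    unfolding SUP_mult_right_ennreal
    by (intro nn_integral_monotone_convergence_SUP_AE) (auto simp: indicator_def elim!: eventually_mono)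
  also have "\<dots> = (SUP n. \<integral>\<^sup>+z. g n z * indicator A (fst z) \<partial>m)"
    by (simp add: cint_set_integral)
  also have "\<dots> = (\<integral>\<^sup>+z. (SUP n. g n z) * indicator A (fst z) \<partial>m)"
    unfolding SUP_mult_right_ennreal
    by (intro nn_integral_monotone_convergence_SUP_AE[symmetric])
       (use mono in \<open>auto simp: indicator_def elim!: eventually_mono\<close>)
  finally show "(\<integral>\<^sup>+\<omega>. (SUP n. cint Q m (g n) \<omega>) * indicator A \<omega> \<partial>Q) =
    (\<integral>\<^sup>+z. (SUP n. g n z) * indicator A (fst z) \<partial>m)" .
qed auto

end

section \<open>Conditional sets and their local sections\<close>

lemma measurable_AE_eq:
  assumes "complete_measure M" and x: "x \<in> borel_measurable M" and eq: "AE \<omega> in M. y \<omega> = x \<omega>"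
  shows "y \<in> borel_measurable M"
proof (rule borel_measurableI)
  interpret complete_measure M by fact
  fix S :: "'b set" assume "open S"
  then have xS: "x -` S \<inter> space M \<in> sets M" using x by (intro measurable_sets[OF x]) auto
  have ae: "AE \<omega> in M. \<omega> \<in> x -` S \<inter> space M \<longleftrightarrow> \<omega> \<in> y -` S \<inter> space M"
    using eq by eventually_elim simp
  show "y -` S \<inter> space M \<in> sets M" by (rule in_sets_AE[OF ae xS]) auto
qed

lemma AE_disjoint_cover:
  assumes "\<And>k::nat. AE \<omega>\<in>A k in M. P \<omega>"
  shows "AE \<omega>\<in>(\<Union>k. A k) in M. P \<omega>"
proof -
  have "AE \<omega> in M. \<forall>k. \<omega> \<in> A k \<longrightarrow> P \<omega>" using assms unfolding AE_all_countable by blast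
  then show ?thesis by eventually_elim blast
qed

lemma AE_partition:
  assumes "is_partition M A" "\<And>k. AE \<omega>\<in>A k in M. P \<omega>"
  shows "AE \<omega> in M. P \<omega>"
proof -
  have "AE \<omega>\<in>(\<Union>k. A k) in M. P \<omega>" by (rule AE_disjoint_cover) (rule assms)
  moreover have "(\<Union>k. A k) = space M" using assms(1) by (simp add: is_partition_def)
  ultimately have "AE \<omega> in M. \<omega> \<in> space M \<longrightarrow> P \<omega>" by simp
  with AE_space show ?thesis by eventually_elim blast
qed

lemma is_partition_two: "A \<in> sets M \<Longrightarrow> is_partition M (\<lambda>k. if k = 0 then A else if k = 1 then space M - A else {})"
  using sets.sets_into_space[of A M] by (auto simp: is_partition_def disjoint_family_on_def)


lemma concat_exists:
  assumes A: "is_partition M A" and x: "\<And>k. x k \<in> borel_measurable M"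
  shows "\<exists>y\<in>borel_measurable M. is_concat M A x y"
proof -
  have [measurable]: "A k \<in> sets M" for k using A by (auto simp: is_partition_def)
  have [measurable]: "x k \<in> borel_measurable M" for k by (rule x)
  define N where "N \<omega> = (LEAST k. \<omega> \<in> A k)" for \<omega>
  have [measurable]: "N \<in> measurable M (count_space UNIV)" unfolding N_def by measurable
  have "(\<lambda>\<omega>. x (N \<omega>) \<omega>) \<in> borel_measurable M" by measurable
  moreover have "N \<omega> = k" if "\<omega> \<in> A k" for \<omega> k
  proof -
    have "j = k" if "\<omega> \<in> A j" for j
      using that \<open>\<omega> \<in> A k\<close> A by (auto simp: is_partition_def disjoint_family_on_def)
    then show ?thesis unfolding N_def using that by (metis LeastI)
  qed
  then have "is_concat M A x (\<lambda>\<omega>. x (N \<omega>) \<omega>)" by (auto simp: is_concat_def)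
  ultimately show ?thesis by blast
qed

lemma concat_measurable:
  assumes M: "complete_measure M" and A: "is_partition M A" and x: "\<And>k. x k \<in> borel_measurable M"
    and y: "is_concat M A x y"
  shows "y \<in> borel_measurable M"
proof -
  obtain z where z: "z \<in> borel_measurable M" "is_concat M A x z"
    by (rule bexE[OF concat_exists[OF A x]])
  have "AE \<omega> in M. y \<omega> = z \<omega>"
  proof (rule AE_partition[OF A])
    fix k
    have "AE \<omega>\<in>A k in M. y \<omega> = x k \<omega>" "AE \<omega>\<in>A k in M. z \<omega> = x k \<omega>"
      using y z by (auto simp: is_concat_def)
    then show "AE \<omega>\<in>A k in M. y \<omega> = z \<omega>" by eventually_elim simp
  qed
  then show ?thesis by (rule measurable_AE_eq[OF M z(1)])
qed

lemma stable_set_concat: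
  assumes "stable_set M V" "V \<subseteq> borel_measurable M" "is_partition M A" "\<And>k. x k \<in> V"
  shows "\<exists>y\<in>V. is_concat M A x y"
  using concat_exists[OF assms(3), of x] assms unfolding stable_set_def by blast

lemma disjointed_in_sets:
  assumes "\<And>k. A k \<in> sets M" shows "disjointed A k \<in> sets M"
proof -
  have "range A \<subseteq> sets M" using assms by blast
  from sets.range_disjointed_sets[OF this] show ?thesis by blast
qed

text \<open>The events may overlap and need not cover the space: overlaps are removed by
  \<open>disjointed\<close>, and the complement of the union becomes one more part.\<close>

lemma stable_set_glue:
  assumes V: "stable_set M V" "V \<subseteq> borel_measurable M" and A: "\<And>k. A k \<in> sets M" and x: "\<And>k. x k \<in> V"
  shows "\<exists>y\<in>V. \<forall>k. AE \<omega>\<in>disjointed A k in M. y \<omega> = x k \<omega>"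
proof -
  \<comment> \<open>Part \<open>0\<close> is the complement of the union. By truncated subtraction
    the shifted sequence \<open>x (k - 1)\<close> places \<open>x 0\<close> there, where any member
    of \<open>V\<close> would do.\<close>
  define B where "B k = (case k of 0 \<Rightarrow> space M - (\<Union>k. A k) | Suc k \<Rightarrow> disjointed A k)" for k
  have dj: "disjointed A k \<in> sets M" for k
    by (rule disjointed_in_sets) (rule A)
  have "is_partition M B"
    unfolding is_partition_def
  proof (intro conjI)
    show "range B \<subseteq> sets M" using A dj by (auto simp: B_def split: nat.split)
    have "disjointed A i \<inter> disjointed A j = {}" if "i \<noteq> j" for i j
      using disjoint_family_disjointed[of A] that by (auto simp: disjoint_family_on_def)
    moreover have "disjointed A i \<inter> (space M - (\<Union>k. A k)) = {}" for i
      using disjointed_subset[of A i] by auto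
    ultimately show "disjoint_family B"
      by (auto simp: disjoint_family_on_def B_def split: nat.splits)
    have "B k \<subseteq> space M" for k
      using A[THEN sets.sets_into_space] dj[THEN sets.sets_into_space] by (auto simp: B_def split: nat.split)
    moreover have "\<exists>k. \<omega> \<in> B k" if "\<omega> \<in> space M" for \<omega>
    proof (cases "\<omega> \<in> (\<Union>k. disjointed A k)")
      case True
      then obtain k where "\<omega> \<in> B (Suc k)" by (auto simp: B_def)
      then show ?thesis ..
    next
      case False
      then have "\<omega> \<in> B 0" using that unfolding UN_disjointed_eq by (simp add: B_def)
      then show ?thesis ..
    qed
    ultimately show "(\<Union>k. B k) = space M" by blast
  qed
  then obtain y where y: "y \<in> V" "is_concat M B (\<lambda>k. x (k - 1)) y"
    using stable_set_concat[OF V, of B "\<lambda>k. x (k - 1)"] x by blast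
  have "AE \<omega>\<in>disjointed A k in M. y \<omega> = x k \<omega>" for k
    using y(2)[unfolded is_concat_def, rule_format, of "Suc k"] by (simp add: B_def)
  with y show ?thesis by blast
qed

section \<open>Essential suprema of events\<close>

text \<open>This is the predicate from which \<open>ess_Sup_sets\<close> makes its choice; named, it
  also applies to versions other than the chosen one.\<close>

definition is_esup :: "'a measure \<Rightarrow> 'a set set \<Rightarrow> 'a set \<Rightarrow> bool" where
  "is_esup M \<A> C \<longleftrightarrow> C \<in> sets M \<and> (\<forall>A\<in>\<A>. AE \<omega>\<in>A in M. \<omega> \<in> C) \<and>
     (\<forall>D\<in>sets M. (\<forall>A\<in>\<A>. AE \<omega>\<in>A in M. \<omega> \<in> D) \<longrightarrow> (AE \<omega>\<in>C in M. \<omega> \<in> D))"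

lemma is_esup_unique:
  assumes "is_esup M \<A> C" "is_esup M \<A> D" shows "AE \<omega> in M. \<omega> \<in> C \<longleftrightarrow> \<omega> \<in> D"
proof -
  have "AE \<omega>\<in>C in M. \<omega> \<in> D" "AE \<omega>\<in>D in M. \<omega> \<in> C"
    using assms unfolding is_esup_def by blast+
  then show ?thesis by eventually_elim auto
qed

text \<open>Exhaustion: countable unions of members with probabilities tending to the supremum
  \<open>s\<close> are merged into one, and a member sticking out with positive probability would
  push the value above \<open>s\<close>. That the result is a countable union of members is what
  later lets suprema be attained by gluing.\<close>

lemma (in prob_space) esup_exists:
  assumes "\<A> \<subseteq> events" "\<A> \<noteq> {}"
  shows "\<exists>A. range A \<subseteq> \<A> \<and> is_esup M \<A> (\<Union>k::nat. A k)"
proof -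
  define \<S> where "\<S> = {A :: nat \<Rightarrow> 'a set. range A \<subseteq> \<A>}"
  define s where "s = (SUP A\<in>\<S>. prob (\<Union>k. A k))"
  obtain A0 where "A0 \<in> \<A>" using assms(2) by blast
  then have "(\<lambda>_. A0) \<in> \<S>" by (auto simp: \<S>_def)
  then have ne: "\<S> \<noteq> {}" by blast
  have bdd: "bdd_above ((\<lambda>A. prob (\<Union>k. A k)) ` \<S>)" by (auto intro!: bdd_aboveI[of _ 1])
  have "\<exists>A\<in>\<S>. s - 1 / real (Suc n) < prob (\<Union>k. A k)" for n
    using less_cSUP_iff[OF ne bdd, of "s - 1 / real (Suc n)"] by (simp add: s_def)
  then obtain A where A: "\<And>n. A n \<in> \<S>" "\<And>n. s - 1 / real (Suc n) < prob (\<Union>k. A n k)" by metis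
  define B where "B i = A (fst (prod_decode i)) (snd (prod_decode i))" for i
  have BA: "B (prod_encode (n, k)) = A n k" for n k by (simp add: B_def)
  have BS: "range B \<subseteq> \<A>" using A(1) by (auto simp: B_def \<S>_def)
  have Bm: "(\<Union>k. B k) \<in> events" using BS assms(1) by blast
  have "s \<le> prob (\<Union>k. B k)"
  proof (rule field_le_epsilon)
    fix e :: real assume "0 < e"
    then obtain n where n: "1 / real (Suc n) < e" using nat_approx_posE by blast
    have "prob (\<Union>k. A n k) \<le> prob (\<Union>k. B k)"
      by (intro finite_measure_mono Bm UN_least) (metis BA UN_upper UNIV_I)
    with A(2)[of n] n show "s \<le> prob (\<Union>k. B k) + e" by linarith
  qed
  have up: "AE \<omega>\<in>C in M. \<omega> \<in> (\<Union>k. B k)" if C: "C \<in> \<A>" for C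
  proof -
    have Cm: "C \<in> events" using C assms by auto
    define D where "D = case_nat C B"
    have "D \<in> \<S>" using C BS by (force simp: \<S>_def D_def split: nat.splits)
    then have "prob (\<Union>k. D k) \<le> s" unfolding s_def by (rule cSUP_upper[OF _ bdd])
    moreover have "(\<Union>k. D k) = (\<Union>k. B k) \<union> (C - (\<Union>k. B k))"
    proof (intro equalityI subsetI)
      fix z assume "z \<in> (\<Union>k. B k) \<union> (C - (\<Union>k. B k))"
      then have "z \<in> D 0 \<or> (\<exists>k. z \<in> D (Suc k))" by (auto simp: D_def)
      then show "z \<in> (\<Union>k. D k)" by blast
    next
      fix z assume "z \<in> (\<Union>k. D k)"
      then obtain k where "z \<in> D k" by blast
      then show "z \<in> (\<Union>k. B k) \<union> (C - (\<Union>k. B k))" by (cases k) (auto simp: D_def)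
    qed
    moreover have "prob ((\<Union>k. B k) \<union> (C - (\<Union>k. B k))) = prob (\<Union>k. B k) + prob (C - (\<Union>k. B k))"
      using Bm Cm by (intro finite_measure_Union) auto
    ultimately have "prob (C - (\<Union>k. B k)) \<le> 0" using \<open>s \<le> _\<close> by (smt (verit))
    then have "C - (\<Union>k. B k) \<in> null_sets M"
      using Bm Cm by (auto simp: null_sets_def emeasure_eq_measure measure_le_0_iff)
    then show ?thesis by (auto dest: AE_not_in)
  qed
  have "is_esup M \<A> (\<Union>k. B k)"
    unfolding is_esup_def
  proof (intro conjI ballI impI)
    fix D assume D: "\<forall>A\<in>\<A>. AE \<omega>\<in>A in M. \<omega> \<in> D"
    show "AE \<omega>\<in>(\<Union>k. B k) in M. \<omega> \<in> D"
      by (rule AE_disjoint_cover) (use D BS in blast)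
  qed (use Bm up in blast)+
  with BS show ?thesis by blast
qed

lemma (in prob_space) ess_Sup_sets_is_esup:
  assumes "\<A> \<subseteq> events" "\<A> \<noteq> {}"
  shows "is_esup M \<A> (ess_Sup_sets M \<A>)"
proof -
  have "\<exists>C. is_esup M \<A> C" using esup_exists[OF assms] by blast
  then show ?thesis unfolding ess_Sup_sets_def is_esup_def[symmetric] by (rule someI_ex)
qed

text \<open>\<open>sel M P A x\<close> says that \<open>x|A\<close> belongs to \<open>P|A\<close> and that \<open>P\<close> lives on all of \<open>A\<close>.\<close>

definition sel :: "'a measure \<Rightarrow> ('a, 'b::topological_space) cset \<Rightarrow> 'a set \<Rightarrow> ('a \<Rightarrow> 'b) \<Rightarrow> bool" where
  "sel M P A x \<longleftrightarrow> A \<in> sets M \<and> x \<in> borel_measurable M \<and>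
     (\<exists>u\<in>P. AE \<omega>\<in>A in M. u \<omega> = Some (x \<omega>))"

lemma sel_crestr:
  "sel M (crestr M V A) B x \<longleftrightarrow> B \<in> sets M \<and> x \<in> borel_measurable M \<and>
     (AE \<omega>\<in>B in M. \<omega> \<in> A) \<and> (\<exists>y\<in>V. AE \<omega>\<in>B in M. y \<omega> = x \<omega>)"
    if "V \<noteq> {}"
proof (cases "B \<in> sets M \<and> x \<in> borel_measurable M")
  case True
  have "(\<exists>u\<in>crestr M V A. AE \<omega>\<in>B in M. u \<omega> = Some (x \<omega>)) \<longleftrightarrow>
     (\<exists>y\<in>V. AE \<omega>\<in>B in M. \<omega> \<in> A \<and> y \<omega> = x \<omega>)" (is "?l \<longleftrightarrow> ?r")
  proof
    assume ?l
    then obtain u y where y: "y \<in> V" and *: "AE \<omega> in M. u \<omega> = ((Some \<circ> y) |` A) \<omega>"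
      and **: "AE \<omega>\<in>B in M. u \<omega> = Some (x \<omega>)" unfolding crestr_def by blast
    from * ** have "AE \<omega>\<in>B in M. \<omega> \<in> A \<and> y \<omega> = x \<omega>"
      by eventually_elim (auto simp: restrict_map_def split: if_splits)
    with y show ?r by blast
  next
    assume ?r
    then obtain y where y: "y \<in> V" and *: "AE \<omega>\<in>B in M. \<omega> \<in> A \<and> y \<omega> = x \<omega>" by blast
    have "(Some \<circ> y) |` A \<in> crestr M V A" using y by (auto simp: crestr_def)
    moreover have "AE \<omega>\<in>B in M. ((Some \<circ> y) |` A) \<omega> = Some (x \<omega>)"
      using * by eventually_elim (auto simp: restrict_map_def)
    ultimately show ?l by blast
  qed
  with True show ?thesis unfolding sel_def by (auto simp: imp_conjR)
qed (auto simp: sel_def)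

section \<open>Order and extensionality through local sections\<close>

locale complete_prob_space = prob_space M + complete_measure M for M :: "'a measure"
begin

abbreviation L0 :: "('a \<Rightarrow> 'b::topological_space) set" where "L0 \<equiv> borel_measurable M"

abbreviation csets :: "('a, 'b::topological_space) cset gorder" where "csets \<equiv> csubsets M L0"

lemma stable_set_L0: "stable_set M L0"
  unfolding stable_set_def
proof (intro conjI allI impI)
  have "(\<lambda>_. undefined) \<in> L0" by simp
  then show "L0 \<noteq> {}" by blast
qed (blast intro: concat_measurable[OF complete_measure_axioms])

lemma carrierE:
  assumes "P \<in> carrier csets"
  obtains V A where "cond_pair M L0 V A" "P = crestr M V A"
  using assms by (auto simp: csubsets_def)

lemma cond_pairD:
  assumes "cond_pair M L0 V A"
  shows "V \<noteq> {}" "V \<subseteq> L0" "stable_set M V" "A \<in> events"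
  using assms by (auto simp: cond_pair_def stable_set_def)

lemma sel_local:
  assumes "sel M P A x" "B \<in> events" "AE \<omega>\<in>B in M. \<omega> \<in> A" "y \<in> L0"
    "AE \<omega>\<in>B in M. y \<omega> = x \<omega>"
  shows "sel M P B y"
proof -
  obtain u where u: "u \<in> P" "AE \<omega>\<in>A in M. u \<omega> = Some (x \<omega>)"
    using assms(1) by (auto simp: sel_def)
  have "AE \<omega>\<in>B in M. u \<omega> = Some (y \<omega>)"
    using u(2) assms(3,5) by eventually_elim auto
  with u assms show ?thesis by (auto simp: sel_def)
qed

text \<open>The members of \<open>V\<close> that witness the single sections may differ; stability
  of \<open>V\<close> pastes them along the disjointed events into one witness.\<close>

lemma sel_glue:
  assumes P: "P \<in> carrier csets" and s: "\<And>k::nat. sel M P (A k) x"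
  shows "sel M P (\<Union>k. A k) x"
proof -
  obtain V B where VB: "cond_pair M L0 V B" "P = crestr M V B" using carrierE[OF P] .
  note V = cond_pairD[OF VB(1)]
  have A: "A k \<in> events" "x \<in> L0" "AE \<omega>\<in>A k in M. \<omega> \<in> B"
    "\<exists>y\<in>V. AE \<omega>\<in>A k in M. y \<omega> = x \<omega>" for k
    using s[of k] V unfolding VB(2) by (auto simp: sel_crestr)
  obtain y where y: "\<And>k. y k \<in> V" "\<And>k. AE \<omega>\<in>A k in M. y k \<omega> = x \<omega>" using A(4) by metis
  obtain z where z: "z \<in> V" "\<And>k. AE \<omega>\<in>disjointed A k in M. z \<omega> = y k \<omega>"
    using stable_set_glue[of M V A y] V A(1) y(1) by metis
  have "AE \<omega>\<in>(\<Union>k. disjointed A k) in M. z \<omega> = x \<omega>"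
  proof (rule AE_disjoint_cover)
    fix k show "AE \<omega>\<in>disjointed A k in M. z \<omega> = x \<omega>"
      using z(2)[of k] y(2)[of k] by eventually_elim (use disjointed_subset[of A k] in auto)
  qed
  then show ?thesis
    unfolding VB(2) sel_crestr[OF V(1)] UN_disjointed_eq
    using A z(1) AE_disjoint_cover[where P="\<lambda>\<omega>. \<omega> \<in> B"] by blast
qed

lemma sel_empty: "P \<in> carrier csets \<Longrightarrow> x \<in> L0 \<Longrightarrow> sel M P {} x"
  by (erule carrierE) (frule cond_pairD(1), auto simp: sel_crestr)

text \<open>Off its domain \<open>A\<close> a representing set \<open>V\<close> is not determined by
  the conditional set. Sections avoid the choice of representatives: the order becomes inclusion of
  section systems.\<close>

lemma cond_le_iff:
  assumes P: "P \<in> carrier csets" and Q: "Q \<in> carrier csets"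
  shows "cond_le M L0 P Q \<longleftrightarrow> (\<forall>A x. sel M P A x \<longrightarrow> sel M Q A x)"
proof
  assume "cond_le M L0 P Q"
  then obtain V A W B where *: "cond_pair M L0 V A" "cond_pair M L0 W B" "P = crestr M V A" "Q = crestr M W B"
    "AE \<omega>\<in>A in M. \<omega> \<in> B" "crestr M V A \<subseteq> crestr M W A"
    unfolding cond_le_def by blast
  show "\<forall>A x. sel M P A x \<longrightarrow> sel M Q A x"
  proof (intro allI impI)
    fix C x assume "sel M P C x"
    then have "sel M (crestr M W A) C x" using * by (auto simp: sel_def)
    then have "C \<in> events" "x \<in> L0" "AE \<omega>\<in>C in M. \<omega> \<in> A" "\<exists>y\<in>W. AE \<omega>\<in>C in M. y \<omega> = x \<omega>"
      using cond_pairD[OF *(2)] by (auto simp: sel_crestr)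
    moreover from this(3) *(5) have "AE \<omega>\<in>C in M. \<omega> \<in> B" by eventually_elim auto
    ultimately show "sel M Q C x" using cond_pairD[OF *(2)] unfolding *(4) by (simp add: sel_crestr)
  qed
next
  assume le: "\<forall>A x. sel M P A x \<longrightarrow> sel M Q A x"
  obtain V A where V: "cond_pair M L0 V A" "P = crestr M V A" using carrierE[OF P] .
  obtain W B where W: "cond_pair M L0 W B" "Q = crestr M W B" using carrierE[OF Q] .
  note V' = cond_pairD[OF V(1)] note W' = cond_pairD[OF W(1)]
  have *: "(AE \<omega>\<in>A in M. \<omega> \<in> B) \<and> (\<exists>w\<in>W. AE \<omega>\<in>A in M. w \<omega> = v \<omega>)" if "v \<in> V" for v
  proof -
    have "sel M P A v" unfolding V(2) using that V' by (auto simp: sel_crestr)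
    then have "sel M Q A v" using le by blast
    then show ?thesis unfolding W(2) using W' by (auto simp: sel_crestr)
  qed
  have "crestr M V A \<subseteq> crestr M W A"
  proof
    fix u assume "u \<in> crestr M V A"
    then obtain v where v: "v \<in> V" "AE \<omega> in M. u \<omega> = ((Some \<circ> v) |` A) \<omega>" by (auto simp: crestr_def)
    obtain w where w: "w \<in> W" "AE \<omega>\<in>A in M. w \<omega> = v \<omega>" using *[OF v(1)] by blast
    from v(2) w(2) have "AE \<omega> in M. u \<omega> = ((Some \<circ> w) |` A) \<omega>"
      by eventually_elim (auto simp: restrict_map_def)
    with w show "u \<in> crestr M W A" by (auto simp: crestr_def)
  qed
  then show "cond_le M L0 P Q" unfolding cond_le_def using V W * V' by blast
qed

text \<open>A section over the whole domain of one set shows this domain to be almost contained in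
  that of the other; so sections determine the domain as well as the values on it.\<close>

lemma cset_eqI:
  assumes P: "P \<in> carrier csets" and Q: "Q \<in> carrier csets" and eq: "\<And>A x. sel M P A x \<longleftrightarrow> sel M Q A x"
  shows "P = Q"
proof -
  have "P \<subseteq> Q" if P: "P \<in> carrier csets" and Q: "Q \<in> carrier csets" and eq: "\<And>A x. sel M P A x \<longleftrightarrow> sel M Q A x"
    for P Q :: "('a, 'b) cset"
  proof
    fix u assume u: "u \<in> P"
    obtain V A where V: "cond_pair M L0 V A" "P = crestr M V A" using carrierE[OF P] .
    obtain W B where W: "cond_pair M L0 W B" "Q = crestr M W B" using carrierE[OF Q] .
    note V' = cond_pairD[OF V(1)] note W' = cond_pairD[OF W(1)]
    obtain v where v: "v \<in> V" "AE \<omega> in M. u \<omega> = ((Some \<circ> v) |` A) \<omega>" using u V by (auto simp: crestr_def)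
    have "sel M P A v" unfolding V(2) using v V' by (auto simp: sel_crestr)
    then have "sel M Q A v" using eq by simp
    then obtain w where w: "w \<in> W" "AE \<omega>\<in>A in M. w \<omega> = v \<omega>" and AB: "AE \<omega>\<in>A in M. \<omega> \<in> B"
      unfolding W(2) using W' by (auto simp: sel_crestr)
    have "sel M Q B w" unfolding W(2) using w W' by (auto simp: sel_crestr)
    then have "sel M P B w" using eq by simp
    then have BA: "AE \<omega>\<in>B in M. \<omega> \<in> A" unfolding V(2) using V' by (auto simp: sel_crestr)
    have "AE \<omega> in M. u \<omega> = ((Some \<circ> w) |` B) \<omega>"
      using v(2) w(2) AB BA by eventually_elim (auto simp: restrict_map_def)
    then show "u \<in> Q" using w W by (auto simp: crestr_def)
  qed
  from this[OF P Q eq] this[OF Q P] eq show ?thesis by (simp add: subset_antisym)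
qed

text \<open>These are the closure properties that characterize the systems of local sections of conditional
  sets; the conditional set is recovered from the largest event with a section.\<close>

definition selsys :: "('a set \<Rightarrow> ('a \<Rightarrow> 'b::topological_space) \<Rightarrow> bool) \<Rightarrow> bool" where
  "selsys R \<longleftrightarrow> (\<forall>A x. R A x \<longrightarrow> A \<in> events \<and> x \<in> L0) \<and>
     (\<forall>A x B y. R A x \<longrightarrow> B \<in> events \<longrightarrow> (AE \<omega>\<in>B in M. \<omega> \<in> A) \<longrightarrow> y \<in> L0 \<longrightarrow>
        (AE \<omega>\<in>B in M. y \<omega> = x \<omega>) \<longrightarrow> R B y) \<and>
     (\<forall>A x. (\<forall>k::nat. R (A k) x) \<longrightarrow> R (\<Union>k. A k) x) \<and>
     (\<forall>x\<in>L0. R {} x)"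

lemma selsysD:
  assumes "selsys R"
  shows "R A x \<Longrightarrow> A \<in> events" "R A x \<Longrightarrow> x \<in> L0"
    "R A x \<Longrightarrow> B \<in> events \<Longrightarrow> AE \<omega>\<in>B in M. \<omega> \<in> A \<Longrightarrow> y \<in> L0 \<Longrightarrow>
       AE \<omega>\<in>B in M. y \<omega> = x \<omega> \<Longrightarrow> R B y"
    "(\<And>k::nat. R (N k) x) \<Longrightarrow> R (\<Union>k. N k) x"
    "x \<in> L0 \<Longrightarrow> R {} x"
  using assms unfolding selsys_def by blast+

lemma selsys_Un: "selsys R \<Longrightarrow> R A x \<Longrightarrow> R B x \<Longrightarrow> R (A \<union> B) x"
proof -
  assume R: "selsys R" "R A x" "R B x"
  define N where "N k = (if k = 0 then A else B)" for k :: nat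
  have "R (\<Union>k. N k) x" by (rule selsysD(4)[OF R(1)]) (simp add: N_def R)
  moreover have "(\<Union>k. N k) = A \<union> B" by (auto simp: N_def split: if_splits)
  ultimately show ?thesis by simp
qed

lemma selsys_sel: "P \<in> carrier csets \<Longrightarrow> selsys (sel M P)"
  unfolding selsys_def
proof (intro conjI allI impI ballI)
  assume P: "P \<in> carrier csets"
  show "sel M P A x \<Longrightarrow> A \<in> events" "sel M P A x \<Longrightarrow> x \<in> L0" for A x by (simp_all add: sel_def)
  show "sel M P (\<Union>k. A k) x" if "\<forall>k. sel M P (A k) x" for A :: "nat \<Rightarrow> 'a set" and x
    using that by (intro sel_glue[OF P]) blast
  show "sel M P {} x" if "x \<in> L0" for x using sel_empty[OF P that] .
qed (rule sel_local)

text \<open>Sections over countably many events that exhaust the supremum are pasted along the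
  disjointed events, and closure under countable unions turns the result into a section over their
  union.\<close>

lemma selsys_attained:
  assumes R: "selsys R" and C: "is_esup M {A. \<exists>x. R A x} C"
  shows "\<exists>x. R C x"
proof -
  let ?A = "{A. \<exists>x. R A x}"
  have "?A \<subseteq> events" "?A \<noteq> {}"
    using selsysD(1)[OF R] selsysD(5)[OF R, of "\<lambda>_. undefined"] by (blast, force)
  from esup_exists[OF this] obtain A where A: "range A \<subseteq> ?A" "is_esup M ?A (\<Union>k::nat. A k)" by blast
  then have "\<forall>k. \<exists>x. R (A k) x" by blast
  then obtain x where x: "\<And>k. R (A k) (x k)" by metis
  have Ae: "A k \<in> events" and xL: "x k \<in> L0" for k using selsysD(1,2)[OF R x] .
  obtain y where y: "y \<in> L0" "\<And>k. AE \<omega>\<in>disjointed A k in M. y \<omega> = x k \<omega>"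
    using stable_set_glue[OF stable_set_L0 order.refl, of A x] Ae xL by blast
  have "R (disjointed A k) y" for k
  proof (rule selsysD(3)[OF R x[of k]])
    show "disjointed A k \<in> events" by (rule disjointed_in_sets) (rule Ae)
    show "AE \<omega>\<in>disjointed A k in M. \<omega> \<in> A k" using disjointed_subset[of A k] by auto
  qed (use y in auto)
  then have "R (\<Union>k. disjointed A k) y" by (rule selsysD(4)[OF R])
  then have "R (\<Union>k. A k) y" by (simp add: UN_disjointed_eq)
  moreover have "AE \<omega> in M. \<omega> \<in> C \<longleftrightarrow> \<omega> \<in> (\<Union>k. A k)" by (rule is_esup_unique[OF C A(2)])
  then have CA: "AE \<omega>\<in>C in M. \<omega> \<in> (\<Union>k. A k)" by eventually_elim blast
  moreover have "C \<in> events" using C by (simp add: is_esup_def)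
  ultimately have "R C y" using y(1) selsysD(3)[OF R, of "\<Union>k. A k" y C y] by simp
  then show ?thesis by blast
qed

lemma selsys_represent:
  assumes R: "selsys R" and C: "is_esup M {A. \<exists>x. R A x} C"
  shows "cond_pair M L0 {x \<in> L0. R C x} C" "sel M (crestr M {x \<in> L0. R C x} C) = R"
proof -
  let ?V = "{x \<in> L0. R C x}"
  obtain x0 where x0: "R C x0" using selsys_attained[OF R C] by blast
  have Ce: "C \<in> events" using C by (simp add: is_esup_def)
  have x0L: "x0 \<in> L0" using selsysD(2)[OF R x0] .
  have "y \<in> ?V" if A: "is_partition M A" and x: "\<And>k. x k \<in> ?V" and y: "is_concat M A x y" for A x y
  proof -
    have yL: "y \<in> L0" using concat_measurable[OF complete_measure_axioms A _ y] x by blast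
    have "R (C \<inter> A k) y" for k
    proof (rule selsysD(3)[OF R, of C "x k"])
      show "AE \<omega>\<in>C \<inter> A k in M. y \<omega> = x k \<omega>"
        using y unfolding is_concat_def by (auto dest!: spec[of _ k] elim: eventually_mono)
    qed (use x yL Ce A in \<open>auto simp: is_partition_def\<close>)
    then have "R (\<Union>k. C \<inter> A k) y" by (rule selsysD(4)[OF R])
    moreover have "(\<Union>k. C \<inter> A k) = C"
      using A sets.sets_into_space[OF Ce] by (auto simp: is_partition_def)
    ultimately show ?thesis using yL by simp
  qed
  then have V: "stable_set M ?V" unfolding stable_set_def using x0 x0L by blast
  then show "cond_pair M L0 ?V C" using Ce by (auto simp: cond_pair_def)
  have ne: "?V \<noteq> {}" using x0 x0L by blast
  show "sel M (crestr M ?V C) = R"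
  proof (intro ext iffI)
    fix B x assume "sel M (crestr M ?V C) B x"
    then obtain y where y: "B \<in> events" "x \<in> L0" "AE \<omega>\<in>B in M. \<omega> \<in> C" "R C y"
      "AE \<omega>\<in>B in M. y \<omega> = x \<omega>"
      unfolding sel_crestr[OF ne] by blast
    from y(5) have "AE \<omega>\<in>B in M. x \<omega> = y \<omega>" by eventually_elim simp
    then show "R B x" by (rule selsysD(3)[OF R y(4,1,3,2)])
  next
    fix B x assume BR: "R B x"
    have Be: "B \<in> events" and xL: "x \<in> L0" using selsysD(1,2)[OF R BR] .
    have BC: "AE \<omega>\<in>B in M. \<omega> \<in> C" using C BR unfolding is_esup_def by blast
    \<comment> \<open>Members of the representing set have to be sections over all of
      \<open>C\<close>, so the section over \<open>B\<close> is continued by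
      \<open>x0\<close>.\<close>
    define y where "y \<omega> = (if \<omega> \<in> B then x \<omega> else x0 \<omega>)" for \<omega>
    have yL: "y \<in> L0" unfolding y_def using Be xL x0L by (intro measurable_If_set) (auto dest: sets.sets_into_space simp: Int_absorb2)
    have "R B y" by (rule selsysD(3)[OF R BR Be _ yL]) (auto simp: y_def)
    moreover have "R (C - B) y"
      by (rule selsysD(3)[OF R x0 _ _ yL]) (use Ce Be in \<open>auto simp: y_def\<close>)
    ultimately have "R (B \<union> (C - B)) y" by (rule selsys_Un[OF R])
    then have "R C y" by (rule selsysD(3)[OF R]) (use Ce yL in auto)
    then have "y \<in> ?V" using yL by blast
    moreover have "AE \<omega>\<in>B in M. y \<omega> = x \<omega>" by (auto simp: y_def)
    ultimately show "sel M (crestr M ?V C) B x" unfolding sel_crestr[OF ne] using Be xL BC by blast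
  qed
qed

definition cset :: "('a set \<Rightarrow> ('a \<Rightarrow> 'b::topological_space) \<Rightarrow> bool) \<Rightarrow> ('a, 'b) cset" where
  "cset R = (let C = ess_Sup_sets M {A. \<exists>x. R A x} in crestr M {x \<in> L0. R C x} C)"

lemma selsys_esup: "selsys R \<Longrightarrow> is_esup M {A. \<exists>x. R A x} (ess_Sup_sets M {A. \<exists>x. R A x})"
  using selsysD(1)[of R] selsysD(5)[of R "\<lambda>_. undefined"] by (intro ess_Sup_sets_is_esup) auto

lemma cset_carrier: "selsys R \<Longrightarrow> cset R \<in> carrier csets"
  using selsys_represent(1)[OF _ selsys_esup] by (auto simp: cset_def csubsets_def Let_def)

lemma sel_cset: "selsys R \<Longrightarrow> sel M (cset R) = R"
  using selsys_represent(2)[OF _ selsys_esup] by (auto simp: cset_def Let_def)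

section \<open>Suprema and infima\<close>

text \<open>The supremum is defined by choice of a least upper bound. Antisymmetry, which is
  \<open>cset_eqI\<close>, makes the choice unique, so that a candidate only has to be tested on
  sections.\<close>

lemma lub_csets:
  assumes P: "P \<in> carrier csets" and \<P>: "\<P> \<subseteq> carrier csets"
    and up: "\<And>Q A x. Q \<in> \<P> \<Longrightarrow> sel M Q A x \<Longrightarrow> sel M P A x"
    and least: "\<And>Q A x. Q \<in> carrier csets \<Longrightarrow> (\<And>P' A x. P' \<in> \<P> \<Longrightarrow> sel M P' A x \<Longrightarrow> sel M Q A x) \<Longrightarrow> sel M P A x \<Longrightarrow> sel M Q A x"
  shows "\<Squnion>\<^bsub>csets\<^esub> \<P> = P"
  unfolding sup_def
proof (rule some_equality)
  have le: "le csets = cond_le M L0" by (simp add: csubsets_def)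
  show l: "least csets P (Upper csets \<P>)"
    unfolding least_def Upper_def le
  proof (safe, goal_cases)
    case (1 Q) then show ?case using up P \<P> by (auto simp: cond_le_iff subset_iff)
  next
    case 2 show ?case by (rule P)
  next
    case (3 Q) 
    have "sel M P' A x \<Longrightarrow> sel M Q A x" if "P' \<in> \<P>" for P' A x
      using 3 that \<P> by (auto simp: cond_le_iff subset_iff)
    then show ?case using 3 P least[of Q] by (auto simp: cond_le_iff)
  qed
  fix Q assume "least csets Q (Upper csets \<P>)"
  with l have "Q \<in> carrier csets" "cond_le M L0 P Q" "cond_le M L0 Q P"
    by (auto simp: least_def Upper_def le)
  then show "Q = P" using P by (intro cset_eqI) (auto simp: cond_le_iff)
qed

lemma glb_csets:
  assumes P: "P \<in> carrier csets" and Q: "Q \<in> carrier csets" and K: "K \<in> carrier csets"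
    and *: "\<And>A x. sel M K A x \<longleftrightarrow> sel M P A x \<and> sel M Q A x"
  shows "P \<sqinter>\<^bsub>csets\<^esub> Q = K"
  unfolding meet_def inf_def
proof (rule some_equality)
  have le: "le csets = cond_le M L0" by (simp add: csubsets_def)
  show l: "greatest csets K (Lower csets {P, Q})"
    unfolding greatest_def Lower_def le using P Q K * by (auto simp: cond_le_iff)
  fix K' assume "greatest csets K' (Lower csets {P, Q})"
  with l have "K' \<in> carrier csets" "cond_le M L0 K K'" "cond_le M L0 K' K"
    by (auto simp: greatest_def Lower_def le)
  then show "K' = K" using K by (intro cset_eqI) (auto simp: cond_le_iff)
qed

end

section \<open>Conditional sets of graphs and the stable Borel sets\<close>

lemma dense_seq_exists:
  "\<exists>d :: nat \<Rightarrow> 'b::euclidean_space. \<forall>y e. 0 < e \<longrightarrow> (\<exists>i. dist (d i) y < e)"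
proof -
  obtain D :: "'b set" where D: "countable D" "\<And>X. open X \<Longrightarrow> X \<noteq> {} \<Longrightarrow> \<exists>d\<in>D. d \<in> X"
    using countable_dense_setE by blast
  have "D \<noteq> {}" using D(2)[of UNIV] by auto
  have "\<exists>i. dist (from_nat_into D i) y < e" if e: "0 < e" for y e
  proof -
    obtain z where "z \<in> D" "z \<in> ball y e" using D(2)[of "ball y e"] e by auto
    then show ?thesis using from_nat_into_surj[OF D(1)] by (metis dist_commute mem_ball)
  qed
  then show ?thesis by blast
qed

text \<open>With a fixed dense sequence, random choices of dense points become choices of natural
  numbers, which \<open>LEAST\<close> makes measurable.\<close>

definition dseq :: "nat \<Rightarrow> 'b::euclidean_space" where
  "dseq = (SOME d. \<forall>y e. 0 < e \<longrightarrow> (\<exists>i. dist (d i) y < e))"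

lemma dseq: "0 < e \<Longrightarrow> \<exists>i. dist (dseq i) y < e"
  using someI_ex[OF dense_seq_exists] unfolding dseq_def by blast

text \<open>For comparing a family of events that lie in a given event literally with one whose
  members do so only up to null sets.\<close>

lemma is_esup_cofinal:
  assumes C: "is_esup M \<A> C" and sub: "\<A> \<subseteq> \<B>"
    and cof: "\<And>B. B \<in> \<B> \<Longrightarrow> \<exists>A\<in>\<A>. AE \<omega>\<in>B in M. \<omega> \<in> A"
  shows "is_esup M \<B> C"
  unfolding is_esup_def
proof (intro conjI ballI impI)
  fix B assume "B \<in> \<B>"
  then obtain A where A: "A \<in> \<A>" "AE \<omega>\<in>B in M. \<omega> \<in> A" using cof by blast
  have "AE \<omega>\<in>A in M. \<omega> \<in> C" using C A(1) by (auto simp: is_esup_def)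
  with A(2) show "AE \<omega>\<in>B in M. \<omega> \<in> C" by eventually_elim auto
next
  fix D assume "D \<in> sets M" "\<forall>B\<in>\<B>. AE \<omega>\<in>B in M. \<omega> \<in> D"
  with C sub show "AE \<omega>\<in>C in M. \<omega> \<in> D" unfolding is_esup_def by (meson subsetD)
qed (use C in \<open>simp add: is_esup_def\<close>)

context complete_prob_space
begin

abbreviation MB :: "('a \<times> 'b::topological_space) measure" where "MB \<equiv> M \<Otimes>\<^sub>M borel"

definition gsel :: "('a \<times> 'b::topological_space) set \<Rightarrow> 'a set \<Rightarrow> ('a \<Rightarrow> 'b) \<Rightarrow> bool" where
  "gsel G A x \<longleftrightarrow> A \<in> events \<and> x \<in> L0 \<and> (AE \<omega>\<in>A in M. (\<omega>, x \<omega>) \<in> G)"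

definition gset :: "('a \<times> 'b::topological_space) set \<Rightarrow> ('a, 'b) cset" where
  "gset G = cset (gsel G)"

lemma selsys_gsel: "selsys (gsel G)"
  unfolding selsys_def
proof (intro conjI allI impI ballI)
  show "gsel G A x \<Longrightarrow> A \<in> events" "gsel G A x \<Longrightarrow> x \<in> L0" for A x by (simp_all add: gsel_def)
  show "gsel G B y" if "gsel G A x" "B \<in> events" "AE \<omega>\<in>B in M. \<omega> \<in> A" "y \<in> L0"
    "AE \<omega>\<in>B in M. y \<omega> = x \<omega>" for A x B y
  proof -
    have "AE \<omega>\<in>A in M. (\<omega>, x \<omega>) \<in> G" using that(1) by (simp add: gsel_def)
    with that(3,5) have "AE \<omega>\<in>B in M. (\<omega>, y \<omega>) \<in> G" by eventually_elim auto
    with that show ?thesis by (simp add: gsel_def)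
  qed
  show "gsel G (\<Union>k. A k) x" if "\<forall>k. gsel G (A k) x" for A :: "nat \<Rightarrow> 'a set" and x
    unfolding gsel_def
  proof (intro conjI AE_disjoint_cover)
    show "AE \<omega>\<in>A k in M. (\<omega>, x \<omega>) \<in> G" for k using that by (simp add: gsel_def)
  qed (use that in \<open>auto simp: gsel_def\<close>)
  show "gsel G {} x" if "x \<in> L0" for x using that by (simp add: gsel_def)
qed

lemma gset_carrier [simp, intro]: "gset G \<in> carrier csets"
  unfolding gset_def by (rule cset_carrier[OF selsys_gsel])

lemma sel_gset: "sel M (gset G) A x \<longleftrightarrow> A \<in> events \<and> x \<in> L0 \<and> (AE \<omega>\<in>A in M. (\<omega>, x \<omega>) \<in> G)"
  unfolding gset_def sel_cset[OF selsys_gsel] gsel_def ..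

lemma graph_section [measurable]:
  assumes [measurable]: "G \<in> sets MB" "x \<in> L0"
  shows "{\<omega> \<in> space M. (\<omega>, x \<omega>) \<in> G} \<in> events"
  by measurable

lemma sel_gset_graph:
  assumes "G \<in> sets MB" "x \<in> L0"
  shows "sel M (gset G) {\<omega> \<in> space M. (\<omega>, x \<omega>) \<in> G} x"
  using graph_section[OF assms] assms by (simp add: sel_gset)

text \<open>For measurable \<open>G\<close> every random point has a largest event over which it is
  a section, namely where its graph lies in \<open>G\<close>; testing on this event
  suffices.\<close>

lemma gset_le_iff:
  assumes G: "G \<in> sets MB"
  shows "cond_le M L0 (gset G) (gset H) \<longleftrightarrow> (\<forall>x\<in>L0. AE \<omega> in M. (\<omega>, x \<omega>) \<in> G \<longrightarrow> (\<omega>, x \<omega>) \<in> H)"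
  unfolding cond_le_iff[OF gset_carrier gset_carrier]
proof safe
  fix x :: "'a \<Rightarrow> 'b" assume x: "x \<in> L0" and "\<forall>A x. sel M (gset G) A x \<longrightarrow> sel M (gset H) A x"
  then have "sel M (gset H) {\<omega> \<in> space M. (\<omega>, x \<omega>) \<in> G} x" using sel_gset_graph[OF G x] by blast
  then have "AE \<omega> in M. \<omega> \<in> {\<omega> \<in> space M. (\<omega>, x \<omega>) \<in> G} \<longrightarrow> (\<omega>, x \<omega>) \<in> H" by (simp add: sel_gset)
  with AE_space show "AE \<omega> in M. (\<omega>, x \<omega>) \<in> G \<longrightarrow> (\<omega>, x \<omega>) \<in> H" by eventually_elim simp
next
  fix A x assume *: "\<forall>x\<in>L0. AE \<omega> in M. (\<omega>, x \<omega>) \<in> G \<longrightarrow> (\<omega>, x \<omega>) \<in> H" and s: "sel M (gset G) A x"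
  then have "AE \<omega>\<in>A in M. (\<omega>, x \<omega>) \<in> G" "AE \<omega> in M. (\<omega>, x \<omega>) \<in> G \<longrightarrow> (\<omega>, x \<omega>) \<in> H"
    by (auto simp: sel_gset)
  then have "AE \<omega>\<in>A in M. (\<omega>, x \<omega>) \<in> H" by eventually_elim auto
  with s show "sel M (gset H) A x" by (simp add: sel_gset)
qed


lemma gset_eqD:
  assumes "G \<in> sets MB" "H \<in> sets MB" "gset G = gset H" "x \<in> L0"
  shows "AE \<omega> in M. (\<omega>, x \<omega>) \<in> G \<longleftrightarrow> (\<omega>, x \<omega>) \<in> H"
proof -
  have "cond_le M L0 (gset G) (gset H)" "cond_le M L0 (gset H) (gset G)"
    using cond_le_iff[OF gset_carrier gset_carrier] assms(3) by metis+
  then have "AE \<omega> in M. (\<omega>, x \<omega>) \<in> G \<longrightarrow> (\<omega>, x \<omega>) \<in> H" "AE \<omega> in M. (\<omega>, x \<omega>) \<in> H \<longrightarrow> (\<omega>, x \<omega>) \<in> G"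
    using assms(1,2,4) gset_le_iff by blast+
  then show ?thesis by eventually_elim blast
qed

lemma crestr_carrier: "cond_pair M L0 V A \<Longrightarrow> crestr M V A \<in> carrier csets"
  by (auto simp: csubsets_def)

lemma ctop_eq_gset: "(ctop M L0 :: ('a, 'b::topological_space) cset) = gset (space MB)"
proof (rule cset_eqI[OF _ gset_carrier])
  have "(\<lambda>_. undefined) \<in> (L0 :: ('a \<Rightarrow> 'b) set)" by simp
  then have ne: "(L0 :: ('a \<Rightarrow> 'b) set) \<noteq> {}" by blast
  show "ctop M L0 \<in> carrier (csets :: ('a, 'b) cset gorder)"
    by (rule crestr_carrier) (auto simp: cond_pair_def stable_set_L0)
  show "sel M (ctop M L0) A x \<longleftrightarrow> sel M (gset (space MB)) A x" for A and x :: "'a \<Rightarrow> 'b"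
  proof -
    have "AE \<omega>\<in>A in M. \<omega> \<in> space M" using AE_space by eventually_elim simp
    then show ?thesis unfolding sel_crestr[OF ne] sel_gset by (auto simp: space_pair_measure)
  qed
qed

lemma cbot_eq_gset: "(cbot M L0 :: ('a, 'b::topological_space) cset) = gset {}"
proof (rule cset_eqI[OF _ gset_carrier])
  have "(\<lambda>_. undefined) \<in> (L0 :: ('a \<Rightarrow> 'b) set)" by simp
  then have ne: "(L0 :: ('a \<Rightarrow> 'b) set) \<noteq> {}" by blast
  show "cbot M L0 \<in> carrier (csets :: ('a, 'b) cset gorder)"
    by (rule crestr_carrier) (auto simp: cond_pair_def stable_set_L0)
  show "sel M (cbot M L0) A x \<longleftrightarrow> sel M (gset {}) A x" for A and x :: "'a \<Rightarrow> 'b"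
    unfolding sel_crestr[OF ne] sel_gset by (auto elim: eventually_mono)
qed

text \<open>A section of the union splits into countably many events on each of which its graph lies
  in a single \<open>G k\<close>; gluing shows that every upper bound contains it. The index set
  covers countable suprema as well as the finite ones of elementary functions.\<close>

lemma gset_UN:
  fixes I :: "nat set"
  assumes G: "\<And>k. G k \<in> sets MB"
  shows "\<Squnion>\<^bsub>csets\<^esub> ((\<lambda>k. gset (G k)) ` I) = gset (\<Union>k\<in>I. G k)"
proof (rule lub_csets)
  fix Q A x assume Q: "Q \<in> (\<lambda>k. gset (G k)) ` I" and s: "sel M Q A x"
  then obtain k where k: "k \<in> I" "sel M (gset (G k)) A x" by blast
  then have "AE \<omega>\<in>A in M. (\<omega>, x \<omega>) \<in> G k" by (simp add: sel_gset)
  then have "AE \<omega>\<in>A in M. (\<omega>, x \<omega>) \<in> (\<Union>k\<in>I. G k)"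
    by eventually_elim (use k in auto)
  with k show "sel M (gset (\<Union>k\<in>I. G k)) A x" by (simp add: sel_gset)
next
  fix Q A x assume Q: "Q \<in> carrier csets" and le: "\<And>P' A x. P' \<in> (\<lambda>k. gset (G k)) ` I \<Longrightarrow> sel M P' A x \<Longrightarrow> sel M Q A x"
    and s: "sel M (gset (\<Union>k\<in>I. G k)) A x"
  have x: "x \<in> L0" and A: "A \<in> events" using s by (auto simp: sel_gset)
  define B where "B k = (if k \<in> I then {\<omega> \<in> space M. (\<omega>, x \<omega>) \<in> G k} else {})" for k
  have "sel M Q (B k) x" for k
    using le[of "gset (G k)"] sel_gset_graph[OF G x] sel_empty[OF Q x] by (auto simp: B_def)
  then have "sel M Q (\<Union>k. B k) x" by (rule sel_glue[OF Q])
  moreover have "AE \<omega>\<in>A in M. \<omega> \<in> (\<Union>k. B k)"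
  proof -
    have "AE \<omega>\<in>A in M. (\<omega>, x \<omega>) \<in> (\<Union>k\<in>I. G k)" using s by (simp add: sel_gset)
    with AE_space show ?thesis by eventually_elim (auto simp: B_def)
  qed
  ultimately show "sel M Q A x" using sel_local[of Q "\<Union>k. B k" x A x] x A by simp
qed auto

lemma gset_meet: "gset G \<sqinter>\<^bsub>csets\<^esub> gset H = gset (G \<inter> H)"
  by (rule glb_csets[OF gset_carrier gset_carrier gset_carrier]) (auto simp: sel_gset elim: eventually_elim2)

lemma selsys_conj: "selsys R \<Longrightarrow> selsys S \<Longrightarrow> selsys (\<lambda>A x. R A x \<and> S A x)"
proof -
  assume R: "selsys R" and S: "selsys S"
  show ?thesis
    unfolding selsys_def
  proof (intro conjI allI impI ballI)
    show "R B y" "S B y" if "R A x \<and> S A x" "B \<in> events" "AE \<omega>\<in>B in M. \<omega> \<in> A" "y \<in> L0"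
      "AE \<omega>\<in>B in M. y \<omega> = x \<omega>" for A x B y
      using that selsysD(3)[OF R, of A x B y] selsysD(3)[OF S, of A x B y] by blast+
    show "R (\<Union>k. A k) x" "S (\<Union>k. A k) x" if "\<forall>k. R (A k) x \<and> S (A k) x" for A :: "nat \<Rightarrow> 'a set" and x
      using that by (intro selsysD(4)[OF R] selsysD(4)[OF S]; simp)+
    show "A \<in> events" "x \<in> L0" if "R A x \<and> S A x" for A x
      using that selsysD(1,2)[OF R, of A x] by blast+
    show "R {} x" "S {} x" if "x \<in> L0" for x
      using that selsysD(5)[OF R, of x] selsysD(5)[OF S, of x] by blast+
  qed
qed

lemma meet_csets:
  assumes "P \<in> carrier csets" "Q \<in> carrier csets"
  shows "P \<sqinter>\<^bsub>csets\<^esub> Q \<in> carrier csets" "sel M (P \<sqinter>\<^bsub>csets\<^esub> Q) A x \<longleftrightarrow> sel M P A x \<and> sel M Q A x"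
proof -
  have s: "selsys (\<lambda>A x. sel M P A x \<and> sel M Q A x)"
    by (intro selsys_conj selsys_sel assms)
  have "P \<sqinter>\<^bsub>csets\<^esub> Q = cset (\<lambda>A x. sel M P A x \<and> sel M Q A x)"
    by (rule glb_csets[OF assms cset_carrier[OF s]]) (simp add: sel_cset[OF s])
  then show "P \<sqinter>\<^bsub>csets\<^esub> Q \<in> carrier csets" "sel M (P \<sqinter>\<^bsub>csets\<^esub> Q) A x \<longleftrightarrow> sel M P A x \<and> sel M Q A x"
    using cset_carrier[OF s] sel_cset[OF s] by auto
qed

text \<open>Uniqueness of complements concerns all conditional sets, not only those of the form
  \<open>gset G\<close>, so joins have to be known in general: a section of the join lies in
  \<open>P\<close> over one event and in \<open>Q\<close> over the rest.\<close>

lemma sel_join: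
  assumes P: "P \<in> carrier csets" and Q: "Q \<in> carrier csets"
  shows "sel M (P \<squnion>\<^bsub>csets\<^esub> Q) A x \<longleftrightarrow> (\<exists>B C. sel M P B x \<and> sel M Q C x \<and> A = B \<union> C)"
proof -
  define R where "R A x \<longleftrightarrow> (\<exists>B C. sel M P B x \<and> sel M Q C x \<and> A = B \<union> C)" for A x
  note sP = selsysD[OF selsys_sel[OF P]] and sQ = selsysD[OF selsys_sel[OF Q]]
  have s: "selsys R"
    unfolding selsys_def
  proof (intro conjI allI impI ballI)
    show "R A x \<Longrightarrow> A \<in> events" "R A x \<Longrightarrow> x \<in> L0" for A x unfolding R_def by (auto simp: sel_def)
    show "R D y" if RA: "R A x" and "D \<in> events" "AE \<omega>\<in>D in M. \<omega> \<in> A" "y \<in> L0"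
      "AE \<omega>\<in>D in M. y \<omega> = x \<omega>" for A x D y
    proof -
      obtain B C where BC: "sel M P B x" "sel M Q C x" "A = B \<union> C" using RA unfolding R_def by blast
      have Be: "B \<in> events" using BC(1) by (simp add: sel_def)
      have "sel M P (D \<inter> B) y"
        using that(2,5) Be by (intro sP(3)[OF BC(1) _ _ that(4)]) (auto elim: eventually_mono)
      moreover have "sel M Q (D - B) y"
        using that(2,3,5) Be BC(3) by (intro sQ(3)[OF BC(2) _ _ that(4)]) (auto elim: eventually_mono)
      ultimately show "R D y" unfolding R_def by blast
    qed
    show "R (\<Union>k. A k) x" if RA: "\<forall>k. R (A k) x" for A :: "nat \<Rightarrow> 'a set" and x
    proof -
      obtain B C where "\<And>k. sel M P (B k) x" "\<And>k. sel M Q (C k) x" "\<And>k. A k = B k \<union> C k"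
        using RA unfolding R_def by metis
      moreover from this have "sel M P (\<Union>k. B k) x" "sel M Q (\<Union>k. C k) x" by (blast intro: sP(4) sQ(4))+
      moreover have "(\<Union>k. A k) = (\<Union>k. B k) \<union> (\<Union>k. C k)" using calculation by auto
      ultimately show ?thesis unfolding R_def by blast
    qed
    show "R {} x" if "x \<in> L0" for x unfolding R_def using sP(5) sQ(5) that by blast
  qed
  have "P \<squnion>\<^bsub>csets\<^esub> Q = cset R"
    unfolding join_def
  proof (rule lub_csets[OF cset_carrier[OF s]])
    fix P' A x assume "P' \<in> {P, Q}" and *: "sel M P' A x"
    moreover from * have "x \<in> L0" by (simp add: sel_def)
    ultimately show "sel M (cset R) A x"
      unfolding sel_cset[OF s] R_def using sP(5)[of x] sQ(5)[of x] by fastforce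
  next
    fix Q' A x assume Q': "Q' \<in> carrier csets" and le: "\<And>P' A x. P' \<in> {P, Q} \<Longrightarrow> sel M P' A x \<Longrightarrow> sel M Q' A x"
      and "sel M (cset R) A x"
    then obtain B C where "sel M Q' B x" "sel M Q' C x" "A = B \<union> C"
      unfolding sel_cset[OF s] R_def using le by blast
    then show "sel M Q' A x" using selsys_Un[OF selsys_sel[OF Q']] by simp
  qed (use P Q in auto)
  then show ?thesis by (simp add: sel_cset[OF s] R_def)
qed

text \<open>The definite description asks for uniqueness among all conditional sets. If
  \<open>Q\<close> meets \<open>gset G\<close> trivially, its sections almost surely avoid
  \<open>G\<close>; if the join is everything, a section that avoids \<open>G\<close> can only come
  from \<open>Q\<close>.\<close>

lemma ccompl_gset:
  assumes G: "(G :: ('a \<times> 'b::topological_space) set) \<in> sets MB"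
  shows "ccompl M L0 (gset G) = gset (space MB - G)"
  unfolding ccompl_def
proof (rule the_equality)
  have "gset G \<squnion>\<^bsub>csets\<^esub> gset (space MB - G) = \<Squnion>\<^bsub>csets\<^esub> ((\<lambda>k::nat. gset (if k = 0 then G else space MB - G)) ` {0, 1})"
    by (simp add: join_def)
  also have "\<dots> = gset (space MB)"
    using G sets.sets_into_space[OF G] by (subst gset_UN) (auto intro!: arg_cong[where f=gset])
  finally show "gset (space MB - G) \<in> carrier csets \<and> gset G \<sqinter>\<^bsub>csets\<^esub> gset (space MB - G) = cbot M L0 \<and>
      gset G \<squnion>\<^bsub>csets\<^esub> gset (space MB - G) = ctop M L0"
    by (simp add: gset_meet cbot_eq_gset ctop_eq_gset)
next
  fix Q assume "Q \<in> carrier csets \<and> gset G \<sqinter>\<^bsub>csets\<^esub> Q = cbot M L0 \<and> gset G \<squnion>\<^bsub>csets\<^esub> Q = ctop M L0"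
  then have Q: "Q \<in> carrier csets" and bot: "gset G \<sqinter>\<^bsub>csets\<^esub> Q = gset {}" and top: "gset G \<squnion>\<^bsub>csets\<^esub> Q = gset (space MB)"
    by (auto simp: cbot_eq_gset ctop_eq_gset)
  have nul: "AE \<omega> in M. \<omega> \<notin> A" if "sel M (gset G) A x" "sel M Q A x" for A x
  proof -
    have "sel M (gset {}) A x" using that meet_csets(2)[OF gset_carrier Q, of G A x] bot by simp
    then show ?thesis by (auto simp: sel_gset)
  qed
  show "Q = gset (space MB - G)"
  proof (rule cset_eqI[OF Q gset_carrier])
    fix A and x :: "'a \<Rightarrow> 'b"
    show "sel M Q A x \<longleftrightarrow> sel M (gset (space MB - G)) A x"
    proof
      assume s: "sel M Q A x"
      then have A: "A \<in> events" and x: "x \<in> L0" by (auto simp: sel_def)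
      let ?B = "A \<inter> {\<omega> \<in> space M. (\<omega>, x \<omega>) \<in> G}"
      have B: "?B \<in> events" using A graph_section[OF G x] by blast
      have "sel M (gset G) ?B x" using B x by (simp add: sel_gset)
      moreover have "sel M Q ?B x" by (rule sel_local[OF s B _ x]) auto
      ultimately have "AE \<omega> in M. \<omega> \<notin> ?B" by (rule nul)
      with AE_space have "AE \<omega>\<in>A in M. (\<omega>, x \<omega>) \<in> space MB - G"
        by eventually_elim (auto simp: space_pair_measure)
      then show "sel M (gset (space MB - G)) A x" using A x by (simp add: sel_gset)
    next
      assume s: "sel M (gset (space MB - G)) A x"
      then have A: "A \<in> events" and x: "x \<in> L0" and G': "AE \<omega>\<in>A in M. (\<omega>, x \<omega>) \<in> space MB - G"
        by (auto simp: sel_gset)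
      have "AE \<omega>\<in>A in M. (\<omega>, x \<omega>) \<in> space MB" using G' by eventually_elim auto
      then have "sel M (gset G \<squnion>\<^bsub>csets\<^esub> Q) A x" unfolding top using A x by (simp add: sel_gset)
      then obtain B C where BC: "sel M (gset G) B x" "sel M Q C x" "A = B \<union> C"
        unfolding sel_join[OF gset_carrier Q] by blast
      have "AE \<omega>\<in>B in M. (\<omega>, x \<omega>) \<in> G" using BC(1) by (simp add: sel_gset)
      with G' have "AE \<omega>\<in>A in M. \<omega> \<in> C" by eventually_elim (use BC(3) in auto)
      then show "sel M Q A x" by (intro sel_local[OF BC(2) A _ x]) auto
    qed
  qed
qed

section \<open>Concatenations, indicators and preimages\<close>

text \<open>The concatenation, given by versions of partial functions, is rewritten as
  \<open>crestr M W D\<close>: \<open>W\<close> consists of the random points that follow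
  \<open>V k\<close> on each \<open>A k\<close>, and \<open>D\<close> is pasted from the domains
  \<open>B k\<close>.\<close>

lemma cconcat_csets:
  assumes A: "is_partition M A" and P: "\<And>k. P k \<in> carrier csets"
  shows "cconcat M A P \<in> carrier csets"
    "sel M (cconcat M A P) B x \<longleftrightarrow> B \<in> events \<and> x \<in> L0 \<and> (\<forall>k. sel M (P k) (B \<inter> A k) x)"
proof -
  have "\<exists>V B. cond_pair M L0 V B \<and> P k = crestr M V B" for k using P[of k] by (auto simp: csubsets_def)
  then obtain V B where VB: "\<And>k. cond_pair M L0 (V k) (B k)" "\<And>k. P k = crestr M (V k) (B k)" by metis
  note V = cond_pairD[OF VB(1)]
  have Ae: "A k \<in> events" for k using A by (auto simp: is_partition_def)
  have Adj: "i = j" if "\<omega> \<in> A i" "\<omega> \<in> A j" for i j \<omega>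
    using A that by (auto simp: is_partition_def disjoint_family_on_def)
  define W where "W = {x \<in> L0. \<forall>k. \<exists>y\<in>V k. AE \<omega>\<in>A k in M. x \<omega> = y \<omega>}"
  define D where "D = (\<Union>k. A k \<inter> B k)"
  have D: "D \<in> events" unfolding D_def using Ae V(4) by blast
  have DA: "\<omega> \<in> D \<longleftrightarrow> \<omega> \<in> B k" if "\<omega> \<in> A k" for \<omega> k
    unfolding D_def using that Adj by blast
  have glue: "\<exists>x\<in>W. is_concat M A y x" if y: "\<And>k. y k \<in> V k" for y
  proof -
    have "y k \<in> L0" for k using y V(2) by blast
    then obtain x where x: "x \<in> L0" "is_concat M A y x"
      by (rule bexE[OF concat_exists[OF A]])
    then have "x \<in> W" unfolding W_def is_concat_def using y by simp blast
    with x show ?thesis by (intro bexI)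
  qed
  have "\<forall>k. \<exists>y. y \<in> V k" using V(1) by blast
  then obtain y0 where "\<And>k. y0 k \<in> V k" by metis
  from glue[OF this] have ne: "W \<noteq> {}" by blast
  have WL: "W \<subseteq> L0" by (auto simp: W_def)
  have stW: "stable_set M W"
    unfolding stable_set_def
  proof (intro conjI ne allI impI, elim conjE)
    fix C xs z assume C: "is_partition M C" and xs: "\<forall>k. xs k \<in> W" and z: "is_concat M C xs z"
    have zL: "z \<in> L0" using concat_measurable[OF complete_measure_axioms C _ z] xs WL by blast
    have "\<exists>y\<in>V k. AE \<omega>\<in>A k in M. z \<omega> = y \<omega>" for k
    proof -
      have "\<forall>j. \<exists>y\<in>V k. AE \<omega>\<in>A k in M. xs j \<omega> = y \<omega>" using xs by (auto simp: W_def)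
      then obtain y where y: "\<And>j. y j \<in> V k" "\<And>j. AE \<omega>\<in>A k in M. xs j \<omega> = y j \<omega>" by metis
      obtain v where v: "v \<in> V k" "is_concat M C y v"
        by (rule bexE[OF stable_set_concat[OF V(3,2) C y(1)]])
      have "AE \<omega>\<in>A k in M. z \<omega> = v \<omega>"
      proof (rule AE_partition[OF C])
        fix j
        have "AE \<omega>\<in>C j in M. z \<omega> = xs j \<omega>" "AE \<omega>\<in>C j in M. v \<omega> = y j \<omega>"
          using z v(2) by (auto simp: is_concat_def)
        with y(2)[of j] show "AE \<omega>\<in>C j in M. \<omega> \<in> A k \<longrightarrow> z \<omega> = v \<omega>"
          by eventually_elim simp
      qed
      with v show ?thesis by blast
    qed
    with zL show "z \<in> W" by (simp add: W_def)
  qed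
  have cp: "cond_pair M L0 W D" using stW WL D by (auto simp: cond_pair_def)
  have eq: "cconcat M A P = crestr M W D"
  proof (intro equalityI subsetI)
    fix u assume "u \<in> cconcat M A P"
    then obtain v where v: "\<And>k. v k \<in> P k" "is_concat M A v u" by (auto simp: cconcat_def)
    then have "\<forall>k. \<exists>y\<in>V k. AE \<omega> in M. v k \<omega> = ((Some \<circ> y) |` B k) \<omega>"
      unfolding VB(2) crestr_def by blast
    then obtain y where y: "\<And>k. y k \<in> V k" "\<And>k. AE \<omega> in M. v k \<omega> = ((Some \<circ> y k) |` B k) \<omega>" by metis
    obtain x where x: "x \<in> W" "is_concat M A y x" by (rule bexE[OF glue[OF y(1)]])
    have "AE \<omega> in M. u \<omega> = ((Some \<circ> x) |` D) \<omega>"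
    proof (rule AE_partition[OF A])
      fix k
      have "AE \<omega>\<in>A k in M. u \<omega> = v k \<omega>" "AE \<omega>\<in>A k in M. x \<omega> = y k \<omega>"
        using v(2) x(2) by (auto simp: is_concat_def)
      with y(2)[of k] show "AE \<omega>\<in>A k in M. u \<omega> = ((Some \<circ> x) |` D) \<omega>"
        by eventually_elim (auto simp: restrict_map_def DA)
    qed
    with x show "u \<in> crestr M W D" by (auto simp: crestr_def)
  next
    fix u assume "u \<in> crestr M W D"
    then obtain x where x: "x \<in> W" "AE \<omega> in M. u \<omega> = ((Some \<circ> x) |` D) \<omega>" by (auto simp: crestr_def)
    from x(1) have "\<forall>k. \<exists>y\<in>V k. AE \<omega>\<in>A k in M. x \<omega> = y \<omega>" by (simp add: W_def)
    then obtain y where y: "\<And>k. y k \<in> V k" "\<And>k. AE \<omega>\<in>A k in M. x \<omega> = y k \<omega>" by metis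
    have "is_concat M A (\<lambda>k. (Some \<circ> y k) |` B k) u"
      unfolding is_concat_def
    proof
      fix k show "AE \<omega>\<in>A k in M. u \<omega> = ((Some \<circ> y k) |` B k) \<omega>"
        using x(2) y(2)[of k] by eventually_elim (auto simp: restrict_map_def DA)
    qed
    moreover have "(Some \<circ> y k) |` B k \<in> P k" for k
      unfolding VB(2) crestr_def using y(1) by blast
    ultimately show "u \<in> cconcat M A P" unfolding cconcat_def
      by (intro CollectI exI[of _ "\<lambda>k. (Some \<circ> y k) |` B k"]) simp
  qed
  show "cconcat M A P \<in> carrier csets" unfolding eq by (rule crestr_carrier[OF cp])
  have Dk: "(AE \<omega>\<in>E in M. \<omega> \<in> D) \<longleftrightarrow> (\<forall>k. AE \<omega>\<in>E \<inter> A k in M. \<omega> \<in> B k)" (is "?l \<longleftrightarrow> ?r") for E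
  proof
    assume l: ?l show ?r
    proof
      fix k show "AE \<omega>\<in>E \<inter> A k in M. \<omega> \<in> B k" using l by eventually_elim (auto simp: DA)
    qed
  next
    assume r: ?r show ?l
    proof (rule AE_partition[OF A])
      fix k from r have "AE \<omega>\<in>E \<inter> A k in M. \<omega> \<in> B k" by blast
      then show "AE \<omega>\<in>A k in M. \<omega> \<in> E \<longrightarrow> \<omega> \<in> D" by eventually_elim (auto simp: DA)
    qed
  qed
  have Wk: "(\<exists>w\<in>W. AE \<omega>\<in>E in M. w \<omega> = x \<omega>) \<longleftrightarrow> (\<forall>k. \<exists>y\<in>V k. AE \<omega>\<in>E \<inter> A k in M. y \<omega> = x \<omega>)"
    (is "?l \<longleftrightarrow> ?r") for E
  proof
    assume ?l
    then obtain w where w: "w \<in> W" "AE \<omega>\<in>E in M. w \<omega> = x \<omega>" by blast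
    show ?r
    proof
      fix k
      obtain y where y: "y \<in> V k" "AE \<omega>\<in>A k in M. w \<omega> = y \<omega>" using w(1) by (auto simp: W_def)
      from y(2) w(2) have "AE \<omega>\<in>E \<inter> A k in M. y \<omega> = x \<omega>" by eventually_elim auto
      with y show "\<exists>y\<in>V k. AE \<omega>\<in>E \<inter> A k in M. y \<omega> = x \<omega>" by blast
    qed
  next
    assume ?r
    then obtain y where y: "\<And>k. y k \<in> V k" "\<And>k. AE \<omega>\<in>E \<inter> A k in M. y k \<omega> = x \<omega>" by metis
    obtain w where w: "w \<in> W" "is_concat M A y w" by (rule bexE[OF glue[OF y(1)]])
    have "AE \<omega>\<in>E in M. w \<omega> = x \<omega>"
    proof (rule AE_partition[OF A])
      fix k
      have "AE \<omega>\<in>A k in M. w \<omega> = y k \<omega>" using w(2) by (auto simp: is_concat_def)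
      with y(2)[of k] show "AE \<omega>\<in>A k in M. \<omega> \<in> E \<longrightarrow> w \<omega> = x \<omega>" by eventually_elim auto
    qed
    with w show ?l by blast
  qed
  show "sel M (cconcat M A P) B' x \<longleftrightarrow> B' \<in> events \<and> x \<in> L0 \<and> (\<forall>k. sel M (P k) (B' \<inter> A k) x)" for B'
    unfolding eq VB(2) sel_crestr[OF ne] sel_crestr[OF V(1)] Dk Wk using Ae by blast
qed

lemma cconcat_gset:
  assumes A: "is_partition M A"
  shows "cconcat M A (\<lambda>k. gset (G k)) = gset (\<Union>k. G k \<inter> (A k \<times> UNIV))"
proof (rule cset_eqI[OF cconcat_csets(1)[OF A gset_carrier] gset_carrier])
  fix B and x :: "'a \<Rightarrow> 'b"
  have Ae: "A k \<in> events" for k using A by (auto simp: is_partition_def)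
  have Adj: "i = j" if "\<omega> \<in> A i" "\<omega> \<in> A j" for i j \<omega>
    using A that by (auto simp: is_partition_def disjoint_family_on_def)
  have "(\<forall>k. AE \<omega>\<in>B \<inter> A k in M. (\<omega>, x \<omega>) \<in> G k) \<longleftrightarrow>
    (AE \<omega>\<in>B in M. (\<omega>, x \<omega>) \<in> (\<Union>k. G k \<inter> (A k \<times> UNIV)))" (is "?l \<longleftrightarrow> ?r")
  proof
    assume l: ?l show ?r
    proof (rule AE_partition[OF A])
      fix k from l have "AE \<omega>\<in>B \<inter> A k in M. (\<omega>, x \<omega>) \<in> G k" by blast
      then show "AE \<omega>\<in>A k in M. \<omega> \<in> B \<longrightarrow> (\<omega>, x \<omega>) \<in> (\<Union>k. G k \<inter> (A k \<times> UNIV))"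
        by eventually_elim auto
    qed
  next
    assume r: ?r show ?l
    proof
      fix k show "AE \<omega>\<in>B \<inter> A k in M. (\<omega>, x \<omega>) \<in> G k"
        using r by eventually_elim (auto dest: Adj)
    qed
  qed
  then show "sel M (cconcat M A (\<lambda>k. gset (G k))) B x \<longleftrightarrow> sel M (gset (\<Union>k. G k \<inter> (A k \<times> UNIV))) B x"
    unfolding cconcat_csets(2)[OF A gset_carrier] sel_gset using Ae by blast
qed

text \<open>Translates the membership tests in \<open>stable_indicator\<close> and
  \<open>cpreimage\<close> into sections.\<close>

lemma restrict_mem_crestr:
  assumes V: "cond_pair M L0 V A" and C: "C \<in> events" "AE \<omega>\<in>C in M. \<omega> \<in> A" and x: "x \<in> L0"
  shows "(Some \<circ> x) |` C \<in> crestr M V C \<longleftrightarrow> sel M (crestr M V A) C x"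
proof -
  have "(AE \<omega> in M. ((Some \<circ> x) |` C) \<omega> = ((Some \<circ> y) |` C) \<omega>) \<longleftrightarrow> (AE \<omega>\<in>C in M. y \<omega> = x \<omega>)" for y
    by (intro eventually_subst always_eventually) (auto simp: restrict_map_def)
  then show ?thesis
    unfolding sel_crestr[OF cond_pairD(1)[OF V]] using C x by (simp add: crestr_def)
qed

text \<open>The event where the graph of \<open>x\<close> lies in \<open>G\<close> is the essential
  supremum in the definition. It lies in \<open>A\<close> only almost surely, so it is its
  intersection with \<open>A\<close> that is admissible.\<close>

lemma stable_indicator_gset:
  assumes V: "cond_pair M L0 V A" and G: "crestr M V A = gset G" "G \<in> sets MB" and x: "x \<in> L0"
  shows "AE \<omega> in M. stable_indicator M V A x \<omega> = indicator G (\<omega>, x \<omega>)"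
proof -
  let ?A = "{A'. A' \<in> events \<and> A' \<subseteq> A \<and> (Some \<circ> x) |` A' \<in> crestr M V A'}"
  let ?B = "{\<omega> \<in> space M. (\<omega>, x \<omega>) \<in> G}"
  have A: "A \<in> events" using cond_pairD[OF V] by simp
  have mem: "C \<in> ?A \<longleftrightarrow> C \<in> events \<and> C \<subseteq> A \<and> (AE \<omega>\<in>C in M. (\<omega>, x \<omega>) \<in> G)" for C
  proof (cases "C \<in> events \<and> C \<subseteq> A")
    case True
    then have "(Some \<circ> x) |` C \<in> crestr M V C \<longleftrightarrow> sel M (gset G) C x"
      unfolding G(1)[symmetric] by (intro restrict_mem_crestr[OF V _ _ x]) auto
    with True x show ?thesis by (simp add: sel_gset)
  qed auto
  have BA: "AE \<omega>\<in>?B in M. \<omega> \<in> A"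
    using sel_gset_graph[OF G(2) x] unfolding G(1)[symmetric] sel_crestr[OF cond_pairD(1)[OF V]] by simp
  have B: "?B \<in> events" by (rule graph_section[OF G(2) x])
  have BAm: "?B \<inter> A \<in> ?A" unfolding mem using A B by auto
  have "is_esup M ?A ?B"
    unfolding is_esup_def
  proof (intro conjI ballI impI B)
    fix C assume "C \<in> ?A"
    then have "AE \<omega>\<in>C in M. (\<omega>, x \<omega>) \<in> G" unfolding mem by blast
    with AE_space show "AE \<omega>\<in>C in M. \<omega> \<in> ?B" by eventually_elim auto
  next
    fix D assume "\<forall>C\<in>?A. AE \<omega>\<in>C in M. \<omega> \<in> D"
    then have "AE \<omega> in M. \<omega> \<in> ?B \<inter> A \<longrightarrow> \<omega> \<in> D" using BAm by blast
    with BA show "AE \<omega>\<in>?B in M. \<omega> \<in> D" by eventually_elim auto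
  qed
  moreover have "is_esup M ?A (ess_Sup_sets M ?A)"
    by (rule ess_Sup_sets_is_esup) (use BAm in auto)
  ultimately have "AE \<omega> in M. \<omega> \<in> ess_Sup_sets M ?A \<longleftrightarrow> \<omega> \<in> ?B" by (rule is_esup_unique[rotated])
  with AE_space show ?thesis
    unfolding stable_indicator_def by eventually_elim (auto simp: indicator_def)
qed

text \<open>On graphs, \<open>f\<close> is the substitution that sends (\<omega>, y) to (\<omega>,
  \<open>F (\<omega>, y)\<close>). The definition takes its supremum over events inside
  \<open>A\<close>, the section system of \<open>?G\<close> over all events; cofinality identifies
  the two.\<close>

lemma cpreimage_gset:
  fixes F :: "'a \<times> 'b::topological_space \<Rightarrow> 'c::topological_space"
  assumes W: "cond_pair M L0 W A" and H: "crestr M W A = gset H" "H \<in> sets MB"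
    and f: "\<And>x. x \<in> L0 \<Longrightarrow> f x \<in> L0" "\<And>x. x \<in> L0 \<Longrightarrow> AE \<omega> in M. f x \<omega> = F (\<omega>, x \<omega>)"
  shows "cpreimage M L0 f W A = gset {z \<in> space MB. (fst z, F z) \<in> H}"
proof -
  let ?G = "{z \<in> space MB. (fst z, F z) \<in> H}"
  let ?A = "{A'. A' \<in> events \<and> A' \<subseteq> A \<and> (\<exists>x\<in>L0. (Some \<circ> f x) |` A' \<in> crestr M W A')}"
  let ?B = "{A'. \<exists>x. gsel ?G A' x}"
  have Ae: "A \<in> events" using cond_pairD[OF W] by simp
  have sel_f: "sel M (gset H) C (f x) \<longleftrightarrow> gsel ?G C x" if x: "x \<in> L0" for C x
  proof -
    have "(AE \<omega>\<in>C in M. (\<omega>, f x \<omega>) \<in> H) \<longleftrightarrow> (AE \<omega>\<in>C in M. (\<omega>, x \<omega>) \<in> ?G)"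
      using f(2)[OF x] AE_space
      by (intro eventually_subst, eventually_elim) (auto simp: space_pair_measure)
    with x f(1)[OF x] show ?thesis by (simp add: sel_gset gsel_def)
  qed
  have mem: "(Some \<circ> f x) |` C \<in> crestr M W C \<longleftrightarrow> gsel ?G C x"
    if "C \<in> events" "AE \<omega>\<in>C in M. \<omega> \<in> A" "x \<in> L0" for C x
    using restrict_mem_crestr[OF W that(1,2) f(1)[OF that(3)]] sel_f[OF that(3)] H(1) by simp
  have csrA: "AE \<omega>\<in>C in M. \<omega> \<in> A" if "gsel ?G C x" for C x
  proof -
    have "x \<in> L0" using that by (simp add: gsel_def)
    from that have "sel M (crestr M W A) C (f x)" unfolding H(1) sel_f[OF \<open>x \<in> L0\<close>] .
    then show ?thesis unfolding sel_crestr[OF cond_pairD(1)[OF W]] by simp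
  qed
  have AB: "?A \<subseteq> ?B"
  proof
    fix D assume D: "D \<in> ?A"
    then obtain x where "x \<in> L0" "(Some \<circ> f x) |` D \<in> crestr M W D" by blast
    with D have "gsel ?G D x" by (subst mem[symmetric]) auto
    then show "D \<in> ?B" by blast
  qed
  \<comment> \<open>The empty event makes the family nonempty, as the existence of its essential
    supremum requires.\<close>
  have u: "(\<lambda>_. undefined) \<in> (L0 :: ('a \<Rightarrow> 'b) set)" by simp
  have "(Some \<circ> f (\<lambda>_. undefined)) |` {} \<in> crestr M W {}"
    using restrict_mem_crestr[OF W _ _ f(1)[OF u], of "{}"] sel_empty[OF crestr_carrier[OF W] f(1)[OF u]] by simp
  then have "\<exists>x\<in>L0. (Some \<circ> f x) |` {} \<in> crestr M W {}" by (intro bexI[of _ "\<lambda>_. undefined"] u)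
  then have empty: "{} \<in> ?A" by simp
  define C where "C = ess_Sup_sets M ?A"
  have "?A \<noteq> {}" by (metis empty empty_iff)
  then have CA: "is_esup M ?A C" unfolding C_def by (intro ess_Sup_sets_is_esup) blast
  have C: "is_esup M ?B C"
  proof (rule is_esup_cofinal[OF CA AB])
    fix D assume "D \<in> ?B"
    then obtain x where D: "gsel ?G D x" by blast
    then have De: "D \<in> events" and x: "x \<in> L0" by (auto simp: gsel_def)
    have DA: "AE \<omega>\<in>D in M. \<omega> \<in> A" by (rule csrA[OF D])
    have "gsel ?G (D \<inter> A) x" by (rule selsysD(3)[OF selsys_gsel D _ _ x]) (use De Ae in auto)
    then have "D \<inter> A \<in> ?A" using mem[of "D \<inter> A" x] De Ae x by auto
    moreover have "AE \<omega>\<in>D in M. \<omega> \<in> D \<inter> A" using DA by eventually_elim auto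
    ultimately show "\<exists>A\<in>?A. AE \<omega>\<in>D in M. \<omega> \<in> A" by blast
  qed
  have Ce: "C \<in> events" using CA by (simp add: is_esup_def)
  have "AE \<omega>\<in>C in M. \<omega> \<in> A"
    using selsys_attained[OF selsys_gsel C] csrA by blast
  then have V: "{x \<in> L0. (Some \<circ> f x) |` C \<in> crestr M W C} = {x \<in> L0. gsel ?G C x}"
    using mem[OF Ce] by blast
  note rep = selsys_represent[OF selsys_gsel C]
  have "cpreimage M L0 f W A = crestr M {x \<in> L0. gsel ?G C x} C"
    unfolding cpreimage_def Let_def C_def[symmetric] V ..
  also have "\<dots> = gset ?G"
    by (rule cset_eqI[OF crestr_carrier[OF rep(1)] gset_carrier])
       (simp only: rep(2), simp add: sel_gset gsel_def)
  finally show ?thesis .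
qed

section \<open>Generation of the stable Borel sets\<close>

lemma stable_ball_gset:
  fixes x :: "'a \<Rightarrow> 'b::euclidean_space"
  assumes x [measurable]: "x \<in> L0" and r [measurable]: "r \<in> L0" and pos: "AE \<omega> in M. 0 < r \<omega>"
  shows "crestr M (stable_ball M x r) (space M) = gset {z \<in> space MB. norm (x (fst z) - snd z) < r (fst z)}"
    (is "_ = gset ?G")
proof (rule cset_eqI[OF crestr_carrier gset_carrier])
  have xb: "x \<in> stable_ball M x r" using x pos by (simp add: stable_ball_def)
  then have ne: "stable_ball M x r \<noteq> {}" by blast
  show "cond_pair M L0 (stable_ball M x r) (space M)"
    unfolding cond_pair_def stable_set_def
  proof (intro conjI allI impI)
    fix A ys y assume *: "is_partition M A \<and> (\<forall>k. ys k \<in> stable_ball M x r) \<and> is_concat M A ys y"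
    then have A: "is_partition M A" and ys: "\<forall>k. ys k \<in> stable_ball M x r" and y: "is_concat M A ys y"
      by blast+
    have "y \<in> L0" using concat_measurable[OF complete_measure_axioms A _ y] ys by (auto simp: stable_ball_def)
    moreover have "AE \<omega> in M. norm (x \<omega> - y \<omega>) < r \<omega>"
    proof (rule AE_partition[OF A])
      fix k
      have "AE \<omega>\<in>A k in M. y \<omega> = ys k \<omega>" "AE \<omega> in M. norm (x \<omega> - ys k \<omega>) < r \<omega>"
        using y ys by (auto simp: is_concat_def stable_ball_def)
      then show "AE \<omega>\<in>A k in M. norm (x \<omega> - y \<omega>) < r \<omega>" by eventually_elim auto
    qed
    ultimately show "y \<in> stable_ball M x r" by (simp add: stable_ball_def)
  next
    show "stable_ball M x r \<noteq> {}" by (rule ne)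
  qed (auto simp: stable_ball_def)
  fix A and z :: "'a \<Rightarrow> 'b"
  have "(AE \<omega>\<in>A in M. \<omega> \<in> space M)" using AE_space by eventually_elim simp
  moreover have "(\<exists>y\<in>stable_ball M x r. AE \<omega>\<in>A in M. y \<omega> = z \<omega>) \<longleftrightarrow>
      (AE \<omega>\<in>A in M. (\<omega>, z \<omega>) \<in> ?G)" (is "?l \<longleftrightarrow> ?r") if A: "A \<in> events" and z: "z \<in> L0"
  proof
    assume ?l
    then obtain y where "AE \<omega> in M. norm (x \<omega> - y \<omega>) < r \<omega>" "AE \<omega>\<in>A in M. y \<omega> = z \<omega>"
      by (auto simp: stable_ball_def)
    with AE_space show ?r by eventually_elim (auto simp: space_pair_measure)
  next
    assume r: ?r
    \<comment> \<open>Off \<open>A\<close> the point is moved to the centre, which belongs to the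
      ball because the radius is positive.\<close>
    define y where "y \<omega> = (if \<omega> \<in> A then z \<omega> else x \<omega>)" for \<omega>
    have "y \<in> L0" unfolding y_def using A z x
      by (intro measurable_If_set) (auto dest: sets.sets_into_space simp: Int_absorb2)
    moreover have "AE \<omega> in M. norm (x \<omega> - y \<omega>) < r \<omega>"
      using r pos by eventually_elim (auto simp: y_def)
    ultimately have "y \<in> stable_ball M x r" by (simp add: stable_ball_def)
    then show ?l by (rule bexI[rotated]) (simp add: y_def)
  qed
  ultimately show "sel M (crestr M (stable_ball M x r) (space M)) A z \<longleftrightarrow> sel M (gset ?G) A z"
    unfolding sel_crestr[OF ne] sel_gset by blast
qed

lemma stable_sigma_algebra_gset:
  "stable_sigma_algebra M (L0 :: ('a \<Rightarrow> 'b::euclidean_space) set) (gset ` sets MB)"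
  unfolding stable_sigma_algebra_def stable_collection_def
proof (intro conjI allI impI ballI)
  show "gset ` sets MB \<subseteq> carrier (csets :: ('a, 'b) cset gorder)" by blast
  show "gset ` sets MB \<noteq> ({} :: ('a, 'b) cset set)" using sets.top by blast
  show "ctop M (L0 :: ('a \<Rightarrow> 'b) set) \<in> gset ` sets MB" unfolding ctop_eq_gset by blast
  show "cconcat M A P \<in> gset ` sets MB" if "is_partition M A \<and> (\<forall>k. P k \<in> gset ` sets MB)"
    for A and P :: "nat \<Rightarrow> ('a, 'b) cset"
  proof -
    from that have "\<forall>k. \<exists>G\<in>sets MB. P k = gset G" by blast
    then obtain G where G: "\<And>k. G k \<in> sets MB" "\<And>k. P k = gset (G k)" by metis
    have A: "is_partition M A" "\<And>k. A k \<in> events" using that by (auto simp: is_partition_def)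
    have "P = (\<lambda>k. gset (G k))" using G(2) by blast
    then have "cconcat M A P = gset (\<Union>k. G k \<inter> (A k \<times> UNIV))" by (simp add: cconcat_gset[OF A(1)])
    moreover have "(\<Union>k. G k \<inter> (A k \<times> UNIV)) \<in> sets MB" using G(1) A(2) by (intro sets.countable_UN) auto
    ultimately show ?thesis by blast
  qed
  show "ccompl M L0 P \<in> gset ` sets MB" if "P \<in> gset ` sets MB" for P :: "('a, 'b) cset"
    using that by (auto simp: ccompl_gset)
  show "\<Squnion>\<^bsub>csets\<^esub> (range P) \<in> gset ` sets MB" if "\<forall>k. P k \<in> gset ` sets MB" for P :: "nat \<Rightarrow> ('a, 'b) cset"
  proof -
    from that have "\<forall>k. \<exists>G\<in>sets MB. P k = gset G" by blast
    then obtain G where G: "\<And>k. G k \<in> sets MB" "\<And>k. P k = gset (G k)" by metis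
    have "P = (\<lambda>k. gset (G k))" using G(2) by blast
    then have "\<Squnion>\<^bsub>csets\<^esub> (range P) = gset (\<Union>k\<in>UNIV. G k)" using gset_UN[OF G(1), where I=UNIV] by simp
    then show ?thesis using G(1) by blast
  qed
qed

text \<open>The graph sets form a stable \<sigma>-algebra that contains the balls. Conversely, balls
  with constant centre and radius yield the strips over open, then over Borel sets; concatenation
  with the least element cuts strips down to rectangles, and these generate the product.\<close>

lemma stable_borel_eq: "(stable_borel M :: ('a, 'b::euclidean_space) cset set) = gset ` sets MB"
proof (intro equalityI)
  have "{z \<in> space MB. norm (x (fst z) - snd z) < r (fst z)} \<in> sets MB"
    if [measurable]: "x \<in> L0" "r \<in> L0" for x :: "'a \<Rightarrow> 'b" and r :: "'a \<Rightarrow> real"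
    by measurable
  then show "stable_borel M \<subseteq> (gset ` sets MB :: ('a, 'b) cset set)"
    unfolding stable_borel_def using stable_sigma_algebra_gset
    by (intro Inter_lower) (auto simp: stable_ball_gset)
  show "(gset ` sets MB :: ('a, 'b) cset set) \<subseteq> stable_borel M"
    unfolding stable_borel_def
  proof (intro Inter_greatest, safe)
    fix \<X> :: "('a, 'b) cset set" and G :: "('a \<times> 'b) set"
    assume X: "stable_sigma_algebra M L0 \<X>" and G: "G \<in> sets MB"
      and ball: "\<forall>x\<in>L0. \<forall>r\<in>L0. (AE \<omega> in M. 0 < r \<omega>) \<longrightarrow> crestr M (stable_ball M x r) (space M) \<in> \<X>"
    have compl: "gset (space MB - G) \<in> \<X>" if "gset G \<in> \<X>" "G \<in> sets MB" for G
      using X that unfolding stable_sigma_algebra_def by (metis ccompl_gset)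
    have un: "gset (\<Union>k. G k) \<in> \<X>" if "\<And>k::nat. gset (G k) \<in> \<X>" "\<And>k. G k \<in> sets MB" for G
    proof -
      have "\<Squnion>\<^bsub>csets\<^esub> (range (\<lambda>k. gset (G k))) \<in> \<X>"
        using X that(1) unfolding stable_sigma_algebra_def by (elim conjE allE[of _ "\<lambda>k. gset (G k)"]) simp
      then show ?thesis using gset_UN[OF that(2), where I=UNIV] by simp
    qed
    have top: "gset (space MB) \<in> \<X>" using X unfolding stable_sigma_algebra_def ctop_eq_gset by blast
    have bot: "gset {} \<in> \<X>" using compl[OF top] by simp
    have op: "gset (space M \<times> U) \<in> \<X>" if U: "open U" for U :: "'b set"
    proof -
      define B where "B i = (let (j, n) = prod_decode i in
        if ball (dseq j) (1 / real (Suc n)) \<subseteq> U then ball (dseq j) (1 / real (Suc n)) else {} :: 'b set)" for i :: nat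
      have "U = (\<Union>i. B i)"
      proof (intro equalityI subsetI)
        fix y assume "y \<in> U"
        then obtain e where e: "0 < e" "ball y e \<subseteq> U" using U openE by blast
        \<comment> \<open>Half of \<open>e\<close>, as a ball whose centre is within its radius of
          \<open>y\<close> reaches less than twice the radius away from \<open>y\<close>.\<close>
        then obtain n where n: "1 / real (Suc n) < e / 2" using nat_approx_posE[of "e / 2"] by auto
        obtain j where j: "dist (dseq j) y < 1 / real (Suc n)" using dseq[of "1 / real (Suc n)" y] by auto
        have "ball (dseq j :: 'b) (1 / real (Suc n)) \<subseteq> ball y e"
        proof
          fix w :: 'b assume "w \<in> ball (dseq j) (1 / real (Suc n))"
          then have "dist y w < 1 / real (Suc n) + 1 / real (Suc n)"
            using j dist_triangle[of y w "dseq j"] by (simp add: dist_commute)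
          then show "w \<in> ball y e" using n by simp
        qed
        then have "y \<in> B (prod_encode (j, n))" using e(2) j by (auto simp: B_def)
        then show "y \<in> (\<Union>i. B i)" by blast
      next
        fix y assume "y \<in> (\<Union>i. B i)"
        then obtain i where i: "y \<in> B i" by blast
        obtain j n where "prod_decode i = (j, n)" by force
        with i show "y \<in> U" by (auto simp: B_def split: if_splits)
      qed
      then have "space M \<times> U = (\<Union>i. space M \<times> B i)" by blast
      moreover have "gset (space M \<times> B i) \<in> \<X>" for i
      proof -
        obtain j n where jn: "prod_decode i = (j, n)" by force
        define d :: 'b where "d = dseq j"
        have "crestr M (stable_ball M (\<lambda>_. d) (\<lambda>_. 1 / real (Suc n))) (space M) \<in> \<X>"
          using ball by simp
        then have "gset {z \<in> space MB. norm (d - snd z) < 1 / real (Suc n)} \<in> \<X>"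
          by (subst (asm) stable_ball_gset) auto
        moreover have "{z \<in> space MB. norm (d - snd z) < 1 / real (Suc n)} = space M \<times> ball d (1 / real (Suc n))"
          by (auto simp: space_pair_measure dist_norm)
        ultimately show ?thesis using bot jn by (auto simp: B_def d_def)
      qed
      moreover have "space M \<times> B i \<in> sets MB" for i
        by (intro pair_measureI) (auto simp: B_def split: prod.splits)
      ultimately show ?thesis using un[of "\<lambda>i. space M \<times> B i"] by simp
    qed
    have bor: "gset (space M \<times> U) \<in> \<X>" if U: "U \<in> sets borel" for U :: "'b set"
      using U unfolding sets_borel
    proof (induction rule: sigma_sets.induct)
      case (Basic U)
      then show ?case by (simp add: op)
    next
      case Empty
      then show ?case by (simp add: bot)
    next
      case (Compl U)
      then have "space M \<times> U \<in> sets MB" by (intro pair_measureI) (auto simp: sets_borel)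
      from compl[OF Compl.IH this] show ?case by (simp add: space_pair_measure Times_Diff_distrib1 Sigma_Diff_distrib2)
    next
      case (Union U)
      have "space M \<times> U i \<in> sets MB" for i using Union(1) by (intro pair_measureI) (auto simp: sets_borel)
      moreover have "(\<Union>i. space M \<times> U i) = space M \<times> (\<Union>i. U i)" by blast
      ultimately show ?case using un[of "\<lambda>i. space M \<times> U i", OF Union.IH] by simp
    qed
    have rect: "gset (A \<times> U) \<in> \<X>" if A: "A \<in> events" and U: "U \<in> sets borel" for A and U :: "'b set"
    proof -
      \<comment> \<open>The strip over \<open>A\<close> is concatenated with the empty set
        elsewhere. Dependence on \<omega> is produced only here, by stability of the
        collection.\<close>
      let ?A = "\<lambda>k::nat. if k = 0 then A else if k = 1 then space M - A else {}"
      let ?G = "\<lambda>k::nat. if k = 0 then space M \<times> U else {}"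
      have "cconcat M ?A (\<lambda>k. gset (?G k)) \<in> \<X>"
        using X is_partition_two[OF A] bor[OF U] bot
        unfolding stable_sigma_algebra_def stable_collection_def by auto
      moreover have "(\<Union>k. ?G k \<inter> (?A k \<times> UNIV)) = A \<times> U"
        using sets.sets_into_space[OF A] by (auto split: if_splits)
      ultimately show ?thesis by (simp add: cconcat_gset[OF is_partition_two[OF A]])
    qed
    show "gset G \<in> \<X>"
      using G unfolding sets_pair_measure
    proof (induction rule: sigma_sets.induct)
      case (Basic a)
      then show ?case using rect by auto
    next
      case Empty
      then show ?case by (simp add: bot)
    next
      case (Compl G)
      then have "G \<in> sets MB" by (simp add: sets_pair_measure)
      from compl[OF Compl.IH this] show ?case by (simp add: space_pair_measure)
    next
      case (Union G)
      then have "G i \<in> sets MB" for i by (simp add: sets_pair_measure)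
      from un[OF Union.IH this] show ?case .
    qed
  qed
qed

end

section \<open>Stable sequentially continuous functions\<close>

text \<open>Composed with a random point, it gives approximations with countably many values, on
  which stability can act.\<close>

definition near :: "nat \<Rightarrow> 'b::euclidean_space \<Rightarrow> nat" where
  "near k y = (LEAST i. dist (dseq i) y < 1 / real (Suc k))"

lemma near_measurable [measurable]: "near k \<in> measurable borel (count_space UNIV)"
  unfolding near_def by measurable

lemma dist_near: "dist (dseq (near k y)) y < 1 / real (Suc k)"
  unfolding near_def by (rule LeastI_ex[OF dseq]) simp

lemma near_tendsto: "(\<lambda>k. dseq (near k y)) \<longlonglongrightarrow> y"
proof (rule metric_tendsto_imp_tendsto[OF LIMSEQ_inverse_real_of_nat])
  show "\<forall>\<^sub>F k in sequentially. dist (dseq (near k y)) y \<le> dist (inverse (real (Suc k))) 0"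
    by (intro always_eventually allI) (simp add: inverse_eq_divide less_imp_le[OF dist_near] del: of_nat_Suc)
qed

text \<open>Suppose each of the finitely many balls covering \<open>T\<close> that come near
  \<open>T\<close> satisfied the bound \<open>e\<close> from some \<open>n\<close> on; by
  monotonicity the largest of these \<open>n\<close> would serve for all of \<open>T\<close>. The
  centre stays close to \<open>T\<close>, which makes repeated choices converge.\<close>

lemma pigeonhole_dseq:
  fixes T :: "'b::euclidean_space set"
  assumes T: "bounded T" and "0 < \<delta>" and mono: "\<And>n i. \<phi> (Suc n) i \<le> (\<phi> n i :: real)"
    and ex: "\<And>n. \<exists>i. dseq i \<in> T \<and> e < \<phi> n i"
  shows "\<exists>c. (\<exists>t\<in>T. dist t (dseq c :: 'b) \<le> \<delta>) \<and> (\<forall>n. \<exists>i. dist (dseq i) (dseq c :: 'b) \<le> \<delta> \<and> e < \<phi> n i)"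
proof (rule ccontr)
  assume no: "\<not> ?thesis"
  have "compact (closure T)" using T by (simp add: compact_closure)
  \<comment> \<open>Half the radius leaves room for moving the centres to dense points.\<close>
  then obtain K where K: "finite K" "closure T \<subseteq> (\<Union>x\<in>K. ball x (\<delta> / 2))"
    using compact_imp_seq_compact seq_compact_imp_totally_bounded \<open>0 < \<delta>\<close> by (metis half_gt_zero)
  have "\<forall>x. \<exists>c. dist (dseq c) x < \<delta> / 2" using dseq[of "\<delta> / 2"] \<open>0 < \<delta>\<close> by auto
  then obtain c where c: "\<And>x. dist (dseq (c x)) (x :: 'b) < \<delta> / 2" by metis
  have cover: "\<exists>x\<in>K. dist t (dseq (c x)) \<le> \<delta>" if "t \<in> T" for t
  proof -
    have "t \<in> closure T" using closure_subset that by blast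
    then have "t \<in> (\<Union>x\<in>K. ball x (\<delta> / 2))" using K(2) by blast
    then obtain x where x: "x \<in> K" "dist x t < \<delta> / 2" by auto
    have "dist t (dseq (c x)) \<le> dist t x + dist x (dseq (c x))" by (rule dist_triangle)
    with x c[of x] show ?thesis by (intro bexI[of _ x]) (auto simp: dist_commute)
  qed
  have "\<exists>n. (\<exists>t\<in>T. dist t (dseq (c x)) \<le> \<delta>) \<longrightarrow> (\<forall>i. dist (dseq i) (dseq (c x) :: 'b) \<le> \<delta> \<longrightarrow> \<phi> n i \<le> e)" for x
  proof (cases "\<exists>t\<in>T. dist t (dseq (c x)) \<le> \<delta>")
    case True
    with no have "\<not> (\<forall>n. \<exists>i. dist (dseq i) (dseq (c x) :: 'b) \<le> \<delta> \<and> e < \<phi> n i)" by blast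
    then obtain n where "\<not> (\<exists>i. dist (dseq i) (dseq (c x) :: 'b) \<le> \<delta> \<and> e < \<phi> n i)" by blast
    then show ?thesis by (intro exI[of _ n]) (auto simp: not_less)
  qed simp
  then obtain n where n: "\<And>x i t. t \<in> T \<Longrightarrow> dist t (dseq (c x)) \<le> \<delta> \<Longrightarrow> dist (dseq i) (dseq (c x) :: 'b) \<le> \<delta> \<Longrightarrow> \<phi> (n x) i \<le> e"
    by metis
  obtain i where i: "dseq i \<in> T" "e < \<phi> (Max (insert 0 (n ` K))) i" using ex by blast
  obtain x where x: "x \<in> K" "dist (dseq i) (dseq (c x) :: 'b) \<le> \<delta>" using cover[OF i(1)] by blast
  have "\<phi> (Max (insert 0 (n ` K))) i \<le> \<phi> (n x) i"
    by (rule lift_Suc_antimono_le[of "\<lambda>n. \<phi> n i"]) (use mono x K in auto)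
  also have "\<dots> \<le> e" by (rule n[OF i(1) x(2) x(2)])
  finally show False using i(2) by simp
qed

context complete_prob_space
begin

abbreviation SC :: "(('a \<Rightarrow> 'b::euclidean_space) \<Rightarrow> 'a \<Rightarrow> real) set" where "SC \<equiv> stable_seq_continuous M"

lemma SC_measurable [measurable (raw)]: "f \<in> SC \<Longrightarrow> x \<in> L0 \<Longrightarrow> f x \<in> L0"
  by (auto simp: stable_seq_continuous_def stable_fun_def)

lemma SC_tendsto:
  "f \<in> SC \<Longrightarrow> (\<And>n. xs n \<in> L0) \<Longrightarrow> x \<in> L0 \<Longrightarrow> AE \<omega> in M. (\<lambda>n. xs n \<omega>) \<longlonglongrightarrow> x \<omega> \<Longrightarrow>
     AE \<omega> in M. (\<lambda>n. f (xs n) \<omega>) \<longlonglongrightarrow> f x \<omega>"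
  unfolding stable_seq_continuous_def by blast

lemma SC_concat:
  "f \<in> SC \<Longrightarrow> is_partition M A \<Longrightarrow> (\<And>k. xs k \<in> L0) \<Longrightarrow> x \<in> L0 \<Longrightarrow> is_concat M A xs x \<Longrightarrow>
     is_concat M A (\<lambda>k. f (xs k)) (f x)"
  unfolding stable_seq_continuous_def stable_fun_def by blast

lemma SC_I:
  assumes "\<And>x. x \<in> L0 \<Longrightarrow> f x \<in> L0"
    and "\<And>A xs x. is_partition M A \<Longrightarrow> (\<And>k. xs k \<in> L0) \<Longrightarrow> x \<in> L0 \<Longrightarrow> is_concat M A xs x \<Longrightarrow>
      is_concat M A (\<lambda>k. f (xs k)) (f x)"
    and "\<And>xs x. (\<And>n. xs n \<in> L0) \<Longrightarrow> x \<in> L0 \<Longrightarrow> AE \<omega> in M. (\<lambda>n. xs n \<omega>) \<longlonglongrightarrow> x \<omega> \<Longrightarrow>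
      AE \<omega> in M. (\<lambda>n. f (xs n) \<omega>) \<longlonglongrightarrow> f x \<omega>"
  shows "f \<in> SC"
  unfolding stable_seq_continuous_def stable_fun_def
  by (intro CollectI conjI ballI allI impI; (elim conjE)?; rule assms; simp)

lemma SC_map2:
  assumes f: "f \<in> SC" and g: "g \<in> SC"
    and meas: "\<And>u v. u \<in> L0 \<Longrightarrow> v \<in> L0 \<Longrightarrow> (\<lambda>\<omega>. h \<omega> (u \<omega>) (v \<omega>)) \<in> L0"
    and cont: "\<And>\<omega> us u vs v. us \<longlonglongrightarrow> u \<Longrightarrow> vs \<longlonglongrightarrow> v \<Longrightarrow> (\<lambda>n. h \<omega> (us n) (vs n)) \<longlonglongrightarrow> h \<omega> u v"
  shows "(\<lambda>x \<omega>. h \<omega> (f x \<omega>) (g x \<omega>)) \<in> SC"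
proof (rule SC_I)
  fix x :: "'a \<Rightarrow> 'b" assume x: "x \<in> L0"
  show "(\<lambda>\<omega>. h \<omega> (f x \<omega>) (g x \<omega>)) \<in> L0"
    by (rule meas[OF SC_measurable[OF f x] SC_measurable[OF g x]])
next
  fix A and xs :: "nat \<Rightarrow> 'a \<Rightarrow> 'b" and x
  assume *: "is_partition M A" "\<And>k. xs k \<in> L0" "x \<in> L0" "is_concat M A xs x"
  show "is_concat M A (\<lambda>k \<omega>. h \<omega> (f (xs k) \<omega>) (g (xs k) \<omega>)) (\<lambda>\<omega>. h \<omega> (f x \<omega>) (g x \<omega>))"
    unfolding is_concat_def
  proof
    fix k
    have "AE \<omega>\<in>A k in M. f x \<omega> = f (xs k) \<omega>" "AE \<omega>\<in>A k in M. g x \<omega> = g (xs k) \<omega>"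
      using SC_concat[OF f *] SC_concat[OF g *] by (simp_all add: is_concat_def)
    then show "AE \<omega>\<in>A k in M. h \<omega> (f x \<omega>) (g x \<omega>) = h \<omega> (f (xs k) \<omega>) (g (xs k) \<omega>)"
      by eventually_elim simp
  qed
next
  fix xs :: "nat \<Rightarrow> 'a \<Rightarrow> 'b" and x
  assume *: "\<And>n. xs n \<in> L0" "x \<in> L0" "AE \<omega> in M. (\<lambda>n. xs n \<omega>) \<longlonglongrightarrow> x \<omega>"
  show "AE \<omega> in M. (\<lambda>n. h \<omega> (f (xs n) \<omega>) (g (xs n) \<omega>)) \<longlonglongrightarrow> h \<omega> (f x \<omega>) (g x \<omega>)"
    using SC_tendsto[OF f *] SC_tendsto[OF g *] by eventually_elim (rule cont)
qed

lemma SC_L0: "r \<in> L0 \<Longrightarrow> (\<lambda>_. r) \<in> SC"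
  by (rule SC_I) (auto simp: is_concat_def)

lemma SC_norm: "(\<lambda>x \<omega>. norm (x \<omega>)) \<in> SC"
proof (rule SC_I)
  fix A and xs :: "nat \<Rightarrow> 'a \<Rightarrow> 'b" and x assume "is_concat M A xs x"
  then have "AE \<omega>\<in>A k in M. x \<omega> = xs k \<omega>" for k by (simp add: is_concat_def)
  then have "AE \<omega>\<in>A k in M. norm (x \<omega>) = norm (xs k \<omega>)" for k
    by (rule eventually_mono) auto
  then show "is_concat M A (\<lambda>k \<omega>. norm (xs k \<omega>)) (\<lambda>\<omega>. norm (x \<omega>))" by (simp add: is_concat_def)
qed (auto intro: tendsto_norm elim: eventually_mono)

lemma SC_add: "f \<in> SC \<Longrightarrow> g \<in> SC \<Longrightarrow> (\<lambda>x \<omega>. f x \<omega> + g x \<omega>) \<in> SC"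
  by (rule SC_map2) (auto intro!: tendsto_intros)

lemma SC_mult: "f \<in> SC \<Longrightarrow> g \<in> SC \<Longrightarrow> (\<lambda>x \<omega>. f x \<omega> * g x \<omega>) \<in> SC"
  by (rule SC_map2) (auto intro!: tendsto_intros)

lemma SC_scale: "r \<in> L0 \<Longrightarrow> f \<in> SC \<Longrightarrow> (\<lambda>x \<omega>. r \<omega> * f x \<omega>) \<in> SC"
  by (intro SC_mult SC_L0)

lemma SC_max: "f \<in> SC \<Longrightarrow> g \<in> SC \<Longrightarrow> (\<lambda>x \<omega>. max (f x \<omega>) (g x \<omega>)) \<in> SC"
  by (rule SC_map2) (auto intro!: tendsto_intros)

lemma SC_min: "f \<in> SC \<Longrightarrow> g \<in> SC \<Longrightarrow> (\<lambda>x \<omega>. min (f x \<omega>) (g x \<omega>)) \<in> SC"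
  by (rule SC_map2) (auto intro!: tendsto_intros)

section \<open>Jointly measurable versions\<close>

text \<open>Stability for the partition into the level sets of \<open>N\<close>: on countably valued
  random points \<open>f\<close> acts locally.\<close>

lemma SC_dseq:
  assumes f: "(f :: ('a \<Rightarrow> 'b::euclidean_space) \<Rightarrow> 'a \<Rightarrow> real) \<in> SC"
    and N [measurable]: "N \<in> measurable M (count_space UNIV)"
  shows "AE \<omega> in M. f (\<lambda>\<omega>. dseq (N \<omega>)) \<omega> = f (\<lambda>_. dseq (N \<omega>)) \<omega>"
proof -
  define A where "A k = {\<omega> \<in> space M. N \<omega> = k}" for k
  have Ae: "A k \<in> events" for k unfolding A_def by measurable
  have A: "is_partition M A"
    using Ae by (auto simp: is_partition_def disjoint_family_on_def A_def)
  have "is_concat M A (\<lambda>k. f (\<lambda>_. dseq k)) (f (\<lambda>\<omega>. dseq (N \<omega>)))"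
    by (rule SC_concat[OF f A]) (auto simp: is_concat_def A_def)
  then have "AE \<omega>\<in>A k in M. f (\<lambda>\<omega>. dseq (N \<omega>)) \<omega> = f (\<lambda>_. dseq k) \<omega>" for k
    by (simp add: is_concat_def)
  then have "AE \<omega>\<in>A k in M. f (\<lambda>\<omega>. dseq (N \<omega>)) \<omega> = f (\<lambda>_. dseq (N \<omega>)) \<omega>" for k
    by (rule eventually_mono) (auto simp: A_def)
  then show ?thesis by (rule AE_partition[OF A])
qed

text \<open>Where the sequence diverges, \<open>lim\<close> is an unspecified value; along each
  fixed random point this happens only on a null set.\<close>

definition version :: "(('a \<Rightarrow> 'b::euclidean_space) \<Rightarrow> 'a \<Rightarrow> real) \<Rightarrow> 'a \<times> 'b \<Rightarrow> real" where
  "version f z = lim (\<lambda>k. f (\<lambda>_. dseq (near k (snd z))) (fst z))"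

lemma version_measurable:
  assumes f: "f \<in> SC" shows "version f \<in> borel_measurable MB"
proof -
  have [measurable]: "(\<lambda>z. f (\<lambda>_. dseq i) (fst z)) \<in> borel_measurable MB" for i
    using SC_measurable[OF f, of "\<lambda>_. dseq i"] by measurable
  have "(\<lambda>z. f (\<lambda>_. dseq (near k (snd z))) (fst z)) \<in> borel_measurable MB" for k
    by (rule measurable_compose_countable[where f="\<lambda>i z. f (\<lambda>_. dseq i) (fst z)"]) measurable
  then show ?thesis unfolding version_def[abs_def] by (rule borel_measurable_lim_metric)
qed

lemma version_eq:
  assumes f: "f \<in> SC" and x [measurable]: "x \<in> L0"
  shows "AE \<omega> in M. f x \<omega> = version f (\<omega>, x \<omega>)"
proof -
  have "AE \<omega> in M. (\<lambda>k. f (\<lambda>\<omega>. dseq (near k (x \<omega>))) \<omega>) \<longlonglongrightarrow> f x \<omega>"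
    by (rule SC_tendsto[OF f _ x]) (auto intro: near_tendsto)
  moreover have "AE \<omega> in M. \<forall>k. f (\<lambda>\<omega>. dseq (near k (x \<omega>))) \<omega> = f (\<lambda>_. dseq (near k (x \<omega>))) \<omega>"
    unfolding AE_all_countable by (intro allI SC_dseq[OF f]) measurable
  ultimately show ?thesis
    by eventually_elim (simp add: version_def limI)
qed

section \<open>Uniform smallness on bounded sets\<close>

text \<open>A random form of the theorem of Dini. Where the conclusion fails, ever smaller bad balls
  are chosen measurably; their centres converge to a random point at which every \<open>F n\<close>
  is at least \<open>e\<close>. Convergence to \<open>0\<close> along this one random point then
  makes the failure event null.\<close>

lemma AE_bounded_small:
  fixes F :: "nat \<Rightarrow> ('a \<Rightarrow> 'b::euclidean_space) \<Rightarrow> 'a \<Rightarrow> real"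
  assumes F: "\<And>n. F n \<in> SC"
    and mono: "\<And>n x. x \<in> L0 \<Longrightarrow> AE \<omega> in M. F (Suc n) x \<omega> \<le> F n x \<omega>"
    and lim: "\<And>x. x \<in> L0 \<Longrightarrow> AE \<omega> in M. (\<lambda>n. F n x \<omega>) \<longlonglongrightarrow> 0"
    and e: "0 < e"
  shows "AE \<omega> in M. \<exists>n. \<forall>i. norm (dseq i :: 'b) \<le> R \<longrightarrow> F n (\<lambda>_. dseq i) \<omega> \<le> e"
proof -
  define \<phi> where "\<phi> n i \<omega> = F n (\<lambda>_. dseq i) \<omega>" for n i \<omega>
  have [measurable]: "\<phi> n i \<in> L0" for n i
    unfolding \<phi>_def[abs_def] by (rule SC_measurable[OF F]) simp
  define Bad where "Bad k c \<omega> \<longleftrightarrow> (\<forall>n. \<exists>i. dist (dseq i) (dseq c :: 'b) \<le> (1/2)^k \<and> e < \<phi> n i \<omega>)" for k c \<omega>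
  have [measurable]: "Measurable.pred M (Bad k c)" for k c unfolding Bad_def by measurable
  define B where "B = {\<omega> \<in> space M. (\<forall>n i. \<phi> (Suc n) i \<omega> \<le> \<phi> n i \<omega>) \<and>
     (\<forall>n. \<exists>i. norm (dseq i :: 'b) \<le> R \<and> e < \<phi> n i \<omega>)}"
  have B [measurable]: "B \<in> events" unfolding B_def by measurable
  \<comment> \<open>The step width bounds \<open>(1/2)^k\<close> from the old centre to some point
    of its ball plus \<open>(1/2)^Suc k\<close> from there to the new centre, and it is summable.
    \<open>LEAST\<close> keeps the choice measurable.\<close>
  define c where "c = rec_nat (\<lambda>\<omega>. LEAST c. Bad 0 c \<omega>)
     (\<lambda>k ck \<omega>. LEAST c'. dist (dseq c') (dseq (ck \<omega>) :: 'b) \<le> 2 * (1/2)^k \<and> Bad (Suc k) c' \<omega>)"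
  have c0: "c 0 \<omega> = (LEAST c. Bad 0 c \<omega>)" and
    cS: "c (Suc k) \<omega> = (LEAST c'. dist (dseq c') (dseq (c k \<omega>) :: 'b) \<le> 2 * (1/2)^k \<and> Bad (Suc k) c' \<omega>)" for k \<omega>
    by (simp_all add: c_def)
  have c_meas [measurable]: "c k \<in> measurable M (count_space UNIV)" for k
  proof (induction k)
    case 0 then show ?case by (subst measurable_cong[OF c0]) measurable
  next
    case (Suc k)
    note [measurable] = Suc
    show ?case by (subst measurable_cong[OF cS]) measurable
  qed
  have bad: "Bad k (c k \<omega>) \<omega>" "dist (dseq (c (Suc k) \<omega>)) (dseq (c k \<omega>) :: 'b) \<le> 2 * (1/2)^k" if \<omega>: "\<omega> \<in> B" for k \<omega>
  proof -
    have mono': "\<And>n i. \<phi> (Suc n) i \<omega> \<le> \<phi> n i \<omega>" using \<omega> by (simp add: B_def)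
    have step: "\<exists>c'. dist (dseq c') (dseq j :: 'b) \<le> 2 * (1/2)^k \<and> Bad (Suc k) c' \<omega>" if "Bad k j \<omega>" for k j
    proof -
      have "\<exists>i. dseq i \<in> cball (dseq j :: 'b) ((1/2)^k) \<and> e < \<phi> n i \<omega>" for n
        using that unfolding Bad_def by (simp add: dist_commute)
      from pigeonhole_dseq[where \<phi>="\<lambda>n i. \<phi> n i \<omega>" and \<delta>="(1/2)^Suc k", OF bounded_cball _ mono' this]
      obtain c' t where c': "dist (dseq j) t \<le> (1/2)^k" "dist t (dseq c' :: 'b) \<le> (1/2)^Suc k" "Bad (Suc k) c' \<omega>"
        unfolding Bad_def by auto
      have "dist (dseq j) (dseq c' :: 'b) \<le> (1/2)^k + (1/2)^Suc k"
        using dist_triangle[of "dseq j" "dseq c'" t] c'(1,2) by linarith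
      also have "\<dots> \<le> 2 * (1/2)^k" by simp
      finally show ?thesis using c'(3) by (auto simp: dist_commute)
    qed
    have B0: "Bad k (c k \<omega>) \<omega>" for k
    proof (induction k)
      case 0
      have "\<exists>i. dseq i \<in> cball (0 :: 'b) R \<and> e < \<phi> n i \<omega>" for n
        using \<omega> by (simp add: B_def)
      from pigeonhole_dseq[where \<phi>="\<lambda>n i. \<phi> n i \<omega>" and \<delta>="1", OF bounded_cball _ mono' this]
      have "\<exists>c. Bad 0 c \<omega>" unfolding Bad_def by auto
      then show ?case unfolding c0 by (rule LeastI_ex)
    next
      case (Suc k)
      show ?case using LeastI_ex[OF step[OF Suc]] unfolding cS by simp
    qed
    show "Bad k (c k \<omega>) \<omega>" by (rule B0)
    show "dist (dseq (c (Suc k) \<omega>)) (dseq (c k \<omega>) :: 'b) \<le> 2 * (1/2)^k"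
      using LeastI_ex[OF step[OF B0]] unfolding cS by simp
  qed
  \<comment> \<open>Off \<open>B\<close> both \<open>x\<close> and the indices chosen below refer to
    \<open>dseq 0\<close>, so that the approximation converges everywhere and
    \<open>SC_tendsto\<close> applies.\<close>
  define x where "x \<omega> = (if \<omega> \<in> B then lim (\<lambda>k. dseq (c k \<omega>) :: 'b) else dseq 0)" for \<omega>
  have x [measurable]: "x \<in> L0" unfolding x_def[abs_def] by measurable
  have xlim: "(\<lambda>k. dseq (c k \<omega>)) \<longlonglongrightarrow> x \<omega>" if \<omega>: "\<omega> \<in> B" for \<omega>
  proof -
    have "summable (\<lambda>k. dseq (c (Suc k) \<omega>) - dseq (c k \<omega>) :: 'b)"
    proof (rule summable_comparison_test')
      show "summable (\<lambda>k. 2 * (1/2)^k :: real)" by (intro summable_mult summable_geometric) simp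
      show "norm (dseq (c (Suc k) \<omega>) - dseq (c k \<omega>) :: 'b) \<le> 2 * (1/2)^k" for k
        using bad(2)[OF \<omega>] by (simp add: dist_norm)
    qed
    then have "(\<lambda>n. \<Sum>k<n. dseq (c (Suc k) \<omega>) - dseq (c k \<omega>) :: 'b) \<longlonglongrightarrow> (\<Sum>k. dseq (c (Suc k) \<omega>) - dseq (c k \<omega>))"
      by (rule summable_LIMSEQ)
    then have "(\<lambda>n. (dseq (c n \<omega>) - dseq (c 0 \<omega>)) + dseq (c 0 \<omega>) :: 'b) \<longlonglongrightarrow>
        (\<Sum>k. dseq (c (Suc k) \<omega>) - dseq (c k \<omega>)) + dseq (c 0 \<omega>)"
      unfolding sum_lessThan_telescope[of "\<lambda>k. dseq (c k \<omega>)"] by (intro tendsto_intros)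
    then have "convergent (\<lambda>n. dseq (c n \<omega>) :: 'b)" by (auto simp: convergent_def)
    then show ?thesis using \<omega> by (simp add: x_def convergent_LIMSEQ_iff)
  qed
  \<comment> \<open>For fixed \<open>n\<close> the witnesses that the successive balls are bad are
    dense points tending to \<open>x\<close>; continuity of \<open>F n\<close> carries their bound
    over to \<open>x\<close>.\<close>
  have ge: "AE \<omega>\<in>B in M. e \<le> F n x \<omega>" for n
  proof -
    define i where "i k \<omega> = (if \<omega> \<in> B then LEAST i. dist (dseq i) (dseq (c k \<omega>) :: 'b) \<le> (1/2)^k \<and> e < \<phi> n i \<omega> else 0)" for k \<omega>
    have i_meas [measurable]: "i k \<in> measurable M (count_space UNIV)" for k unfolding i_def[abs_def] by measurable
    have i: "dist (dseq (i k \<omega>)) (dseq (c k \<omega>) :: 'b) \<le> (1/2)^k" "e < \<phi> n (i k \<omega>) \<omega>" if "\<omega> \<in> B" for k \<omega>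
    proof -
      have "\<exists>i. dist (dseq i) (dseq (c k \<omega>) :: 'b) \<le> (1/2)^k \<and> e < \<phi> n i \<omega>"
        using bad(1)[OF that, of k] unfolding Bad_def by blast
      from LeastI_ex[OF this] that
      show "dist (dseq (i k \<omega>)) (dseq (c k \<omega>) :: 'b) \<le> (1/2)^k" "e < \<phi> n (i k \<omega>) \<omega>" by (simp_all add: i_def)
    qed
    have ylim: "(\<lambda>k. dseq (i k \<omega>)) \<longlonglongrightarrow> x \<omega>" for \<omega>
    proof (cases "\<omega> \<in> B")
      case True
      have "(\<lambda>k. dseq (i k \<omega>) - dseq (c k \<omega>) :: 'b) \<longlonglongrightarrow> 0"
      proof (rule Lim_null_comparison)
        show "\<forall>\<^sub>F k in sequentially. norm (dseq (i k \<omega>) - dseq (c k \<omega>) :: 'b) \<le> (1/2)^k"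
          using i(1)[OF True] by (simp add: dist_norm)
        show "(\<lambda>k. (1/2)^k :: real) \<longlonglongrightarrow> 0" by (rule LIMSEQ_realpow_zero) auto
      qed
      from tendsto_add[OF this xlim[OF True]] show ?thesis by simp
    qed (simp add: i_def x_def)
    have "AE \<omega> in M. (\<lambda>k. F n (\<lambda>\<omega>. dseq (i k \<omega>)) \<omega>) \<longlonglongrightarrow> F n x \<omega>"
      by (rule SC_tendsto[OF F _ x]) (auto intro: ylim)
    moreover have "AE \<omega> in M. \<forall>k. F n (\<lambda>\<omega>. dseq (i k \<omega>)) \<omega> = F n (\<lambda>_. dseq (i k \<omega>)) \<omega>"
      unfolding AE_all_countable by (intro allI SC_dseq[OF F]) measurable
    ultimately show ?thesis
    proof eventually_elim
      case (elim \<omega>)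
      show ?case
      proof
        assume "\<omega> \<in> B"
        then have "e \<le> F n (\<lambda>\<omega>. dseq (i k \<omega>)) \<omega>" for k
          using i(2)[of \<omega> k] elim(2) by (simp add: \<phi>_def less_imp_le)
        then show "e \<le> F n x \<omega>" by (intro LIMSEQ_le_const[OF elim(1)]) auto
      qed
    qed
  qed
  have "AE \<omega> in M. \<forall>n. \<omega> \<in> B \<longrightarrow> e \<le> F n x \<omega>" unfolding AE_all_countable using ge by blast
  with lim[OF x] have notB: "AE \<omega> in M. \<omega> \<notin> B"
  proof eventually_elim
    case (elim \<omega>)
    show ?case
    proof
      assume "\<omega> \<in> B"
      then have "e \<le> 0" using elim by (intro LIMSEQ_le_const[OF elim(1)]) auto
      with e show False by simp
    qed
  qed
  have "AE \<omega> in M. \<forall>n i. \<phi> (Suc n) i \<omega> \<le> \<phi> n i \<omega>"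
    unfolding AE_all_countable \<phi>_def by (intro allI mono) simp
  with notB AE_space show ?thesis
    by eventually_elim (auto simp: B_def \<phi>_def not_less)
qed

end

locale stable_positive_functional = complete_prob_space M for M :: "'a measure" +
  fixes L :: "(('a \<Rightarrow> 'b::euclidean_space) \<Rightarrow> 'a \<Rightarrow> real) \<Rightarrow> 'a \<Rightarrow> real"
  assumes L_meas [measurable (raw)]: "f \<in> SC \<Longrightarrow> L f \<in> borel_measurable M"
    and L_linear: "f \<in> SC \<Longrightarrow> g \<in> SC \<Longrightarrow> r \<in> borel_measurable M \<Longrightarrow>
      AE \<omega> in M. L (\<lambda>x \<omega>. f x \<omega> + r \<omega> * g x \<omega>) \<omega> = L f \<omega> + r \<omega> * L g \<omega>"
    and L_nonneg: "f \<in> SC \<Longrightarrow> (\<And>x. x \<in> borel_measurable M \<Longrightarrow> AE \<omega> in M. 0 \<le> f x \<omega>) \<Longrightarrow> AE \<omega> in M. 0 \<le> L f \<omega>"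
begin

lemma SC_const: "(\<lambda>_ _. c) \<in> SC"
  by (rule SC_L0) simp

lemma L_zero: "AE \<omega> in M. L (\<lambda>_ _. 0) \<omega> = 0"
  using L_linear[OF SC_const[of 0] SC_const[of 0], of "\<lambda>_. 1"] by simp

lemma L_scale: "r \<in> L0 \<Longrightarrow> f \<in> SC \<Longrightarrow> AE \<omega> in M. L (\<lambda>x \<omega>. r \<omega> * f x \<omega>) \<omega> = r \<omega> * L f \<omega>"
  using L_linear[OF SC_const[of 0], of f r] L_zero by (auto elim: eventually_elim2)

lemma L_add: "f \<in> SC \<Longrightarrow> g \<in> SC \<Longrightarrow> AE \<omega> in M. L (\<lambda>x \<omega>. f x \<omega> + g x \<omega>) \<omega> = L f \<omega> + L g \<omega>"
  using L_linear[of f g "\<lambda>_. 1"] by simp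

lemma L_diff: "f \<in> SC \<Longrightarrow> g \<in> SC \<Longrightarrow> AE \<omega> in M. L (\<lambda>x \<omega>. f x \<omega> - g x \<omega>) \<omega> = L f \<omega> - L g \<omega>"
  using L_linear[of f g "\<lambda>_. -1"] by simp

lemma SC_diff: "f \<in> SC \<Longrightarrow> g \<in> SC \<Longrightarrow> (\<lambda>x \<omega>. f x \<omega> - g x \<omega>) \<in> SC"
  by (rule SC_map2) (auto intro!: tendsto_intros)

lemma L_mono:
  assumes f: "f \<in> SC" and g: "g \<in> SC" and le: "\<And>x. x \<in> L0 \<Longrightarrow> AE \<omega> in M. f x \<omega> \<le> g x \<omega>"
  shows "AE \<omega> in M. L f \<omega> \<le> L g \<omega>"
proof -
  have "AE \<omega> in M. 0 \<le> L (\<lambda>x \<omega>. g x \<omega> - f x \<omega>) \<omega>"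
    by (rule L_nonneg[OF SC_diff[OF g f]]) (use le in simp)
  with L_diff[OF g f] show ?thesis by eventually_elim simp
qed


section \<open>Continuity of the functional at zero\<close>

text \<open>The index from which \<open>F n\<close> is small on a ball depends on \<omega>.
  Multiplication by the indicator of \<open>A j n\<close> turns smallness on this event into a bound
  along all random points, and linearity of \<open>L\<close> over the random variables takes the
  indicator out again.\<close>

lemma L_sigma_continuous:
  assumes F: "\<And>n. F n \<in> SC"
    and nonneg: "\<And>n x. x \<in> L0 \<Longrightarrow> AE \<omega> in M. 0 \<le> F n x \<omega>"
    and mono: "\<And>n x. x \<in> L0 \<Longrightarrow> AE \<omega> in M. F (Suc n) x \<omega> \<le> F n x \<omega>"
    and lim: "\<And>x. x \<in> L0 \<Longrightarrow> AE \<omega> in M. (\<lambda>n. F n x \<omega>) \<longlonglongrightarrow> 0"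
  shows "AE \<omega> in M. (\<lambda>n. L (F n) \<omega>) \<longlonglongrightarrow> 0"
proof -
  \<comment> \<open>One majorant for two regions: the summand \<open>1\<close> serves inside the
    ball of radius \<open>j + 1\<close>, the summand with the norm outside, where
    \<open>F n \<le> F 0\<close>.\<close>
  define G where "G x \<omega> = 1 + F 0 x \<omega> * norm (x \<omega>)" for x \<omega>
  have G: "G \<in> SC" unfolding G_def[abs_def] by (intro SC_add SC_const SC_mult F SC_norm)
  define A where "A j n = {\<omega> \<in> space M. \<forall>i. norm (dseq i :: 'b) \<le> real (Suc j) \<longrightarrow> F n (\<lambda>_. dseq i) \<omega> \<le> 1 / real (Suc j)}" for j n
  have [measurable]: "F n (\<lambda>_. dseq i) \<in> L0" for n i by (rule SC_measurable[OF F]) simp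
  have A [measurable]: "A j n \<in> events" for j n unfolding A_def by measurable
  have ex: "AE \<omega> in M. \<forall>j. \<exists>n. \<omega> \<in> A j n"
    unfolding AE_all_countable
  proof
    fix j
    have "AE \<omega> in M. \<exists>n. \<forall>i. norm (dseq i :: 'b) \<le> real (Suc j) \<longrightarrow> F n (\<lambda>_. dseq i) \<omega> \<le> 1 / real (Suc j)"
      by (rule AE_bounded_small[OF F mono lim]) auto
    with AE_space show "AE \<omega> in M. \<exists>n. \<omega> \<in> A j n" by eventually_elim (auto simp: A_def)
  qed
  have bound: "AE \<omega> in M. indicator (A j n) \<omega> * F n x \<omega> \<le> 1 / real (Suc j) * G x \<omega>" if x [measurable]: "x \<in> L0" for j n x
  proof -
    have "AE \<omega> in M. (\<lambda>k. F n (\<lambda>\<omega>. dseq (near k (x \<omega>))) \<omega>) \<longlonglongrightarrow> F n x \<omega>"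
      by (rule SC_tendsto[OF F _ x]) (auto intro: near_tendsto)
    moreover have "AE \<omega> in M. \<forall>k. F n (\<lambda>\<omega>. dseq (near k (x \<omega>))) \<omega> = F n (\<lambda>_. dseq (near k (x \<omega>))) \<omega>"
      unfolding AE_all_countable by (intro allI SC_dseq[OF F]) measurable
    moreover have "AE \<omega> in M. \<forall>n. 0 \<le> F n x \<omega>" "AE \<omega> in M. \<forall>n. F (Suc n) x \<omega> \<le> F n x \<omega>"
      unfolding AE_all_countable using nonneg[OF x] mono[OF x] by blast+
    ultimately show ?thesis
    proof eventually_elim
      case (elim \<omega>)
      have F0: "F n x \<omega> \<le> F 0 x \<omega>" by (rule lift_Suc_antimono_le[of "\<lambda>n. F n x \<omega>"]) (use elim in auto)
      have G1: "1 \<le> G x \<omega>" using elim(3) by (simp add: G_def)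
      show ?case
      proof (cases "\<omega> \<in> A j n")
        case False
        then show ?thesis using G1 by (simp add: indicator_def)
      next
        case True
        show ?thesis
        proof (cases "norm (x \<omega>) < real (Suc j)")
          \<comment> \<open>Strict inequality keeps the approximating dense points inside the ball
            from some index on.\<close>
          case lt: True
          have "(\<lambda>k. norm (dseq (near k (x \<omega>)) :: 'b)) \<longlonglongrightarrow> norm (x \<omega>)" by (intro tendsto_norm near_tendsto)
          then have "eventually (\<lambda>k. norm (dseq (near k (x \<omega>)) :: 'b) < real (Suc j)) sequentially"
            using lt by (rule order_tendstoD)
          then have "eventually (\<lambda>k. F n (\<lambda>\<omega>. dseq (near k (x \<omega>))) \<omega> \<le> 1 / real (Suc j)) sequentially"
            by (rule eventually_mono) (use True elim(2) in \<open>auto simp: A_def\<close>)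
          then have "F n x \<omega> \<le> 1 / real (Suc j)"
            by (intro tendsto_upperbound[OF elim(1)]) auto
          also have "\<dots> \<le> 1 / real (Suc j) * G x \<omega>" using G1 by (simp add: field_simps)
          finally show ?thesis using True by simp
        next
          case False
          have "F 0 x \<omega> * real (Suc j) \<le> F 0 x \<omega> * norm (x \<omega>)"
            using False elim(3) by (intro mult_left_mono) auto
          also have "\<dots> \<le> G x \<omega>" by (simp add: G_def)
          finally have "F 0 x \<omega> \<le> 1 / real (Suc j) * G x \<omega>" by (simp add: field_simps)
          with F0 True show ?thesis by simp
        qed
      qed
    qed
  qed
  have "AE \<omega> in M. \<forall>j n. indicator (A j n) \<omega> * L (F n) \<omega> \<le> 1 / real (Suc j) * L G \<omega>"
    unfolding AE_all_countable
  proof (intro allI)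
    fix j n
    have "AE \<omega> in M. L (\<lambda>x \<omega>. indicator (A j n) \<omega> * F n x \<omega>) \<omega> \<le> L (\<lambda>x \<omega>. 1 / real (Suc j) * G x \<omega>) \<omega>"
      by (intro L_mono SC_scale F G bound) measurable
    moreover have "AE \<omega> in M. L (\<lambda>x \<omega>. indicator (A j n) \<omega> * F n x \<omega>) \<omega> = indicator (A j n) \<omega> * L (F n) \<omega>"
      by (intro L_scale F) measurable
    moreover have "AE \<omega> in M. L (\<lambda>x \<omega>. 1 / real (Suc j) * G x \<omega>) \<omega> = 1 / real (Suc j) * L G \<omega>"
      by (intro L_scale[of "\<lambda>_. 1 / real (Suc j)"] G) measurable
    ultimately show "AE \<omega> in M. indicator (A j n) \<omega> * L (F n) \<omega> \<le> 1 / real (Suc j) * L G \<omega>"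
      by eventually_elim simp
  qed
  moreover have "AE \<omega> in M. \<forall>n. 0 \<le> L (F n) \<omega>"
    unfolding AE_all_countable by (intro allI L_nonneg F nonneg)
  moreover have "AE \<omega> in M. \<forall>n. L (F (Suc n)) \<omega> \<le> L (F n) \<omega>"
    unfolding AE_all_countable by (intro allI L_mono F mono)
  ultimately show ?thesis using ex
  proof eventually_elim
    case (elim \<omega>)
    show ?case
    proof (rule LIMSEQ_I)
      fix e :: real assume e: "0 < e"
      obtain j where j: "\<bar>L G \<omega>\<bar> / e < real j" using reals_Archimedean2 by blast
      then have "\<bar>L G \<omega>\<bar> < e * real (Suc j)" using e by (simp add: field_simps)
      then have j': "1 / real (Suc j) * L G \<omega> < e" by (simp add: field_simps)
      obtain n where n: "\<omega> \<in> A j n" using elim(4) by blast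
      have "norm (L (F m) \<omega> - 0) < e" if "n \<le> m" for m
      proof -
        have "L (F m) \<omega> \<le> L (F n) \<omega>" by (rule lift_Suc_antimono_le[of "\<lambda>n. L (F n) \<omega>"]) (use elim that in auto)
        also have "\<dots> \<le> 1 / real (Suc j) * L G \<omega>" using elim(1)[rule_format, of j n] n by simp
        finally show ?thesis using j' elim(2) by simp
      qed
      then show "\<exists>n. \<forall>m\<ge>n. norm (L (F m) \<omega> - 0) < e" by blast
    qed
  qed
qed

end

section \<open>The joint measure of a positive functional\<close>

text \<open>Dominated convergence for the counting measure; it makes the weighted series in
  \<open>H_UN\<close> continuous along random points.\<close>

lemma tendsto_half_series:
  fixes a :: "nat \<Rightarrow> nat \<Rightarrow> real"
  assumes a: "\<And>n k. \<bar>a k n\<bar> \<le> 1" and lim: "\<And>n. (\<lambda>k. a k n) \<longlonglongrightarrow> b n"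
  shows "(\<lambda>k. \<Sum>n. (1/2)^Suc n * a k n) \<longlonglongrightarrow> (\<Sum>n. (1/2)^Suc n * b n)"
proof -
  have b: "\<bar>b n\<bar> \<le> 1" for n
    by (rule LIMSEQ_le_const2[OF tendsto_rabs[OF lim]]) (use a in auto)
  have s: "summable (\<lambda>n. (1/2)^Suc n :: real)" using power_half_series sums_summable by blast
  have int: "integrable (count_space UNIV) (\<lambda>n. (1/2)^Suc n * c n)" if "\<And>n. \<bar>c n\<bar> \<le> 1" for c :: "nat \<Rightarrow> real"
    unfolding integrable_count_space_nat_iff
    by (rule summable_comparison_test'[OF s]) (simp add: abs_mult mult_left_le that)
  have "(\<lambda>k. \<integral>n. (1/2)^Suc n * a k n \<partial>count_space UNIV) \<longlonglongrightarrow> (\<integral>n. (1/2)^Suc n * b n \<partial>count_space UNIV)"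
  proof (rule integral_dominated_convergence[where w="\<lambda>n. (1/2)^Suc n * 1"])
    show "integrable (count_space UNIV) (\<lambda>n. (1/2)^Suc n * 1 :: real)" by (rule int) simp
    show "AE n in count_space UNIV. (\<lambda>k. (1/2)^Suc n * a k n) \<longlonglongrightarrow> (1/2)^Suc n * b n"
      by (intro AE_I2 tendsto_intros lim)
    show "AE n in count_space UNIV. norm ((1/2)^Suc n * a k n) \<le> (1/2)^Suc n * 1" for k
      by (intro AE_I2) (simp add: abs_mult mult_left_le a)
  qed auto
  then show ?thesis
    unfolding integral_count_space_nat[OF int[of "a _", OF a]] integral_count_space_nat[OF int[of b, OF b]] .
qed

context complete_prob_space
begin

text \<open>Turns a function on the product into an operation on random points;
  \<open>hat (version f)\<close> agrees with \<open>f\<close> almost surely at each of them.\<close>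

definition hat :: "('a \<times> 'b \<Rightarrow> real) \<Rightarrow> ('a \<Rightarrow> 'b) \<Rightarrow> 'a \<Rightarrow> real" where
  "hat F = (\<lambda>x \<omega>. F (\<omega>, x \<omega>))"

lemma hat_SC:
  assumes F [measurable]: "F \<in> borel_measurable MB"
    and cont: "\<And>xs x. (\<And>n. xs n \<in> L0) \<Longrightarrow> x \<in> L0 \<Longrightarrow> AE \<omega> in M. (\<lambda>n. xs n \<omega>) \<longlonglongrightarrow> x \<omega> \<Longrightarrow>
      AE \<omega> in M. (\<lambda>n. F (\<omega>, xs n \<omega>)) \<longlonglongrightarrow> F (\<omega>, x \<omega>)"
  shows "hat F \<in> SC"
proof (rule SC_I)
  fix x :: "'a \<Rightarrow> 'b" assume [measurable]: "x \<in> L0"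
  show "hat F x \<in> L0" unfolding hat_def by measurable
next
  fix A and xs :: "nat \<Rightarrow> 'a \<Rightarrow> 'b" and x assume "is_concat M A xs x"
  then have "AE \<omega>\<in>A k in M. x \<omega> = xs k \<omega>" for k by (simp add: is_concat_def)
  then have "AE \<omega>\<in>A k in M. F (\<omega>, x \<omega>) = F (\<omega>, xs k \<omega>)" for k
    by (rule eventually_mono) auto
  then show "is_concat M A (\<lambda>k. hat F (xs k)) (hat F x)" by (simp add: is_concat_def hat_def)
qed (unfold hat_def, rule cont)

lemma SC_cong:
  assumes f: "f \<in> SC" and g: "\<And>x. x \<in> L0 \<Longrightarrow> g x \<in> L0" and eq: "\<And>x. x \<in> L0 \<Longrightarrow> AE \<omega> in M. g x \<omega> = f x \<omega>"
  shows "g \<in> SC"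
proof (rule SC_I[OF g])
  fix A and xs :: "nat \<Rightarrow> 'a \<Rightarrow> 'b" and x
  assume *: "is_partition M A" "\<And>k. xs k \<in> L0" "x \<in> L0" "is_concat M A xs x"
  show "is_concat M A (\<lambda>k. g (xs k)) (g x)"
    unfolding is_concat_def
  proof
    fix k
    have "AE \<omega>\<in>A k in M. f x \<omega> = f (xs k) \<omega>"
      using SC_concat[OF f *] by (simp add: is_concat_def)
    with eq[OF *(3)] eq[OF *(2)[of k]] show "AE \<omega>\<in>A k in M. g x \<omega> = g (xs k) \<omega>"
      by eventually_elim simp
  qed
next
  fix xs :: "nat \<Rightarrow> 'a \<Rightarrow> 'b" and x
  assume *: "\<And>n. xs n \<in> L0" "x \<in> L0" "AE \<omega> in M. (\<lambda>n. xs n \<omega>) \<longlonglongrightarrow> x \<omega>"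
  have "AE \<omega> in M. \<forall>n. g (xs n) \<omega> = f (xs n) \<omega>"
    unfolding AE_all_countable using eq[OF *(1)] by blast
  with SC_tendsto[OF f *] eq[OF *(2)] show "AE \<omega> in M. (\<lambda>n. g (xs n) \<omega>) \<longlonglongrightarrow> g x \<omega>"
    by eventually_elim simp
qed

lemma hat_version_SC:
  assumes f: "f \<in> SC" shows "hat (version f) \<in> SC"
proof (rule SC_cong[OF f])
  fix x :: "'a \<Rightarrow> 'b" assume x [measurable]: "x \<in> L0"
  note [measurable] = version_measurable[OF f]
  show "hat (version f) x \<in> L0" unfolding hat_def by measurable
  show "AE \<omega> in M. hat (version f) x \<omega> = f x \<omega>"
    using version_eq[OF f x] by eventually_elim (simp add: hat_def)
qed

end

context stable_positive_functional
begin

text \<open>Continuity is asked only along random points, so bounded measurable dependence on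
  \<omega> is free; hence the cozero sets generate the whole product \<sigma>-algebra. Boundedness
  makes \<open>I\<close> finite.\<close>

definition H :: "('a \<times> 'b \<Rightarrow> real) set" where
  "H = {F \<in> borel_measurable MB. (\<exists>c. \<forall>z\<in>space MB. \<bar>F z\<bar> \<le> c) \<and> hat F \<in> SC}"

definition Q :: "'a measure" where
  "Q = density M (\<lambda>\<omega>. ennreal (1 / (1 + \<bar>L (\<lambda>_ _. 1) \<omega>\<bar>)))"

definition I :: "('a \<times> 'b \<Rightarrow> real) \<Rightarrow> real" where
  "I F = (\<integral>\<omega>. L (hat F) \<omega> \<partial>Q)"

lemma sets_Q [simp, measurable_cong]: "sets Q = events" and space_Q [simp]: "space Q = space M"
  by (simp_all add: Q_def)

lemma L1_meas [measurable]: "L (\<lambda>_ _. 1) \<in> L0"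
  by (rule L_meas[OF SC_const])

lemma AE_Q: "(AE \<omega> in Q. P \<omega>) \<longleftrightarrow> (AE \<omega> in M. P \<omega>)"
proof -
  have "0 < 1 / (1 + \<bar>L (\<lambda>_ _. 1) \<omega>\<bar>)" for \<omega> by (simp add: add_pos_nonneg)
  then show ?thesis unfolding Q_def by (subst AE_density) simp_all
qed

lemma finite_Q: "finite_measure Q"
proof (rule finite_measureI)
  have "emeasure Q (space Q) = (\<integral>\<^sup>+\<omega>. ennreal (1 / (1 + \<bar>L (\<lambda>_ _. 1) \<omega>\<bar>)) * indicator (space M) \<omega> \<partial>M)"
    unfolding Q_def by (subst emeasure_density) auto
  also have "\<dots> \<le> (\<integral>\<^sup>+\<omega>. 1 \<partial>M)"
    by (intro nn_integral_mono) (auto simp: indicator_def field_simps intro!: ennreal_le_1[THEN iffD2])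
  also have "\<dots> = 1" by (simp add: emeasure_space_1)
  finally show "emeasure Q (space Q) \<noteq> \<infinity>" by (auto simp: top_unique)
qed

lemma H_measurable [measurable_dest]: "F \<in> H \<Longrightarrow> F \<in> borel_measurable MB" and
  hat_H: "F \<in> H \<Longrightarrow> hat F \<in> SC"
  by (auto simp: H_def)

lemma L_bound:
  assumes f: "f \<in> SC" and "\<And>x. x \<in> L0 \<Longrightarrow> AE \<omega> in M. \<bar>f x \<omega>\<bar> \<le> c"
  shows "AE \<omega> in M. \<bar>L f \<omega>\<bar> \<le> c * L (\<lambda>_ _. 1) \<omega>"
proof -
  have sc: "AE \<omega> in M. L (\<lambda>x \<omega>. c' * (\<lambda>_ _. 1) x \<omega>) \<omega> = c' * L (\<lambda>_ _. 1) \<omega>" for c'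
    using L_scale[OF _ SC_const[of 1], of "\<lambda>_. c'"] by simp
  have "AE \<omega> in M. L f \<omega> \<le> L (\<lambda>_ _. c) \<omega>"
    by (rule L_mono[OF f SC_const], rule eventually_mono[OF assms(2)]) auto
  moreover have "AE \<omega> in M. L (\<lambda>_ _. -c) \<omega> \<le> L f \<omega>"
    by (rule L_mono[OF SC_const f], rule eventually_mono[OF assms(2)]) auto
  ultimately show ?thesis using sc[of c] sc[of "-c"] by (simp, eventually_elim) auto
qed

lemma AE_hat:
  assumes "\<And>z. z \<in> space MB \<Longrightarrow> P z" shows "AE \<omega> in M. P (\<omega>, x \<omega>)"
  using AE_space by eventually_elim (rule assms, simp add: space_pair_measure)

lemma integrable_L:
  assumes F: "F \<in> H" shows "integrable Q (L (hat F))"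
proof -
  obtain c where c: "\<And>z. z \<in> space MB \<Longrightarrow> \<bar>F z\<bar> \<le> c" using F by (auto simp: H_def)
  have "AE \<omega> in M. \<bar>L (hat F) \<omega>\<bar> \<le> c * L (\<lambda>_ _. 1) \<omega>"
    by (rule L_bound[OF hat_H[OF F]]) (unfold hat_def, rule AE_hat, rule c)
  moreover have "AE \<omega> in M. 0 \<le> L (\<lambda>_ _. 1) \<omega>" by (rule L_nonneg[OF SC_const]) simp
  ultimately have bd: "AE \<omega> in M. norm ((1 / (1 + \<bar>L (\<lambda>_ _. 1) \<omega>\<bar>)) *\<^sub>R L (hat F) \<omega>) \<le> \<bar>c\<bar>"
  proof eventually_elim
    case (elim \<omega>)
    have "\<bar>L (hat F) \<omega>\<bar> \<le> \<bar>c\<bar> * L (\<lambda>_ _. 1) \<omega>"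
      using elim by (meson abs_ge_self mult_right_mono order_trans)
    also have "\<dots> \<le> \<bar>c\<bar> * (1 + \<bar>L (\<lambda>_ _. 1) \<omega>\<bar>)" by (intro mult_left_mono) auto
    finally have "\<bar>L (hat F) \<omega>\<bar> / (1 + \<bar>L (\<lambda>_ _. 1) \<omega>\<bar>) \<le> \<bar>c\<bar>"
      by (subst pos_divide_le_eq) (simp_all add: add_pos_nonneg)
    then show ?case by (simp add: abs_mult)
  qed
  have [measurable]: "L (hat F) \<in> L0" by (rule L_meas[OF hat_H[OF F]])
  show ?thesis unfolding Q_def
    by (subst integrable_density) (auto intro!: integrable_const_bound[OF bd] simp del: real_scaleR_def)
qed

text \<open>Convergence along random points is less than the convergence on all of the product in
  the condition of Daniell; the null sets of the joint measure are found with this stronger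
  form.\<close>

lemma I_tendsto_0:
  assumes F: "\<And>n::nat. F n \<in> H" and nonneg: "\<And>n x. x \<in> L0 \<Longrightarrow> AE \<omega> in M. 0 \<le> F n (\<omega>, x \<omega>)"
    and mono: "\<And>n x. x \<in> L0 \<Longrightarrow> AE \<omega> in M. F (Suc n) (\<omega>, x \<omega>) \<le> F n (\<omega>, x \<omega>)"
    and lim: "\<And>x. x \<in> L0 \<Longrightarrow> AE \<omega> in M. (\<lambda>n. F n (\<omega>, x \<omega>)) \<longlonglongrightarrow> 0"
  shows "(\<lambda>n. I (F n)) \<longlonglongrightarrow> 0"
proof -
  have L0: "AE \<omega> in M. \<forall>n. 0 \<le> L (hat (F n)) \<omega>"
    unfolding AE_all_countable by (intro allI L_nonneg hat_H F) (simp add: hat_def nonneg)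
  have dec: "AE \<omega> in M. \<forall>n. L (hat (F (Suc n))) \<omega> \<le> L (hat (F n)) \<omega>"
    unfolding AE_all_countable by (intro allI L_mono hat_H F) (simp add: hat_def mono)
  have tend: "AE \<omega> in M. (\<lambda>n. L (hat (F n)) \<omega>) \<longlonglongrightarrow> 0"
    by (rule L_sigma_continuous) (auto simp: hat_H F, auto simp: hat_def nonneg mono lim)
  have [measurable]: "L (hat (F n)) \<in> L0" for n by (rule L_meas[OF hat_H[OF F]])
  have "(\<lambda>n. \<integral>\<omega>. L (hat (F n)) \<omega> \<partial>Q) \<longlonglongrightarrow> (\<integral>\<omega>. 0 \<partial>Q)"
  proof (rule integral_dominated_convergence[where w="L (hat (F 0))"])
    show "AE \<omega> in Q. norm (L (hat (F n)) \<omega>) \<le> L (hat (F 0)) \<omega>" for n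
      unfolding AE_Q using L0 dec
    proof eventually_elim
      case (elim \<omega>)
      then show ?case using lift_Suc_antimono_le[of "\<lambda>n. L (hat (F n)) \<omega>" 0 n] by simp
    qed
  qed (auto simp: AE_Q tend integrable_L F)
  then show ?thesis by (simp add: I_def)
qed

lemma H_map2:
  assumes F: "F \<in> H" and G: "G \<in> H"
    and h: "(\<lambda>(a, b). h a b) \<in> borel_measurable (borel \<Otimes>\<^sub>M borel)"
    and bd: "\<And>a b A B. \<bar>a\<bar> \<le> A \<Longrightarrow> \<bar>b\<bar> \<le> B \<Longrightarrow> \<bar>h a b\<bar> \<le> A + B"
    and cont: "\<And>us u vs v. us \<longlonglongrightarrow> u \<Longrightarrow> vs \<longlonglongrightarrow> v \<Longrightarrow> (\<lambda>n. h (us n) (vs n)) \<longlonglongrightarrow> h u v"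
  shows "(\<lambda>z. h (F z) (G z)) \<in> H"
  unfolding H_def
proof (intro CollectI conjI)
  note [measurable] = H_measurable[OF F] H_measurable[OF G] h
  have "(\<lambda>z. (\<lambda>(a, b). h a b) (F z, G z)) \<in> borel_measurable MB" by measurable
  then show "(\<lambda>z. h (F z) (G z)) \<in> borel_measurable MB" by simp
  obtain A B where "\<And>z. z \<in> space MB \<Longrightarrow> \<bar>F z\<bar> \<le> A" "\<And>z. z \<in> space MB \<Longrightarrow> \<bar>G z\<bar> \<le> B"
    using F G by (auto simp: H_def)
  then have "\<forall>z\<in>space MB. \<bar>h (F z) (G z)\<bar> \<le> A + B" using bd by blast
  then show "\<exists>c. \<forall>z\<in>space MB. \<bar>h (F z) (G z)\<bar> \<le> c" by blast
  have "(\<lambda>x \<omega>. h (hat F x \<omega>) (hat G x \<omega>)) \<in> SC"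
  proof (rule SC_map2[OF hat_H[OF F] hat_H[OF G] _ cont])
    fix u v :: "'a \<Rightarrow> real" assume [measurable]: "u \<in> L0" "v \<in> L0"
    have "(\<lambda>\<omega>. (\<lambda>(a, b). h a b) (u \<omega>, v \<omega>)) \<in> L0" by measurable
    then show "(\<lambda>\<omega>. h (u \<omega>) (v \<omega>)) \<in> L0" by simp
  qed
  then show "hat (\<lambda>z. h (F z) (G z)) \<in> SC" by (simp add: hat_def)
qed

lemma H_L0_mult:
  assumes F: "F \<in> H" and r [measurable]: "r \<in> L0" and bd: "\<And>\<omega>. \<omega> \<in> space M \<Longrightarrow> \<bar>r \<omega>\<bar> \<le> c"
  shows "(\<lambda>z. r (fst z) * F z) \<in> H"
  unfolding H_def
proof (intro CollectI conjI)
  note [measurable] = H_measurable[OF F]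
  show "(\<lambda>z. r (fst z) * F z) \<in> borel_measurable MB" by measurable
  obtain A where "\<And>z. z \<in> space MB \<Longrightarrow> \<bar>F z\<bar> \<le> A" using F by (auto simp: H_def)
  moreover have "\<bar>r (fst z)\<bar> \<le> c" if "z \<in> space MB" for z :: "'a \<times> 'b"
    using that bd by (auto simp: space_pair_measure)
  ultimately have "\<forall>z\<in>space MB. \<bar>r (fst z) * F z\<bar> \<le> c * A"
    unfolding abs_mult by (meson abs_ge_zero mult_mono order.trans)
  then show "\<exists>c. \<forall>z\<in>space MB. \<bar>r (fst z) * F z\<bar> \<le> c" by blast
  show "hat (\<lambda>z. r (fst z) * F z) \<in> SC" using SC_scale[OF r hat_H[OF F]] by (simp add: hat_def)
qed

lemma H_const: "(\<lambda>_. c) \<in> H"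
  using SC_const by (auto simp: H_def hat_def)

text \<open>The witness is the sum of the positive parts, truncated at \<open>1\<close> and weighted
  by \<open>(1/2)^Suc n\<close>: it is positive where some term is, and the weights keep it bounded
  and continuous along random points.\<close>

lemma H_UN:
  assumes F: "\<And>n::nat. F n \<in> H"
  shows "\<exists>g\<in>H. \<forall>z\<in>space MB. 0 < g z \<longleftrightarrow> (\<exists>n. 0 < F n z)"
proof -
  define h where "h n z = min 1 (max 0 (F n z))" for n z
  define g where "g z = (\<Sum>n. (1/2)^Suc n * h n z)" for z
  note [measurable] = H_measurable[OF F]
  have h: "0 \<le> h n z" "h n z \<le> 1" for n z by (auto simp: h_def)
  have s: "summable (\<lambda>n. (1/2)^Suc n :: real)" using power_half_series sums_summable by blast
  have sh: "summable (\<lambda>n. (1/2)^Suc n * h n z)" for z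
    by (rule summable_comparison_test'[OF s]) (use h in \<open>simp add: abs_mult mult_left_le\<close>)
  have gm: "g \<in> borel_measurable MB" unfolding g_def[abs_def] h_def by measurable
  have "0 \<le> g z" "g z \<le> 1" for z
  proof -
    show "0 \<le> g z" unfolding g_def by (intro suminf_nonneg sh) (simp add: h)
    have "g z \<le> (\<Sum>n. (1/2)^Suc n)" unfolding g_def by (intro suminf_le sh s) (simp add: h mult_left_le)
    then show "g z \<le> 1" using power_half_series by (simp add: sums_iff)
  qed
  then have "\<forall>z\<in>space MB. \<bar>g z\<bar> \<le> 1" by simp
  moreover have "hat g \<in> SC"
  proof (rule hat_SC[OF gm])
    fix xs :: "nat \<Rightarrow> 'a \<Rightarrow> 'b" and x
    assume *: "\<And>n. xs n \<in> L0" "x \<in> L0" "AE \<omega> in M. (\<lambda>n. xs n \<omega>) \<longlonglongrightarrow> x \<omega>"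
    have "AE \<omega> in M. \<forall>n. (\<lambda>k. F n (\<omega>, xs k \<omega>)) \<longlonglongrightarrow> F n (\<omega>, x \<omega>)"
      unfolding AE_all_countable using SC_tendsto[OF hat_H[OF F] *] by (simp add: hat_def)
    then show "AE \<omega> in M. (\<lambda>k. g (\<omega>, xs k \<omega>)) \<longlonglongrightarrow> g (\<omega>, x \<omega>)"
    proof eventually_elim
      case (elim \<omega>)
      show ?case unfolding g_def
      proof (rule tendsto_half_series)
        show "\<bar>h n (\<omega>, xs k \<omega>)\<bar> \<le> 1" for n k using h by simp
        show "(\<lambda>k. h n (\<omega>, xs k \<omega>)) \<longlonglongrightarrow> h n (\<omega>, x \<omega>)" for n
          unfolding h_def by (intro tendsto_intros elim[rule_format])
      qed
    qed
  qed
  ultimately have "g \<in> H" unfolding H_def using gm by blast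
  moreover have "0 < g z \<longleftrightarrow> (\<exists>n. 0 < F n z)" for z
    unfolding g_def by (subst suminf_pos_iff[OF sh]) (auto simp: h zero_less_mult_iff h_def less_max_iff_disj)
  ultimately show ?thesis by blast
qed

sublocale daniell_functional "space MB" H I
proof
  fix f g :: "'a \<times> 'b \<Rightarrow> real" and c :: real
  show "(\<lambda>_. c) \<in> H" by (rule H_const)
  {
    assume f: "f \<in> H"
    show cf: "(\<lambda>x. c * f x) \<in> H" using H_L0_mult[OF f, of "\<lambda>_. c" c] H_L0_mult[OF f, of "\<lambda>_. c" "\<bar>c\<bar>"] by simp
    have "AE \<omega> in M. L (hat (\<lambda>x. c * f x)) \<omega> = c * L (hat f) \<omega>"
      using L_scale[OF _ hat_H[OF f], of "\<lambda>_. c"] by (simp add: hat_def)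
    then have "AE \<omega> in Q. L (hat (\<lambda>x. c * f x)) \<omega> = c * L (hat f) \<omega>" unfolding AE_Q .
    then show "I (\<lambda>x. c * f x) = c * I f"
      unfolding I_def integral_mult_right_zero[symmetric]
      using L_meas[OF hat_H[OF f]] L_meas[OF hat_H[OF cf]] by (intro integral_cong_AE) auto
    show "0 \<le> I f" if "\<And>x. x \<in> space MB \<Longrightarrow> 0 \<le> f x"
      unfolding I_def
    proof (rule integral_nonneg_AE)
      show "AE \<omega> in Q. 0 \<le> L (hat f) \<omega>" unfolding AE_Q
        by (rule L_nonneg[OF hat_H[OF f]]) (unfold hat_def, rule AE_hat, rule that)
    qed
    assume g: "g \<in> H"
    show fg: "(\<lambda>x. f x + g x) \<in> H" by (rule H_map2[OF f g]) (auto intro!: tendsto_intros)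
    show "(\<lambda>x. max (f x) (g x)) \<in> H" by (rule H_map2[OF f g]) (auto intro!: tendsto_intros)
    have "AE \<omega> in M. L (hat (\<lambda>x. f x + g x)) \<omega> = L (hat f) \<omega> + L (hat g) \<omega>"
      using L_add[OF hat_H[OF f] hat_H[OF g]] by (simp add: hat_def)
    then have "AE \<omega> in Q. L (hat (\<lambda>x. f x + g x)) \<omega> = L (hat f) \<omega> + L (hat g) \<omega>" unfolding AE_Q .
    then show "I (\<lambda>x. f x + g x) = I f + I g"
      unfolding I_def Bochner_Integration.integral_add[OF integrable_L[OF f] integrable_L[OF g], symmetric]
      using L_meas[OF hat_H[OF f]] L_meas[OF hat_H[OF g]] L_meas[OF hat_H[OF fg]]
      by (intro integral_cong_AE) auto
  }
  fix F :: "nat \<Rightarrow> 'a \<times> 'b \<Rightarrow> real" assume F: "\<And>n. F n \<in> H"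
  show "\<exists>g\<in>H. \<forall>x\<in>space MB. (0 < g x) = (\<exists>n. 0 < F n x)" by (rule H_UN[OF F])
  assume dec: "\<And>n x. x \<in> space MB \<Longrightarrow> F (Suc n) x \<le> F n x" and lim: "\<And>x. x \<in> space MB \<Longrightarrow> (\<lambda>n. F n x) \<longlonglongrightarrow> 0"
  show "(\<lambda>n. I (F n)) \<longlonglongrightarrow> 0"
  proof (rule I_tendsto_0[OF F])
    \<comment> \<open>Nonnegativity follows from the decrease to \<open>0\<close>.\<close>
    have "0 \<le> F n z" if "z \<in> space MB" for n z
      using decseq_ge[OF decseq_SucI lim[OF that]] dec[OF that] by blast
    then show "AE \<omega> in M. 0 \<le> F n (\<omega>, x \<omega>)" for n x by (rule AE_hat)
    show "AE \<omega> in M. F (Suc n) (\<omega>, x \<omega>) \<le> F n (\<omega>, x \<omega>)" for n x using dec by (rule AE_hat)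
    show "AE \<omega> in M. (\<lambda>n. F n (\<omega>, x \<omega>)) \<longlonglongrightarrow> 0" for x using lim by (rule AE_hat)
  qed
qed

section \<open>The joint measure and its conditional integrals\<close>

definition joint :: "('a \<times> 'b) measure" where
  "joint = (SOME m. space m = space MB \<and> sets m = sigma_sets (space MB) (coz ` H) \<and> finite_measure m \<and>
     (\<forall>f\<in>H. (\<forall>x\<in>space MB. 0 \<le> f x \<and> f x \<le> 1) \<longrightarrow> (\<integral>\<^sup>+x. ennreal (f x) \<partial>m) = ennreal (I f)) \<and>
     (\<forall>E\<in>sets m. \<forall>e>0. \<exists>f\<in>H. E \<subseteq> coz f \<and> emeasure m (coz f) \<le> emeasure m E + ennreal e))"

lemma space_joint [simp]: "space joint = space MB"
  and sets_joint_sigma: "sets joint = sigma_sets (space MB) (coz ` H)"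
  and finite_joint: "finite_measure joint"
  and nn_integral_joint: "f \<in> H \<Longrightarrow> (\<And>z. z \<in> space MB \<Longrightarrow> 0 \<le> f z \<and> f z \<le> 1) \<Longrightarrow> (\<integral>\<^sup>+z. ennreal (f z) \<partial>joint) = ennreal (I f)"
  and regular_joint: "E \<in> sets joint \<Longrightarrow> 0 < e \<Longrightarrow> \<exists>f\<in>H. E \<subseteq> coz f \<and> emeasure joint (coz f) \<le> emeasure joint E + ennreal e"
  using someI_ex[OF daniell, folded joint_def] by blast+

text \<open>Both coordinates are measurable for the \<sigma>-algebra of the cozero sets:
  \<open>H\<close> contains the indicators of events as functions of \<omega>, and the truncated
  distance to a closed set as a function of the point.\<close>

lemma sets_joint [simp, measurable_cong]: "sets joint = sets MB"
proof (rule antisym)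
  have "coz F \<in> sets MB" if "F \<in> H" for F
    using H_measurable[OF that] unfolding coz_def by measurable
  then show "sets joint \<subseteq> sets MB"
    unfolding sets_joint_sigma by (intro sets.sigma_sets_subset) auto
  have coz: "coz F \<in> sets joint" if "F \<in> H" for F unfolding sets_joint_sigma using that by blast
  have f: "fst \<in> measurable joint M"
  proof (rule measurableI)
    fix A assume A [measurable]: "A \<in> events"
    have "(\<lambda>z. indicator A (fst z) * 1) \<in> H" by (rule H_L0_mult[OF H_const, of _ 1]) (auto simp: indicator_def)
    then have "coz (\<lambda>z. indicator A (fst z) * 1) \<in> sets joint" by (rule coz)
    moreover have "coz (\<lambda>z. indicator A (fst z) * 1) = fst -` A \<inter> space joint"
      by (auto simp: coz_def indicator_def)
    ultimately show "fst -` A \<inter> space joint \<in> sets joint" by simp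
  qed (auto simp: space_pair_measure)
  have s: "snd \<in> measurable joint borel"
  proof (rule borel_measurableI)
    fix U :: "'b set" assume U: "open U"
    show "snd -` U \<inter> space joint \<in> sets joint"
    proof (cases "U = UNIV")
      \<comment> \<open>\<open>infdist\<close> to the empty set is \<open>0\<close>, so the distance
        function below would miss this case.\<close>
      case True then show ?thesis by (simp add: space_joint[symmetric] del: space_joint)
    next
      case False
      define F where "F z = min 1 (infdist (snd z) (- U))" for z :: "'a \<times> 'b"
      have [measurable]: "(\<lambda>y. infdist y (- U)) \<in> borel_measurable borel"
        by (intro borel_measurable_continuous_onI continuous_on_infdist continuous_on_id)
      have Fm: "F \<in> borel_measurable MB" unfolding F_def[abs_def] by measurable
      have "hat F \<in> SC"
      proof (rule hat_SC[OF Fm])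
        fix xs :: "nat \<Rightarrow> 'a \<Rightarrow> 'b" and x assume "AE \<omega> in M. (\<lambda>n. xs n \<omega>) \<longlonglongrightarrow> x \<omega>"
        then show "AE \<omega> in M. (\<lambda>n. F (\<omega>, xs n \<omega>)) \<longlonglongrightarrow> F (\<omega>, x \<omega>)"
          unfolding F_def by eventually_elim (auto intro!: tendsto_intros)
      qed
      moreover have "\<bar>F z\<bar> \<le> 1" for z by (simp add: F_def infdist_nonneg abs_le_iff)
      ultimately have "F \<in> H" unfolding H_def using Fm by blast
      then have "coz F \<in> sets joint" by (rule coz)
      moreover have "0 < infdist y (- U) \<longleftrightarrow> y \<in> U" for y
      proof -
        have "y \<notin> - U \<Longrightarrow> 0 < infdist y (- U)"
          using False U by (intro infdist_pos_not_in_closed) auto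
        moreover have "y \<in> - U \<Longrightarrow> infdist y (- U) = 0" by simp
        ultimately show ?thesis by (cases "y \<in> U") auto
      qed
      then have "coz F = snd -` U \<inter> space joint" by (auto simp: coz_def F_def)
      ultimately show ?thesis by simp
    qed
  qed
  show "sets MB \<subseteq> sets joint"
  proof
    fix G :: "('a \<times> 'b) set" assume G: "G \<in> sets MB"
    have "(\<lambda>z. (fst z, snd z)) \<in> measurable joint MB" using f s by (rule measurable_Pair)
    from measurable_sets[OF this G] show "G \<in> sets joint"
      using sets.sets_into_space[OF G] by (simp add: Int_absorb2)
  qed
qed

text \<open>By linearity over the random variables, \<open>L\<close> of the indicator of an event is
  that indicator times \<open>L (\<lambda>_ _. 1)\<close>, which vanishes almost surely if the event
  is null.\<close>

sublocale cond_integral Q joint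
proof (intro cond_integral.intro finite_Q cond_integral_axioms.intro)
  show "fst \<in> measurable joint Q" by measurable
  fix A assume A: "A \<in> null_sets Q"
  then have [measurable]: "A \<in> events" by auto
  define F where "F z = (indicator A (fst z) * 1 :: real)" for z :: "'a \<times> 'b"
  have F: "F \<in> H" unfolding F_def[abs_def] by (rule H_L0_mult[OF H_const, of _ 1]) (auto simp: indicator_def)
  have "emeasure joint (fst -` A \<inter> space joint) = (\<integral>\<^sup>+z. indicator (fst -` A \<inter> space joint) z \<partial>joint)"
    by (rule nn_integral_indicator[symmetric]) simp
  also have "\<dots> = (\<integral>\<^sup>+z. ennreal (F z) \<partial>joint)"
    by (rule nn_integral_cong) (auto simp: F_def indicator_def)
  also have "\<dots> = ennreal (I F)" by (rule nn_integral_joint[OF F]) (auto simp: F_def indicator_def)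
  also have "I F = 0"
  proof -
    have "AE \<omega> in M. L (\<lambda>x \<omega>. indicator A \<omega> * 1) \<omega> = indicator A \<omega> * L (\<lambda>_ _. 1) \<omega>"
      by (rule L_scale[OF _ SC_const]) measurable
    moreover have "AE \<omega> in M. \<omega> \<notin> A" using AE_not_in[OF A] unfolding AE_Q .
    ultimately have "AE \<omega> in M. L (hat F) \<omega> = 0" by eventually_elim (simp add: hat_def F_def)
    then have "AE \<omega> in Q. L (hat F) \<omega> = 0" unfolding AE_Q .
    then show ?thesis unfolding I_def by (rule integral_eq_zero_AE)
  qed
  finally show "fst -` A \<inter> space joint \<in> null_sets joint" by (auto simp: null_sets_def)
qed

text \<open>Testing on an event amounts to multiplying \<open>F\<close> by its indicator; the
  product stays in \<open>H\<close>, and the indicator comes out of \<open>L\<close>.\<close>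

lemma cint_H:
  assumes F: "F \<in> H" and bd: "\<And>z. z \<in> space MB \<Longrightarrow> 0 \<le> F z \<and> F z \<le> 1"
  shows "AE \<omega> in Q. cint Q joint (\<lambda>z. ennreal (F z)) \<omega> = ennreal (L (hat F) \<omega>)"
proof (rule cint_eqI)
  note [measurable] = H_measurable[OF F] L_meas[OF hat_H[OF F]]
  show "(\<lambda>z. ennreal (F z)) \<in> borel_measurable joint" by measurable
  show "(\<lambda>\<omega>. ennreal (L (hat F) \<omega>)) \<in> borel_measurable Q" by measurable
  fix A assume "A \<in> sets Q"
  then have A [measurable]: "A \<in> events" by simp
  define FA where "FA z = indicator A (fst z) * F z" for z
  have FA: "FA \<in> H" unfolding FA_def[abs_def] by (rule H_L0_mult[OF F, of _ 1]) (auto simp: indicator_def)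
  have LA: "AE \<omega> in M. L (hat FA) \<omega> = indicator A \<omega> * L (hat F) \<omega>"
    using L_scale[OF borel_measurable_indicator[OF A] hat_H[OF F]] by (simp add: hat_def FA_def)
  have nn: "AE \<omega> in M. 0 \<le> L (hat FA) \<omega>"
    by (rule L_nonneg[OF hat_H[OF FA]]) (unfold hat_def, rule AE_hat, simp add: FA_def bd)
  have "(\<integral>\<^sup>+z. ennreal (F z) * indicator A (fst z) \<partial>joint) = (\<integral>\<^sup>+z. ennreal (FA z) \<partial>joint)"
    by (rule nn_integral_cong) (auto simp: FA_def indicator_def)
  also have "\<dots> = ennreal (I FA)"
    by (rule nn_integral_joint[OF FA]) (use bd in \<open>auto simp: FA_def indicator_def\<close>)
  also have "\<dots> = (\<integral>\<^sup>+\<omega>. ennreal (L (hat FA) \<omega>) \<partial>Q)"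
    unfolding I_def by (rule nn_integral_eq_integral[symmetric, OF integrable_L[OF FA]]) (simp add: AE_Q nn)
  also have "\<dots> = (\<integral>\<^sup>+\<omega>. ennreal (L (hat F) \<omega>) * indicator A \<omega> \<partial>Q)"
  proof (rule nn_integral_cong_AE)
    show "AE \<omega> in Q. ennreal (L (hat FA) \<omega>) = ennreal (L (hat F) \<omega>) * indicator A \<omega>"
      unfolding AE_Q using LA by eventually_elim (auto simp: indicator_def)
  qed
  finally show "(\<integral>\<^sup>+\<omega>. ennreal (L (hat F) \<omega>) * indicator A \<omega> \<partial>Q) = (\<integral>\<^sup>+z. ennreal (F z) * indicator A (fst z) \<partial>joint)" ..
qed

text \<open>The complement of a cozero set is the zero set of some \<open>f \<in> H\<close>, on which \<open>(1 - n f\<^sup>+)\<^sup>+ = 1\<close>; if no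
  \<open>x \<in> L\<^sup>0\<close> has its graph in it on a set of positive probability, these functions decrease to \<open>0\<close> along
  every \<open>x\<close>. So no measurable selection theorem is needed.\<close>

lemma negligible:
  assumes N: "N \<in> sets MB" and no: "\<And>x. x \<in> L0 \<Longrightarrow> AE \<omega> in M. (\<omega>, x \<omega>) \<notin> N"
  shows "N \<in> null_sets joint"
proof -
  interpret joint: finite_measure joint by (rule finite_joint)
  have "emeasure joint N \<le> 0 + ennreal e" if e: "0 < e" for e
  proof -
    \<comment> \<open>An outer approximation of the complement of \<open>N\<close> leaves a zero set
      inside \<open>N\<close> that misses at most \<open>e\<close> of its mass.\<close>
    have SN: "space joint - N \<in> sets joint" using N by auto
    obtain f where f: "f \<in> H" "space joint - N \<subseteq> coz f" "emeasure joint (coz f) \<le> emeasure joint (space joint - N) + ennreal e"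
      using regular_joint[OF SN e] by blast
    have cf [measurable]: "coz f \<in> sets joint" using f(1) sets_joint_sigma by blast
    define \<phi> where "\<phi> n z = max 0 (1 + (- real n) * max 0 (f z))" for n z
    have \<phi>H: "\<phi> n \<in> H" for n unfolding \<phi>_def[abs_def] by (intro H_max H_const H_add H_scale f)
    have \<phi>01: "0 \<le> \<phi> n z" "\<phi> n z \<le> 1" for n z by (auto simp: \<phi>_def)
    have "(\<lambda>n. I (\<phi> n)) \<longlonglongrightarrow> 0"
    proof (rule I_tendsto_0[OF \<phi>H])
      show "AE \<omega> in M. 0 \<le> \<phi> n (\<omega>, x \<omega>)" for n x by (simp add: \<phi>01)
      show "AE \<omega> in M. \<phi> (Suc n) (\<omega>, x \<omega>) \<le> \<phi> n (\<omega>, x \<omega>)" for n x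
        unfolding \<phi>_def by (intro AE_I2 max.mono order.refl add_left_mono mult_right_mono) auto
      fix x :: "'a \<Rightarrow> 'b" assume x: "x \<in> L0"
      show "AE \<omega> in M. (\<lambda>n. \<phi> n (\<omega>, x \<omega>)) \<longlonglongrightarrow> 0"
        using no[OF x] AE_space
      proof eventually_elim
        case (elim \<omega>)
        then have "(\<omega>, x \<omega>) \<in> space joint - N" by (simp add: space_pair_measure)
        then have pos: "0 < f (\<omega>, x \<omega>)" using f(2) by (auto simp: coz_def)
        have "eventually (\<lambda>n. \<phi> n (\<omega>, x \<omega>) = 0) sequentially"
        proof (rule eventually_sequentiallyI)
          fix n assume "nat \<lceil>1 / f (\<omega>, x \<omega>)\<rceil> \<le> n"
          then have "1 / f (\<omega>, x \<omega>) \<le> real n" by linarith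
          then have "1 \<le> real n * f (\<omega>, x \<omega>)" using pos by (simp add: field_simps)
          then show "\<phi> n (\<omega>, x \<omega>) = 0" using pos by (simp add: \<phi>_def)
        qed
        then show ?case by (rule tendsto_eventually)
      qed
    qed
    then have "(\<lambda>n. ennreal (I (\<phi> n))) \<longlonglongrightarrow> ennreal 0" by (intro tendsto_ennrealI)
    moreover have "emeasure joint (space joint - coz f) \<le> ennreal (I (\<phi> n))" for n
    proof -
      have "emeasure joint (space joint - coz f) = (\<integral>\<^sup>+z. indicator (space joint - coz f) z \<partial>joint)"
        by (rule nn_integral_indicator[symmetric]) measurable
      also have "\<dots> \<le> (\<integral>\<^sup>+z. ennreal (\<phi> n z) \<partial>joint)"
        by (rule nn_integral_mono) (auto simp: \<phi>_def coz_def indicator_def not_less max_def)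
      also have "\<dots> = ennreal (I (\<phi> n))" by (rule nn_integral_joint[OF \<phi>H]) (simp add: \<phi>01)
      finally show ?thesis .
    qed
    ultimately have "emeasure joint (space joint - coz f) \<le> 0"
      by (intro LIMSEQ_le_const[of "\<lambda>n. ennreal (I (\<phi> n))"]) auto
    then have K0: "measure joint (space joint - coz f) = 0" by (simp add: measure_def)
    have "measure joint (coz f) \<le> measure joint (space joint - N) + e"
      using f(3) e by (simp add: joint.emeasure_eq_measure ennreal_plus[symmetric] del: ennreal_plus)
    moreover have "measure joint (space joint - N) = measure joint (space joint) - measure joint N"
      using N by (intro joint.finite_measure_compl) simp
    moreover have "measure joint (space joint - coz f) = measure joint (space joint) - measure joint (coz f)"
      by (intro joint.finite_measure_compl) measurable
    ultimately have "measure joint N \<le> e" using K0 by linarith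
    then show ?thesis by (simp add: joint.emeasure_eq_measure ennreal_leI)
  qed
  then have "emeasure joint N \<le> 0" by (rule ennreal_le_epsilon)
  then show ?thesis using N by (auto simp: null_sets_def)
qed

text \<open>The transfer principle: properties known almost surely along every random point become
  properties \<open>joint\<close>-almost everywhere, so that ordinary integration theory on the
  product applies.\<close>

lemma AE_joint:
  assumes P [measurable]: "Measurable.pred MB P" and "\<And>x. x \<in> L0 \<Longrightarrow> AE \<omega> in M. P (\<omega>, x \<omega>)"
  shows "AE z in joint. P z"
proof -
  have "{z \<in> space MB. \<not> P z} \<in> null_sets joint"
    by (rule negligible, measurable) (rule eventually_mono[OF assms(2)], auto)
  then show ?thesis by (intro AE_I'[of "{z \<in> space MB. \<not> P z}"]) auto
qed

text \<open>Truncation at \<open>n + 1\<close> gives multiples of elements of \<open>H\<close>, for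
  which \<open>cint_H\<close> applies. The conditional integrals converge monotonically;
  \<open>L\<close> of the truncations converges because the remainders \<open>f - g n\<close>
  decrease to \<open>0\<close> along random points.\<close>

lemma cint_version:
  assumes f: "f \<in> SC" and nonneg: "\<And>x. x \<in> L0 \<Longrightarrow> AE \<omega> in M. 0 \<le> f x \<omega>"
  shows "AE \<omega> in M. cint Q joint (\<lambda>z. ennreal (version f z)) \<omega> = ennreal (L f \<omega>)"
proof -
  note vm [measurable] = version_measurable[OF f]
  \<comment> \<open>Nonnegativity of \<open>f\<close> passes to \<open>version f\<close> only along
    random points, hence the positive part.\<close>
  define F where "F n z = min 1 (1 / real (Suc n) * max 0 (version f z))" for n z
  define g where "g n x \<omega> = min (real (Suc n)) (max 0 (hat (version f) x \<omega>))" for n x \<omega>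
  have hv: "hat (version f) \<in> SC" by (rule hat_version_SC[OF f])
  have gCC: "g n \<in> SC" for n unfolding g_def[abs_def] by (intro SC_min SC_max SC_const hv)
  have gF: "g n = (\<lambda>x \<omega>. real (Suc n) * hat (F n) x \<omega>)" for n
    by (simp add: fun_eq_iff g_def F_def hat_def min_mult_distrib_left del: of_nat_Suc)
  have F: "F n \<in> H" for n
    unfolding H_def
  proof (intro CollectI conjI)
    show "F n \<in> borel_measurable MB" unfolding F_def[abs_def] by measurable
    show "\<exists>c. \<forall>z\<in>space MB. \<bar>F n z\<bar> \<le> c" by (intro exI[of _ 1]) (auto simp: F_def)
    have "(\<lambda>x \<omega>. min 1 (1 / real (Suc n) * max 0 (hat (version f) x \<omega>))) \<in> SC"
      by (intro SC_min SC_mult SC_max SC_const hv)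
    then show "hat (F n) \<in> SC" by (simp add: F_def hat_def)
  qed
  note [measurable] = H_measurable[OF F]
  have "AE \<omega> in Q. \<forall>n. cint Q joint (\<lambda>z. ennreal (real (Suc n)) * ennreal (F n z)) \<omega> = ennreal (real (Suc n)) * cint Q joint (\<lambda>z. ennreal (F n z)) \<omega>"
    unfolding AE_all_countable by (intro allI cint_mult[of _ "\<lambda>_. ennreal (real (Suc n))" for n]) measurable
  moreover have "AE \<omega> in Q. \<forall>n. cint Q joint (\<lambda>z. ennreal (F n z)) \<omega> = ennreal (L (hat (F n)) \<omega>)"
    unfolding AE_all_countable by (intro allI cint_H F) (auto simp: F_def)
  moreover have "AE \<omega> in Q. \<forall>n. L (g n) \<omega> = real (Suc n) * L (hat (F n)) \<omega>"
    unfolding AE_all_countable AE_Q gF by (intro allI L_scale[of "\<lambda>_. real (Suc n)" for n] hat_H F) measurable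
  ultimately have 1: "AE \<omega> in Q. \<forall>n. cint Q joint (\<lambda>z. ennreal (real (Suc n)) * ennreal (F n z)) \<omega> = ennreal (L (g n) \<omega>)"
    by eventually_elim (simp add: ennreal_mult'[symmetric] del: of_nat_Suc)
  have FS: "ennreal (real (Suc n)) * ennreal (F n z) = ennreal (min (real (Suc n)) (max 0 (version f z)))" for n z
    by (subst ennreal_mult[symmetric]) (simp_all add: F_def min_mult_distrib_left del: of_nat_Suc)
  have SUP: "(SUP n. ennreal (real (Suc n)) * ennreal (F n z)) = ennreal (version f z)" for z
  proof (rule antisym)
    show "(SUP n. ennreal (real (Suc n)) * ennreal (F n z)) \<le> ennreal (version f z)"
      unfolding FS by (intro SUP_least, rule order.trans[OF ennreal_leI[OF min.cobounded2]])
        (simp add: max_def ennreal_neg)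
    obtain n where "max 0 (version f z) < real n" using reals_Archimedean2 by blast
    then have "ennreal (version f z) \<le> ennreal (min (real (Suc n)) (max 0 (version f z)))"
      by (intro ennreal_leI) auto
    also have "\<dots> \<le> (SUP n. ennreal (real (Suc n)) * ennreal (F n z))"
      unfolding FS by (rule SUP_upper) simp
    finally show "ennreal (version f z) \<le> (SUP n. ennreal (real (Suc n)) * ennreal (F n z))" .
  qed
  have "AE \<omega> in Q. cint Q joint (\<lambda>z. SUP n. ennreal (real (Suc n)) * ennreal (F n z)) \<omega> =
      (SUP n. cint Q joint (\<lambda>z. ennreal (real (Suc n)) * ennreal (F n z)) \<omega>)"
  proof (rule cint_SUP)
    show "AE z in joint. \<forall>n. ennreal (real (Suc n)) * ennreal (F n z) \<le> ennreal (real (Suc (Suc n))) * ennreal (F (Suc n) z)"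
      unfolding FS by (intro AE_I2 allI ennreal_leI min.mono order.refl) simp
  qed measurable
  then have 2: "AE \<omega> in Q. cint Q joint (\<lambda>z. ennreal (version f z)) \<omega> =
      (SUP n. cint Q joint (\<lambda>z. ennreal (real (Suc n)) * ennreal (F n z)) \<omega>)"
    unfolding SUP .
  have dCC: "(\<lambda>x \<omega>. f x \<omega> - g n x \<omega>) \<in> SC" for n by (rule SC_diff[OF f gCC])
  have gf: "AE \<omega> in M. \<forall>n. g n x \<omega> = min (real (Suc n)) (f x \<omega>)" if "x \<in> L0" for x
    using version_eq[OF f that] nonneg[OF that] by eventually_elim (simp add: g_def hat_def)
  have "AE \<omega> in M. (\<lambda>n. L (\<lambda>x \<omega>. f x \<omega> - g n x \<omega>) \<omega>) \<longlonglongrightarrow> 0"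
  proof (rule L_sigma_continuous[OF dCC])
    fix x :: "'a \<Rightarrow> 'b" assume x: "x \<in> L0"
    show "AE \<omega> in M. 0 \<le> f x \<omega> - g n x \<omega>" for n using gf[OF x] by eventually_elim simp
    show "AE \<omega> in M. f x \<omega> - g (Suc n) x \<omega> \<le> f x \<omega> - g n x \<omega>" for n using gf[OF x] by eventually_elim auto
    show "AE \<omega> in M. (\<lambda>n. f x \<omega> - g n x \<omega>) \<longlonglongrightarrow> 0" using gf[OF x]
    proof eventually_elim
      case (elim \<omega>)
      obtain k where "f x \<omega> < real k" using reals_Archimedean2 by blast
      then have "eventually (\<lambda>n. f x \<omega> - g n x \<omega> = 0) sequentially"
        by (intro eventually_sequentiallyI[of k]) (use elim in auto)
      then show ?case by (rule tendsto_eventually)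
    qed
  qed
  moreover have "AE \<omega> in M. \<forall>n. L (\<lambda>x \<omega>. f x \<omega> - g n x \<omega>) \<omega> = L f \<omega> - L (g n) \<omega>"
    unfolding AE_all_countable by (intro allI L_diff f gCC)
  moreover have "AE \<omega> in M. \<forall>n. L (g n) \<omega> \<le> L (g (Suc n)) \<omega>"
    unfolding AE_all_countable
    by (intro allI L_mono gCC AE_I2) (auto simp: g_def intro!: min.mono)
  ultimately show ?thesis using 1[unfolded AE_Q] 2[unfolded AE_Q]
  proof eventually_elim
    case (elim \<omega>)
    have "(\<lambda>n. L f \<omega> - (L f \<omega> - L (g n) \<omega>)) \<longlonglongrightarrow> L f \<omega> - 0"
      using elim(1) unfolding elim(2)[rule_format] by (intro tendsto_intros)
    then have "(\<lambda>n. ennreal (L (g n) \<omega>)) \<longlonglongrightarrow> ennreal (L f \<omega>)" by (intro tendsto_ennrealI) simp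
    moreover have "(\<lambda>n. ennreal (L (g n) \<omega>)) \<longlonglongrightarrow> (SUP n. ennreal (L (g n) \<omega>))"
      by (intro LIMSEQ_SUP incseq_SucI ennreal_leI) (use elim in blast)
    ultimately have "(SUP n. ennreal (L (g n) \<omega>)) = ennreal (L f \<omega>)" by (rule LIMSEQ_unique[rotated])
    then show ?case using elim(4,5) by simp
  qed
qed

end

section \<open>The representing stable measure\<close>

context stable_positive_functional
begin

text \<open>On stable Borel sets the choice of \<open>G\<close> is immaterial up to null sets: two
  measurable sets with the same conditional set agree along every random point, hence up to a
  \<open>joint\<close>-null set.\<close>

definition \<mu> :: "('a, 'b) cset \<Rightarrow> 'a \<Rightarrow> ennreal" where
  "\<mu> P = cint Q joint (indicator (SOME G. G \<in> sets MB \<and> gset G = P))"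

lemma \<mu>_measurable [measurable]: "\<mu> P \<in> borel_measurable M"
proof -
  have "cint Q joint g \<in> borel_measurable Q" for g by measurable
  then show ?thesis unfolding \<mu>_def by (simp add: measurable_cong_sets[OF sets_Q refl])
qed

lemma cint_indicator_cong:
  assumes [measurable]: "G \<in> sets MB" "G' \<in> sets MB"
    and eq: "\<And>x. x \<in> L0 \<Longrightarrow> AE \<omega> in M. (\<omega>, x \<omega>) \<in> G \<longleftrightarrow> (\<omega>, x \<omega>) \<in> G'"
  shows "AE \<omega> in M. cint Q joint (indicator G) \<omega> = cint Q joint (indicator G') \<omega>"
proof -
  have "AE z in joint. z \<in> G \<longleftrightarrow> z \<in> G'" by (rule AE_joint[OF _ eq]) measurable
  then have "AE z in joint. (indicator G z :: ennreal) = indicator G' z"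
    by eventually_elim (simp add: indicator_def)
  then show ?thesis unfolding AE_Q[symmetric] by (intro cint_cong_AE) measurable
qed

lemma \<mu>_gset:
  assumes G: "G \<in> sets MB"
  shows "AE \<omega> in M. \<mu> (gset G) \<omega> = cint Q joint (indicator G) \<omega>"
proof -
  let ?G = "SOME G'. G' \<in> sets MB \<and> gset G' = gset G"
  have "?G \<in> sets MB \<and> gset ?G = gset G" by (rule someI[of _ G]) (simp add: G)
  then show ?thesis unfolding \<mu>_def using G by (intro cint_indicator_cong gset_eqD) auto
qed

lemma stable_borelE:
  assumes "P \<in> stable_borel M"
  obtains G where "G \<in> sets MB" "P = gset G"
  using assms unfolding stable_borel_eq by blast

text \<open>Obtained by pulling the indicator of \<open>A\<close> out of the conditional integral;
  it yields stability as well as (M1), the latter by comparison with the empty set off the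
  domain.\<close>

lemma cint_localize:
  assumes [measurable]: "A \<in> events" "G \<in> sets MB" "G' \<in> sets MB"
    and eq: "\<And>x. x \<in> L0 \<Longrightarrow> AE \<omega>\<in>A in M. (\<omega>, x \<omega>) \<in> G \<longleftrightarrow> (\<omega>, x \<omega>) \<in> G'"
  shows "AE \<omega>\<in>A in M. cint Q joint (indicator G) \<omega> = cint Q joint (indicator G') \<omega>"
proof -
  have *: "AE \<omega> in M. cint Q joint (\<lambda>z. indicator A (fst z) * indicator G z) \<omega> = indicator A \<omega> * cint Q joint (indicator G) \<omega>"
    if [measurable]: "G \<in> sets MB" for G
    unfolding AE_Q[symmetric] by (rule cint_mult) measurable
  have "AE z in joint. fst z \<in> A \<longrightarrow> z \<in> G \<longleftrightarrow> z \<in> G'" by (rule AE_joint) (measurable, simp add: eq)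
  then have "AE z in joint. indicator A (fst z) * (indicator G z :: ennreal) = indicator A (fst z) * indicator G' z"
    by eventually_elim (auto simp: indicator_def)
  then have "AE \<omega> in M. cint Q joint (\<lambda>z. indicator A (fst z) * indicator G z) \<omega> =
      cint Q joint (\<lambda>z. indicator A (fst z) * indicator G' z) \<omega>"
    unfolding AE_Q[symmetric] by (intro cint_cong_AE) measurable
  with *[OF assms(2)] *[OF assms(3)] show ?thesis by eventually_elim auto
qed

lemma cint_empty: "AE \<omega> in M. cint Q joint (indicator {}) \<omega> = 0"
  unfolding AE_Q[symmetric] by (rule cint_eqI) auto

text \<open>For (M2): the sets behind disjoint conditional sets may overlap, but only in sets that
  almost surely contain no graph and are therefore \<open>joint\<close>-null.\<close>

lemma stable_measure_\<mu>: "stable_measure M L0 (stable_borel M) \<mu>"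
  unfolding stable_measure_def
proof (intro conjI ballI allI impI)
  fix A and P :: "nat \<Rightarrow> ('a, 'b) cset" assume *: "is_partition M A \<and> (\<forall>k. P k \<in> stable_borel M)"
  then have A: "is_partition M A" and "\<forall>k. \<exists>G\<in>sets MB. P k = gset G" unfolding stable_borel_eq by blast+
  then obtain G where G: "\<And>k. G k \<in> sets MB" "\<And>k. P k = gset (G k)" by metis
  have Ae: "A k \<in> events" for k using A by (auto simp: is_partition_def)
  have Adj: "i = j" if "\<omega> \<in> A i" "\<omega> \<in> A j" for i j \<omega>
    using A that by (auto simp: is_partition_def disjoint_family_on_def)
  let ?G = "\<Union>k. G k \<inter> (A k \<times> UNIV)"
  have Gm: "?G \<in> sets MB" using G(1) Ae by (intro sets.countable_UN) auto
  have "P = (\<lambda>k. gset (G k))" using G(2) by blast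
  then have eq: "cconcat M A P = gset ?G" by (simp add: cconcat_gset[OF A])
  show "is_concat M A (\<lambda>k. \<mu> (P k)) (\<mu> (cconcat M A P))"
    unfolding is_concat_def eq G(2)
  proof
    fix k
    have "AE \<omega>\<in>A k in M. cint Q joint (indicator ?G) \<omega> = cint Q joint (indicator (G k)) \<omega>"
      by (rule cint_localize[OF Ae Gm G(1)]) (auto dest: Adj intro!: AE_I2)
    with \<mu>_gset[OF Gm] \<mu>_gset[OF G(1)[of k]]
    show "AE \<omega>\<in>A k in M. \<mu> (gset ?G) \<omega> = \<mu> (gset (G k)) \<omega>" by eventually_elim simp
  qed
next
  fix V :: "('a \<Rightarrow> 'b) set" and A assume *: "cond_pair M L0 V A \<and> crestr M V A \<in> stable_borel M"
  then obtain G where G: "G \<in> sets MB" "crestr M V A = gset G" by (auto elim: stable_borelE)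
  have V: "V \<noteq> {}" and A: "A \<in> events" using * cond_pairD[of V A] by blast+
  have "AE \<omega> in M. \<omega> \<in> space M - A \<longrightarrow> cint Q joint (indicator G) \<omega> = cint Q joint (indicator {}) \<omega>"
  proof (rule cint_localize)
    fix x :: "'a \<Rightarrow> 'b" assume x: "x \<in> L0"
    have "AE \<omega> in M. \<omega> \<in> {\<omega> \<in> space M. (\<omega>, x \<omega>) \<in> G} \<longrightarrow> \<omega> \<in> A"
      using sel_gset_graph[OF G(1) x] unfolding G(2)[symmetric] sel_crestr[OF V] by blast
    then show "AE \<omega> in M. \<omega> \<in> space M - A \<longrightarrow> (\<omega>, x \<omega>) \<in> G \<longleftrightarrow> (\<omega>, x \<omega>) \<in> {}"
      by eventually_elim auto
  qed (use A G in auto)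
  with \<mu>_gset[OF G(1)] cint_empty AE_space
  show "AE \<omega> in M. \<mu> (crestr M V A) \<omega> = (if \<omega> \<in> A then \<mu> (crestr M V A) \<omega> else 0)"
    unfolding G(2) by eventually_elim auto
next
  fix P :: "nat \<Rightarrow> ('a, 'b) cset"
  assume *: "(\<forall>k. P k \<in> stable_borel M) \<and> (\<forall>i j. i \<noteq> j \<longrightarrow> cdisjoint M L0 (P i) (P j))"
  then have "\<forall>k. \<exists>G\<in>sets MB. P k = gset G" unfolding stable_borel_eq by blast
  then obtain G where G [measurable]: "\<And>k. G k \<in> sets MB" and P: "\<And>k. P k = gset (G k)" by metis
  have "P = (\<lambda>k. gset (G k))" using P by blast
  then have lub: "\<Squnion>\<^bsub>csets\<^esub> (range P) = gset (\<Union>k. G k)" using gset_UN[OF G, where I=UNIV] by simp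
  have dj: "AE z in joint. \<not> (z \<in> G i \<and> z \<in> G j)" if "i \<noteq> j" for i j
  proof (rule AE_joint)
    fix x :: "'a \<Rightarrow> 'b" assume x: "x \<in> L0"
    have "gset (G i \<inter> G j) = gset {}" using * that by (simp add: cdisjoint_def P gset_meet cbot_eq_gset)
    from gset_eqD[OF _ _ this x] show "AE \<omega> in M. \<not> ((\<omega>, x \<omega>) \<in> G i \<and> (\<omega>, x \<omega>) \<in> G j)" by simp
  qed measurable
  have "AE z in joint. \<forall>i j. i \<noteq> j \<longrightarrow> \<not> (z \<in> G i \<and> z \<in> G j)"
    unfolding AE_all_countable using dj by (auto intro!: AE_impI)
  then have "AE z in joint. (indicator (\<Union>k. G k) z :: ennreal) = (\<Sum>k. indicator (G k) z)"
  proof eventually_elim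
    case (elim z)
    show ?case
    proof (cases "\<exists>k. z \<in> G k")
      case True
      then obtain k where k: "z \<in> G k" by blast
      have "(\<Sum>j. indicator (G j) z :: ennreal) = (\<Sum>j\<in>{k}. indicator (G j) z)"
        by (rule suminf_finite) (use elim k in \<open>auto simp: indicator_def\<close>)
      then show ?thesis using k by (auto simp: indicator_def)
    qed (auto simp: indicator_def)
  qed
  then have "AE \<omega> in Q. cint Q joint (indicator (\<Union>k. G k)) \<omega> = cint Q joint (\<lambda>z. \<Sum>k. indicator (G k) z) \<omega>"
    by (intro cint_cong_AE) measurable
  moreover have "AE \<omega> in Q. cint Q joint (\<lambda>z. \<Sum>k. indicator (G k) z) \<omega> = (\<Sum>k. cint Q joint (indicator (G k)) \<omega>)"
    by (rule cint_suminf) measurable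
  moreover have "AE \<omega> in Q. \<mu> (gset (\<Union>k. G k)) \<omega> = cint Q joint (indicator (\<Union>k. G k)) \<omega>"
    unfolding AE_Q by (rule \<mu>_gset) measurable
  moreover have "AE \<omega> in Q. \<forall>k. \<mu> (gset (G k)) \<omega> = cint Q joint (indicator (G k)) \<omega>"
    unfolding AE_all_countable AE_Q by (intro allI \<mu>_gset G)
  ultimately show "AE \<omega> in M. \<mu> (\<Squnion>\<^bsub>csets\<^esub> (range P)) \<omega> = (\<Sum>k. \<mu> (P k) \<omega>)"
    unfolding lub P AE_Q[symmetric] by eventually_elim simp
qed (rule \<mu>_measurable)

lemma cint_space: "AE \<omega> in M. cint Q joint (indicator (space MB)) \<omega> = ennreal (L (\<lambda>_ _. 1) \<omega>)"
proof -
  have "AE \<omega> in Q. cint Q joint (indicator (space MB)) \<omega> = cint Q joint (\<lambda>_. ennreal 1) \<omega>"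
    by (rule cint_cong_AE) (auto intro!: AE_I2)
  moreover have "AE \<omega> in Q. cint Q joint (\<lambda>_. ennreal 1) \<omega> = ennreal (L (hat (\<lambda>_. 1)) \<omega>)"
    by (rule cint_H[OF H_const]) simp
  ultimately show ?thesis unfolding AE_Q[symmetric] by eventually_elim (simp add: hat_def)
qed

lemma finite_stable_measure_\<mu>: "finite_stable_measure M L0 (stable_borel M) \<mu>"
  unfolding finite_stable_measure_def
proof
  show "AE \<omega> in M. \<mu> (ctop M L0) \<omega> < \<infinity>"
    unfolding ctop_eq_gset using \<mu>_gset[OF sets.top] cint_space by eventually_elim simp
qed (rule stable_measure_\<mu>)

section \<open>Stable integrals as conditional integrals\<close>

text \<open>Every representation of an elementary function leads to a jointly measurable version
  whose conditional integral is the elementary integral; versions agree along random points, which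
  settles independence of the representation.\<close>

lemma has_elementary_integralD:
  assumes "has_elementary_integral M L0 (stable_borel M) \<mu> f J"
  shows "\<exists>E\<in>borel_measurable MB. (\<forall>x\<in>L0. AE \<omega> in M. ennreal (f x \<omega>) = E (\<omega>, x \<omega>) \<and> 0 \<le> f x \<omega>) \<and>
     (AE \<omega> in M. J \<omega> = cint Q joint E \<omega>)"
proof -
  obtain n :: nat and r V A where
    el: "\<forall>k<n. r k \<in> borel_measurable M \<and> (AE \<omega> in M. 0 \<le> r k \<omega>) \<and>
           cond_pair M L0 (V k) (A k) \<and> crestr M (V k) (A k) \<in> stable_borel M"
      "\<forall>i<n. \<forall>j<n. i \<noteq> j \<longrightarrow> cdisjoint M L0 (crestr M (V i) (A i)) (crestr M (V j) (A j))"
      "\<Squnion>\<^bsub>csets\<^esub> ((\<lambda>k. crestr M (V k) (A k)) ` {..<n}) = ctop M L0" and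
    f: "\<forall>x\<in>L0. AE \<omega> in M. f x \<omega> = (\<Sum>k<n. r k \<omega> * stable_indicator M (V k) (A k) x \<omega>)" and
    J: "AE \<omega> in M. J \<omega> = (\<Sum>k<n. ennreal (r k \<omega>) * \<mu> (crestr M (V k) (A k)) \<omega>)"
    using assms unfolding has_elementary_integral_def by (elim exE conjE) (rule that)
  note el' = el(1)[rule_format]
  note r = el'[THEN conjunct1] el'[THEN conjunct2, THEN conjunct1]
  note V = el'[THEN conjunct2, THEN conjunct2, THEN conjunct1] el'[THEN conjunct2, THEN conjunct2, THEN conjunct2]
  have "\<exists>G. k < n \<longrightarrow> G \<in> sets MB \<and> crestr M (V k) (A k) = gset G" for k
  proof (cases "k < n")
    case True
    obtain G where "G \<in> sets MB" "crestr M (V k) (A k) = gset G" using V(2)[OF True] by (rule stable_borelE)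
    then show ?thesis by blast
  qed simp
  then obtain G where G: "\<And>k. k < n \<Longrightarrow> G k \<in> sets MB" "\<And>k. k < n \<Longrightarrow> crestr M (V k) (A k) = gset (G k)" by metis
  define E where "E z = (\<Sum>k<n. ennreal (r k (fst z)) * indicator (G k) z)" for z
  have Ek: "(\<lambda>z. ennreal (r k (fst z)) * indicator (G k) z) \<in> borel_measurable MB" if "k < n" for k
    using r(1)[OF that] G(1)[OF that] by measurable
  have Em: "E \<in> borel_measurable MB" unfolding E_def[abs_def] using Ek by (intro borel_measurable_sum) auto
  have r0: "AE \<omega> in M. \<forall>k. k < n \<longrightarrow> 0 \<le> r k \<omega>" unfolding AE_all_countable using r(2) by (auto intro!: AE_impI)
  have "AE \<omega> in M. ennreal (f x \<omega>) = E (\<omega>, x \<omega>) \<and> 0 \<le> f x \<omega>" if x: "x \<in> L0" for x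
  proof -
    have "AE \<omega> in M. \<forall>k. k < n \<longrightarrow> stable_indicator M (V k) (A k) x \<omega> = indicator (G k) (\<omega>, x \<omega>)"
      unfolding AE_all_countable using stable_indicator_gset[OF V(1) G(2,1) x] by (auto intro!: AE_impI)
    with f[rule_format, OF x] r0 show ?thesis
    proof eventually_elim
      case (elim \<omega>)
      have f': "f x \<omega> = (\<Sum>k<n. r k \<omega> * indicator (G k) (\<omega>, x \<omega>))"
        unfolding elim(1) by (rule sum.cong) (use elim in auto)
      have "ennreal (f x \<omega>) = (\<Sum>k<n. ennreal (r k \<omega> * indicator (G k) (\<omega>, x \<omega>)))"
        unfolding f' by (rule sum_ennreal[symmetric]) (use elim in auto)
      also have "\<dots> = E (\<omega>, x \<omega>)"
        unfolding E_def by (rule sum.cong) (auto simp: indicator_def)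
      finally show ?case using elim(2) unfolding f' by (auto intro: sum_nonneg)
    qed
  qed
  moreover have "AE \<omega> in M. J \<omega> = cint Q joint E \<omega>"
  proof -
    have "AE \<omega> in Q. cint Q joint E \<omega> = (\<Sum>k<n. cint Q joint (\<lambda>z. ennreal (r k (fst z)) * indicator (G k) z) \<omega>)"
      unfolding E_def[abs_def] by (rule cint_sum) (use Ek in simp)
    moreover have "AE \<omega> in Q. \<forall>k. k < n \<longrightarrow> cint Q joint (\<lambda>z. ennreal (r k (fst z)) * indicator (G k) z) \<omega> =
        ennreal (r k \<omega>) * cint Q joint (indicator (G k)) \<omega>"
      unfolding AE_all_countable using r(1) G(1) by (auto intro!: AE_impI cint_mult)
    moreover have "AE \<omega> in Q. \<forall>k. k < n \<longrightarrow> \<mu> (gset (G k)) \<omega> = cint Q joint (indicator (G k)) \<omega>"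
      unfolding AE_all_countable AE_Q using \<mu>_gset[OF G(1)] by (auto intro!: AE_impI)
    ultimately show ?thesis using J unfolding AE_Q
      by eventually_elim (simp add: G(2))
  qed
  ultimately show ?thesis using Em by blast
qed

text \<open>Every approximating sequence leads by monotone convergence to the same conditional
  integral, so the choice in \<open>stable_nn_integral\<close> is harmless.\<close>

lemma has_stable_nn_integral_unique:
  assumes J: "has_stable_nn_integral M L0 (stable_borel M) \<mu> f J"
    and F [measurable]: "F \<in> borel_measurable MB" and fF: "\<And>x. x \<in> L0 \<Longrightarrow> AE \<omega> in M. f x \<omega> = F (\<omega>, x \<omega>)"
  shows "AE \<omega> in M. J \<omega> = cint Q joint (\<lambda>z. ennreal (F z)) \<omega>"
proof -
  obtain fs :: "nat \<Rightarrow> ('a \<Rightarrow> 'b) \<Rightarrow> 'a \<Rightarrow> real" and Js where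
    el: "\<And>n. has_elementary_integral M L0 (stable_borel M) \<mu> (fs n) (Js n)" and
    inc: "\<And>n x. x \<in> L0 \<Longrightarrow> AE \<omega> in M. fs n x \<omega> \<le> fs (Suc n) x \<omega>" and
    sup: "\<And>x. x \<in> L0 \<Longrightarrow> AE \<omega> in M. (SUP n. ennreal (fs n x \<omega>)) = ennreal (f x \<omega>)" and
    JJ: "AE \<omega> in M. J \<omega> = (SUP n. Js n \<omega>)"
    using J unfolding has_stable_nn_integral_def by blast
  obtain E where E [measurable]: "\<And>n. E n \<in> borel_measurable MB" and
    Ef: "\<And>n x. x \<in> L0 \<Longrightarrow> AE \<omega> in M. ennreal (fs n x \<omega>) = E n (\<omega>, x \<omega>) \<and> 0 \<le> fs n x \<omega>" and
    EJ: "\<And>n. AE \<omega> in M. Js n \<omega> = cint Q joint (E n) \<omega>"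
  proof -
    have "\<forall>n. \<exists>E. E \<in> borel_measurable MB \<and> (\<forall>x\<in>L0. AE \<omega> in M. ennreal (fs n x \<omega>) = E (\<omega>, x \<omega>) \<and> 0 \<le> fs n x \<omega>) \<and>
        (AE \<omega> in M. Js n \<omega> = cint Q joint E \<omega>)"
      using has_elementary_integralD[OF el] by (simp add: Bex_def)
    from choice[OF this] obtain E where "\<forall>n. E n \<in> borel_measurable MB \<and>
        (\<forall>x\<in>L0. AE \<omega> in M. ennreal (fs n x \<omega>) = E n (\<omega>, x \<omega>) \<and> 0 \<le> fs n x \<omega>) \<and>
        (AE \<omega> in M. Js n \<omega> = cint Q joint (E n) \<omega>)" ..
    then show thesis by (intro that[of E]) simp_all
  qed
  have "AE z in joint. \<forall>n. E n z \<le> E (Suc n) z"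
    unfolding AE_all_countable
  proof
    fix n show "AE z in joint. E n z \<le> E (Suc n) z"
    proof (rule AE_joint)
      fix x :: "'a \<Rightarrow> 'b" assume x: "x \<in> L0"
      show "AE \<omega> in M. E n (\<omega>, x \<omega>) \<le> E (Suc n) (\<omega>, x \<omega>)"
        using Ef[OF x, of n] Ef[OF x, of "Suc n"] inc[OF x, of n]
        by eventually_elim (metis ennreal_leI)
    qed measurable
  qed
  then have 1: "AE \<omega> in M. cint Q joint (\<lambda>z. SUP n. E n z) \<omega> = (SUP n. cint Q joint (E n) \<omega>)"
    unfolding AE_Q[symmetric] by (intro cint_SUP) measurable
  have "AE z in joint. (SUP n. E n z) = ennreal (F z)"
  proof (rule AE_joint)
    fix x :: "'a \<Rightarrow> 'b" assume x: "x \<in> L0"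
    have "AE \<omega> in M. \<forall>n. ennreal (fs n x \<omega>) = E n (\<omega>, x \<omega>)"
      unfolding AE_all_countable using Ef[OF x] by (auto elim: eventually_mono)
    with sup[OF x] fF[OF x] show "AE \<omega> in M. (SUP n. E n (\<omega>, x \<omega>)) = ennreal (F (\<omega>, x \<omega>))"
      by eventually_elim simp
  qed measurable
  then have 2: "AE \<omega> in M. cint Q joint (\<lambda>z. SUP n. E n z) \<omega> = cint Q joint (\<lambda>z. ennreal (F z)) \<omega>"
    unfolding AE_Q[symmetric] by (intro cint_cong_AE) measurable
  have "AE \<omega> in M. \<forall>n. Js n \<omega> = cint Q joint (E n) \<omega>" unfolding AE_all_countable using EJ by blast
  with 1 2 JJ show ?thesis by eventually_elim simp
qed

text \<open>The level sets of a simple function on the product give the disjoint conditional sets,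
  with constants as coefficients.\<close>

lemma has_elementary_integral_simple:
  assumes s: "simple_function MB s" and fin: "\<And>z. s z < \<infinity>"
  shows "\<exists>J. has_elementary_integral M L0 (stable_borel M) \<mu> (\<lambda>x \<omega>. enn2real (s (\<omega>, x \<omega>))) J"
proof -
  let ?R = "s ` space MB"
  define n where "n = card ?R"
  have "finite ?R" using s by (simp add: simple_function_def)
  then obtain v where v: "bij_betw v {0..<n} ?R" unfolding n_def using ex_bij_betw_nat_finite by blast
  then have v: "bij_betw v {..<n} ?R" by (simp add: atLeast0LessThan)
  define G where "G k = s -` {v k} \<inter> space MB" for k
  have G [measurable]: "G k \<in> sets MB" for k
    unfolding G_def by (rule simple_functionD(2)[OF s])
  have Gv: "z \<in> G k \<longleftrightarrow> z \<in> space MB \<and> s z = v k" for z k by (auto simp: G_def)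
  have ex: "\<exists>!k. k \<in> {..<n} \<and> s z = v k" if "z \<in> space MB" for z
    using v that unfolding bij_betw_def inj_on_def by (metis imageE imageI)
  have "\<forall>k. \<exists>V A. cond_pair M L0 V A \<and> crestr M V A = gset (G k)"
    by (metis carrierE gset_carrier)
  then obtain V A where VA: "\<And>k. cond_pair M L0 (V k) (A k)" "\<And>k. crestr M (V k) (A k) = gset (G k)" by metis
  have UG: "(\<Union>k\<in>{..<n}. G k) = space MB" using ex by (auto simp: Gv) blast
  have sum: "(\<Sum>k<n. enn2real (v k) * indicator (G k) z) = enn2real (s z)" if z: "z \<in> space MB" for z
  proof -
    obtain k where k: "k < n" "s z = v k" "\<And>j. j < n \<Longrightarrow> s z = v j \<Longrightarrow> j = k"
      using ex[OF z] unfolding lessThan_iff by (elim ex1E) metis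
    have "(\<Sum>j<n. enn2real (v j) * indicator (G j) z) = (\<Sum>j\<in>{k}. enn2real (v j) * indicator (G j) z)"
    proof (rule sum.mono_neutral_right)
      have "z \<notin> G j" if "j < n" "j \<noteq> k" for j using k(3)[OF that(1)] that(2) by (auto simp: Gv)
      then show "\<forall>j\<in>{..<n} - {k}. enn2real (v j) * indicator (G j) z = 0" by simp
    qed (use k(1) in auto)
    moreover have "z \<in> G k" using k(2) z by (simp add: Gv)
    ultimately show ?thesis using k(2) by simp
  qed
  have "has_elementary_integral M L0 (stable_borel M) \<mu> (\<lambda>x \<omega>. enn2real (s (\<omega>, x \<omega>)))
     (\<lambda>\<omega>. \<Sum>k<n. ennreal (enn2real (v k)) * \<mu> (crestr M (V k) (A k)) \<omega>)"
    unfolding has_elementary_integral_def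
  proof (rule exI[of _ n], rule exI[of _ "\<lambda>k _. enn2real (v k)"], rule exI[of _ V], rule exI[of _ A],
      intro conjI allI impI ballI)
    show "crestr M (V k) (A k) \<in> stable_borel M" for k unfolding stable_borel_eq VA(2) using G by blast
    show "cdisjoint M L0 (crestr M (V i) (A i)) (crestr M (V j) (A j))" if "i < n" "j < n" "i \<noteq> j" for i j
    proof -
      have "G i \<inter> G j = {}" using ex that by (auto simp: Gv) (metis lessThan_iff)
      then show ?thesis by (simp add: cdisjoint_def VA(2) gset_meet cbot_eq_gset)
    qed
    show "\<Squnion>\<^bsub>csets\<^esub> ((\<lambda>k. crestr M (V k) (A k)) ` {..<n}) = ctop M L0"
      unfolding VA(2) gset_UN[OF G] UG ctop_eq_gset ..
    fix x :: "'a \<Rightarrow> 'b" assume x: "x \<in> L0"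
    have "AE \<omega> in M. \<forall>k. stable_indicator M (V k) (A k) x \<omega> = indicator (G k) (\<omega>, x \<omega>)"
      unfolding AE_all_countable using stable_indicator_gset[OF VA G x] by blast
    with AE_space show "AE \<omega> in M. enn2real (s (\<omega>, x \<omega>)) = (\<Sum>k<n. enn2real (v k) * stable_indicator M (V k) (A k) x \<omega>)"
    proof eventually_elim
      case (elim \<omega>)
      then have "(\<omega>, x \<omega>) \<in> space MB" by (simp add: space_pair_measure)
      from sum[OF this] show ?case unfolding elim(2)[rule_format] by (rule sym)
    qed
  qed (auto simp: VA(1))
  then show ?thesis by blast
qed

lemma has_stable_nn_integral_exists:
  assumes F [measurable]: "F \<in> borel_measurable MB" and fF: "\<And>x. x \<in> L0 \<Longrightarrow> AE \<omega> in M. f x \<omega> = F (\<omega>, x \<omega>)"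
  shows "\<exists>J. has_stable_nn_integral M L0 (stable_borel M) \<mu> f J"
proof -
  have "(\<lambda>z. ennreal (F z)) \<in> borel_measurable MB" by measurable
  then obtain s where s: "\<And>i. simple_function MB (s i)" "incseq s" "\<And>i z. s i z < \<infinity>" "\<And>z. (SUP i. s i z) = ennreal (F z)"
    by (rule borel_measurable_implies_simple_function_sequence') (rule that, simp_all)
  have s': "ennreal (enn2real (s i z)) = s i z" for i z
    by (rule ennreal_enn2real) (use s(3) in simp)
  obtain Js where Js: "\<And>i. has_elementary_integral M L0 (stable_borel M) \<mu> (\<lambda>x \<omega>. enn2real (s i (\<omega>, x \<omega>))) (Js i)"
    using has_elementary_integral_simple[OF s(1,3)] by metis
  have "has_stable_nn_integral M L0 (stable_borel M) \<mu> f (\<lambda>\<omega>. SUP i. Js i \<omega>)"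
    unfolding has_stable_nn_integral_def
  proof (rule exI[of _ "\<lambda>i x \<omega>. enn2real (s i (\<omega>, x \<omega>))"], rule exI[of _ Js], intro conjI allI ballI Js)
    fix x :: "'a \<Rightarrow> 'b" assume x: "x \<in> L0"
    show "AE \<omega> in M. enn2real (s i (\<omega>, x \<omega>)) \<le> enn2real (s (Suc i) (\<omega>, x \<omega>))" for i
      by (intro AE_I2 enn2real_mono) (use s(2,3) in \<open>auto simp: incseq_Suc_iff le_fun_def\<close>)
    show "AE \<omega> in M. (SUP i. ennreal (enn2real (s i (\<omega>, x \<omega>)))) = ennreal (f x \<omega>)"
      using fF[OF x] by eventually_elim (simp add: s' s(4))
  qed auto
  then show ?thesis by blast
qed

lemma stable_nn_integral_eq:
  assumes F: "F \<in> borel_measurable MB" and fF: "\<And>x. x \<in> L0 \<Longrightarrow> AE \<omega> in M. f x \<omega> = F (\<omega>, x \<omega>)"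
  shows "AE \<omega> in M. stable_nn_integral M L0 (stable_borel M) \<mu> f \<omega> = cint Q joint (\<lambda>z. ennreal (F z)) \<omega>"
  unfolding stable_nn_integral_def
  by (rule has_stable_nn_integral_unique[OF someI_ex[OF has_stable_nn_integral_exists[OF assms]] assms])

lemma stable_nn_integral_SC:
  assumes f: "f \<in> SC" "\<And>x. x \<in> L0 \<Longrightarrow> AE \<omega> in M. 0 \<le> f x \<omega>"
  shows "AE \<omega> in M. stable_nn_integral M L0 (stable_borel M) \<mu> f \<omega> = ennreal (L f \<omega>)"
proof -
  have "AE \<omega> in M. stable_nn_integral M L0 (stable_borel M) \<mu> f \<omega> = cint Q joint (\<lambda>z. ennreal (version f z)) \<omega>"
    by (rule stable_nn_integral_eq[OF version_measurable[OF f(1)]]) (rule version_eq[OF f(1)])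
  moreover have "AE \<omega> in M. cint Q joint (\<lambda>z. ennreal (version f z)) \<omega> = ennreal (L f \<omega>)"
    using cint_version[OF f] unfolding AE_Q by simp
  ultimately show ?thesis by eventually_elim simp
qed

lemma stably_measurable_SC:
  assumes f: "f \<in> SC"
  shows "stably_measurable M L0 (stable_borel M) L0 (stable_borel M) f"
  unfolding stably_measurable_def
proof (intro conjI allI impI)
  show "stable_fun M L0 L0 f" using f by (simp add: stable_seq_continuous_def)
  fix W :: "('a \<Rightarrow> real) set" and A assume "cond_pair M L0 W A \<and> crestr M W A \<in> stable_borel M"
  then have W: "cond_pair M L0 W A" and "crestr M W A \<in> gset ` sets MB" unfolding stable_borel_eq by blast+
  then obtain K where K [measurable]: "K \<in> sets MB" and WK: "crestr M W A = gset K" by blast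
  note [measurable] = version_measurable[OF f]
  have "cpreimage M L0 f W A = gset {z \<in> space MB. (fst z, version f z) \<in> K}"
    by (rule cpreimage_gset[OF W WK K SC_measurable[OF f] version_eq[OF f]])
  moreover have "{z \<in> space MB. (fst z, version f z) \<in> K} \<in> sets MB" by measurable
  ultimately show "cpreimage M L0 f W A \<in> stable_borel M" unfolding stable_borel_eq by blast
qed

lemma representation:
  assumes f: "f \<in> SC"
  shows "stably_integrable M L0 (stable_borel M) \<mu> f"
    and "AE \<omega> in M. L f \<omega> = stable_integral M L0 (stable_borel M) \<mu> f \<omega>"
proof -
  have p: "(\<lambda>x \<omega>. max (f x \<omega>) 0) \<in> SC" by (rule SC_max[OF f SC_const])
  have mf: "(\<lambda>x \<omega>. - f x \<omega>) \<in> SC" using SC_diff[OF SC_const[of 0] f] by simp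
  have m: "(\<lambda>x \<omega>. max (- f x \<omega>) 0) \<in> SC" by (rule SC_max[OF mf SC_const])
  have ip: "AE \<omega> in M. stable_nn_integral M L0 (stable_borel M) \<mu> (\<lambda>x \<omega>. max (f x \<omega>) 0) \<omega> = ennreal (L (\<lambda>x \<omega>. max (f x \<omega>) 0) \<omega>)"
    by (rule stable_nn_integral_SC[OF p]) simp
  have im: "AE \<omega> in M. stable_nn_integral M L0 (stable_borel M) \<mu> (\<lambda>x \<omega>. max (- f x \<omega>) 0) \<omega> = ennreal (L (\<lambda>x \<omega>. max (- f x \<omega>) 0) \<omega>)"
    by (rule stable_nn_integral_SC[OF m]) simp
  show "stably_integrable M L0 (stable_borel M) \<mu> f"
    unfolding stably_integrable_def
  proof (intro conjI stably_measurable_SC[OF f])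
    show "AE \<omega> in M. stable_nn_integral M L0 (stable_borel M) \<mu> (\<lambda>x \<omega>. max (f x \<omega>) 0) \<omega> < \<infinity>"
      using ip by eventually_elim simp
    show "AE \<omega> in M. stable_nn_integral M L0 (stable_borel M) \<mu> (\<lambda>x \<omega>. max (- f x \<omega>) 0) \<omega> < \<infinity>"
      using im by eventually_elim simp
  qed
  have "AE \<omega> in M. L (\<lambda>x \<omega>. max (f x \<omega>) 0 - max (- f x \<omega>) 0) \<omega> = L (\<lambda>x \<omega>. max (f x \<omega>) 0) \<omega> - L (\<lambda>x \<omega>. max (- f x \<omega>) 0) \<omega>"
    by (rule L_diff[OF p m])
  moreover have "(\<lambda>x \<omega>. max (f x \<omega>) 0 - max (- f x \<omega>) 0) = f"
    by (auto simp: fun_eq_iff max_def)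
  moreover have "AE \<omega> in M. 0 \<le> L (\<lambda>x \<omega>. max (f x \<omega>) 0) \<omega>" by (rule L_nonneg[OF p]) simp
  moreover have "AE \<omega> in M. 0 \<le> L (\<lambda>x \<omega>. max (- f x \<omega>) 0) \<omega>" by (rule L_nonneg[OF m]) simp
  ultimately have "AE \<omega> in M. L f \<omega> = L (\<lambda>x \<omega>. max (f x \<omega>) 0) \<omega> - L (\<lambda>x \<omega>. max (- f x \<omega>) 0) \<omega> \<and>
      0 \<le> L (\<lambda>x \<omega>. max (f x \<omega>) 0) \<omega> \<and> 0 \<le> L (\<lambda>x \<omega>. max (- f x \<omega>) 0) \<omega>" by simp
  with ip im show "AE \<omega> in M. L f \<omega> = stable_integral M L0 (stable_borel M) \<mu> f \<omega>"
    unfolding stable_integral_def by eventually_elim simp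
qed

section \<open>Conditional regularity\<close>

text \<open>Outer approximation of the complement leaves a zero set inside \<open>G\<close> at a
  cost of \<open>e / 2\<close>; a large ball makes it bounded, at a further small cost by continuity
  from below.\<close>

lemma inner_regular_joint:
  assumes G: "G \<in> sets MB" and e: "0 < e"
  shows "\<exists>f\<in>H. \<exists>n::nat. {z \<in> space MB. f z \<le> 0 \<and> norm (snd z) \<le> real n} \<subseteq> G \<and>
     emeasure joint (G - {z \<in> space MB. f z \<le> 0 \<and> norm (snd z) \<le> real n}) \<le> ennreal e"
proof -
  interpret joint: finite_measure joint by (rule finite_joint)
  have SG: "space joint - G \<in> sets joint" using G by auto
  obtain f where f: "f \<in> H" "space joint - G \<subseteq> coz f" "emeasure joint (coz f) \<le> emeasure joint (space joint - G) + ennreal (e / 2)"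
    using regular_joint[OF SG, of "e / 2"] e by auto
  note fm [measurable] = H_measurable[OF f(1)]
  have cf [measurable]: "coz f \<in> sets MB" unfolding coz_def by measurable
  define K where "K n = {z \<in> space MB. f z \<le> 0 \<and> norm (snd z) \<le> real n}" for n
  have K [measurable]: "K n \<in> sets MB" for n unfolding K_def by measurable
  have KG: "K n \<subseteq> G" for n using f(2) by (auto simp: K_def coz_def)
  have GU: "(\<Union>n. K n) = space MB - coz f"
  proof -
    have "\<exists>n. norm y \<le> real n" for y :: 'b by (rule real_arch_simple)
    then show ?thesis by (auto simp: K_def coz_def not_less)
  qed
  have "incseq K" by (rule incseq_SucI) (auto simp: K_def)
  then have "(\<lambda>n. measure joint (K n)) \<longlonglongrightarrow> measure joint (\<Union>n. K n)"
    by (intro joint.finite_Lim_measure_incseq) auto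
  then have "(\<lambda>n. measure joint (G - K n)) \<longlonglongrightarrow> measure joint G - measure joint (\<Union>n. K n)"
    using KG G by (subst joint.finite_measure_Diff) (auto intro!: tendsto_intros)
  moreover have "measure joint G - measure joint (\<Union>n. K n) < e"
  proof -
    have "measure joint (coz f) \<le> measure joint (space joint - G) + e / 2"
      using f(3) e by (simp add: joint.emeasure_eq_measure ennreal_plus[symmetric] del: ennreal_plus)
    moreover have "measure joint (space joint - G) = measure joint (space joint) - measure joint G"
      using G by (intro joint.finite_measure_compl) simp
    moreover have "measure joint (space MB - coz f) = measure joint (space joint) - measure joint (coz f)"
      using joint.finite_measure_compl[of "coz f"] by simp
    ultimately show ?thesis using e unfolding GU by linarith
  qed
  ultimately have "eventually (\<lambda>n. measure joint (G - K n) < e) sequentially" by (rule order_tendstoD)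
  then obtain n where "measure joint (G - K n) < e" by (auto simp: eventually_sequentially)
  then have "emeasure joint (G - K n) \<le> ennreal e" by (simp add: joint.emeasure_eq_measure ennreal_leI)
  with f(1) KG show ?thesis unfolding K_def by blast
qed

text \<open>Closedness is inherited from the sequential continuity of \<open>hat f\<close> along
  random points, as \<open>K\<close> is cut out by nonstrict inequalities; the ball provides the
  bound.\<close>

lemma gset_stably_compact:
  assumes f: "f \<in> H" and K: "K = {z \<in> space MB. f z \<le> 0 \<and> norm (snd z) \<le> real n}"
  shows "\<exists>W B. cond_pair M L0 W B \<and> crestr M W B = gset K \<and> stably_compact M W B"
proof -
  define C where "C = ess_Sup_sets M {A. \<exists>x. gsel K A x}"
  define W where "W = {x \<in> L0. gsel K C x}"
  note rep = selsys_represent[OF selsys_gsel selsys_esup[OF selsys_gsel], of K, folded C_def W_def]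
  have eq: "crestr M W C = gset K" unfolding gset_def cset_def C_def W_def Let_def ..
  have WD: "AE \<omega>\<in>C in M. f (\<omega>, x \<omega>) \<le> 0 \<and> norm (x \<omega>) \<le> real n" if "x \<in> W" for x
    using that unfolding W_def gsel_def K by (auto elim: eventually_mono)
  have C [measurable]: "C \<in> events" using cond_pairD[OF rep(1)] by simp
  have "L0_bounded M W C"
    unfolding L0_bounded_def
  proof (intro bexI[of _ "\<lambda>_. real n"] conjI ballI)
    show "AE \<omega>\<in>C in M. norm (x \<omega>) \<le> real n" if "x \<in> W" for x
      using WD[OF that] by eventually_elim simp
  qed auto
  moreover have "sequentially_closed M W C"
    unfolding sequentially_closed_def
  proof (intro allI impI)
    fix xs :: "nat \<Rightarrow> 'a \<Rightarrow> 'b" and x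
    assume *: "(\<forall>n. xs n \<in> W) \<and> x \<in> L0 \<and> (AE \<omega>\<in>C in M. (\<lambda>n. xs n \<omega>) \<longlonglongrightarrow> x \<omega>)"
    then have xs: "\<And>k. xs k \<in> W" and x [measurable]: "x \<in> L0"
      and lim: "AE \<omega>\<in>C in M. (\<lambda>n. xs n \<omega>) \<longlonglongrightarrow> x \<omega>" by blast+
    have [measurable]: "xs k \<in> L0" for k using xs[of k] by (simp add: W_def)
    \<comment> \<open>Convergence is given only on \<open>C\<close>; putting the limit itself off
      \<open>C\<close> makes the sequence converge on the whole space, as \<open>SC_tendsto\<close>
      demands.\<close>
    define ys where "ys k \<omega> = (if \<omega> \<in> C then xs k \<omega> else x \<omega>)" for k \<omega>
    have ys: "ys k \<in> L0" for k unfolding ys_def[abs_def] by measurable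
    have "AE \<omega> in M. (\<lambda>k. ys k \<omega>) \<longlonglongrightarrow> x \<omega>" using lim
    proof eventually_elim
      case (elim \<omega>)
      then show ?case by (cases "\<omega> \<in> C") (simp_all add: ys_def)
    qed
    from SC_tendsto[OF hat_H[OF f] ys x this]
    have lf: "AE \<omega> in M. (\<lambda>k. f (\<omega>, ys k \<omega>)) \<longlonglongrightarrow> f (\<omega>, x \<omega>)" by (simp add: hat_def)
    have all: "AE \<omega> in M. \<forall>k. \<omega> \<in> C \<longrightarrow> f (\<omega>, xs k \<omega>) \<le> 0 \<and> norm (xs k \<omega>) \<le> real n"
      unfolding AE_all_countable using WD[OF xs] by blast
    have "AE \<omega>\<in>C in M. (\<omega>, x \<omega>) \<in> K"
      using lf lim all AE_space
    proof eventually_elim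
      case (elim \<omega>)
      show ?case
      proof
        assume c: "\<omega> \<in> C"
        have "f (\<omega>, x \<omega>) \<le> 0"
          by (rule LIMSEQ_le_const2[OF elim(1)]) (use elim(3) c in \<open>auto simp: ys_def\<close>)
        moreover have "norm (x \<omega>) \<le> real n"
          by (rule LIMSEQ_le_const2[OF tendsto_norm]) (use elim c in auto)
        ultimately show "(\<omega>, x \<omega>) \<in> K" using elim(4) by (simp add: K space_pair_measure)
      qed
    qed
    then have "x \<in> W" unfolding W_def gsel_def by simp
    then show "(Some \<circ> x) |` C \<in> crestr M W C" unfolding crestr_def by auto
  qed
  ultimately show ?thesis using rep(1) eq unfolding stably_compact_def by blast
qed

text \<open>For an upper bound \<open>h\<close> of the compact values, the \<open>Q\<close>-integral
  of the excess of \<open>\<mu> P\<close> over \<open>h\<close> is at most the joint mass missed by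
  a single compact set, hence \<open>0\<close>. Integration takes the place of an increasing
  sequence of compact sets.\<close>

lemma conditionally_regular_\<mu>: "conditionally_regular M \<mu>"
  unfolding conditionally_regular_def
proof
  fix P :: "('a, 'b) cset" assume "P \<in> stable_borel M"
  then obtain G where G [measurable]: "G \<in> sets MB" and P: "P = gset G" by (rule stable_borelE)
  let ?\<K> = "{\<mu> (crestr M W B) |W B. cond_pair M L0 W B \<and> crestr M W B \<in> stable_borel M \<and>
      cond_le M L0 (crestr M W B) P \<and> stably_compact M W B}"
  show "is_ess_Sup M ?\<K> (\<mu> P)"
    unfolding is_ess_Sup_def
  proof (intro conjI ballI impI \<mu>_measurable)
    fix g assume "g \<in> ?\<K>"
    then obtain K where K [measurable]: "K \<in> sets MB" and g: "g = \<mu> (gset K)" "cond_le M L0 (gset K) (gset G)"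
      unfolding stable_borel_eq P by auto
    have "AE z in joint. z \<in> K \<longrightarrow> z \<in> G"
      by (rule AE_joint) (measurable, use g(2) in \<open>simp add: gset_le_iff\<close>)
    then have "AE z in joint. (indicator K z :: ennreal) \<le> indicator G z"
      by eventually_elim (simp add: indicator_def)
    then have "AE \<omega> in Q. cint Q joint (indicator K) \<omega> \<le> cint Q joint (indicator G) \<omega>"
      by (intro cint_mono) measurable
    then show "AE \<omega> in M. g \<omega> \<le> \<mu> P \<omega>"
      unfolding AE_Q g P using \<mu>_gset[OF K] \<mu>_gset[OF G] by eventually_elim simp
  next
    fix h :: "'a \<Rightarrow> ennreal" assume h [measurable]: "h \<in> borel_measurable M" and up: "\<forall>g\<in>?\<K>. AE \<omega> in M. g \<omega> \<le> h \<omega>"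
    interpret joint: finite_measure joint by (rule finite_joint)
    have hQ [measurable]: "h \<in> borel_measurable Q" by measurable
    let ?c = "\<lambda>G. cint Q joint (indicator G)"
    have "(\<integral>\<^sup>+\<omega>. ?c G \<omega> \<partial>Q) = emeasure joint G" by (subst cint_integral) auto
    then have "(\<integral>\<^sup>+\<omega>. ?c G \<omega> \<partial>Q) \<noteq> \<infinity>" by simp
    \<comment> \<open>Excludes infinity minus infinity, which is infinite in \<open>ennreal\<close>,
      from the estimate below.\<close>
    then have fin: "AE \<omega> in Q. ?c G \<omega> \<noteq> \<infinity>" by (rule nn_integral_noteq_infinite[rotated]) measurable
    have "(\<integral>\<^sup>+\<omega>. ?c G \<omega> - h \<omega> \<partial>Q) \<le> 0 + ennreal e" if e: "0 < e" for e
    proof -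
      obtain f n where f: "f \<in> H" and KG: "{z \<in> space MB. f z \<le> 0 \<and> norm (snd z) \<le> real n} \<subseteq> G"
        and Ke: "emeasure joint (G - {z \<in> space MB. f z \<le> 0 \<and> norm (snd z) \<le> real n}) \<le> ennreal e"
        using inner_regular_joint[OF G e] by blast
      define K where "K = {z \<in> space MB. f z \<le> 0 \<and> norm (snd z) \<le> real n}"
      note [measurable] = H_measurable[OF f]
      have K [measurable]: "K \<in> sets MB" unfolding K_def by measurable
      obtain W B where W: "cond_pair M L0 W B" "crestr M W B = gset K" "stably_compact M W B"
        using gset_stably_compact[OF f K_def] by blast
      have "cond_le M L0 (gset K) (gset G)" using KG by (auto simp: gset_le_iff K_def[symmetric])
      moreover have "gset K \<in> stable_borel M" unfolding stable_borel_eq using K by blast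
      ultimately have "\<mu> (gset K) \<in> ?\<K>" by (intro CollectI exI[of _ W] exI[of _ B]) (simp add: W P)
      then have "AE \<omega> in M. \<mu> (gset K) \<omega> \<le> h \<omega>" using up by blast
      with \<mu>_gset[OF K] have "AE \<omega> in M. ?c K \<omega> \<le> h \<omega>" by eventually_elim simp
      then have Kh: "AE \<omega> in Q. ?c K \<omega> \<le> h \<omega>" unfolding AE_Q .
      have "AE \<omega> in Q. ?c G \<omega> = cint Q joint (\<lambda>z. indicator K z + indicator (G - K) z) \<omega>"
        using KG by (intro cint_cong_AE AE_I2) (auto simp: K_def indicator_def)
      moreover have "AE \<omega> in Q. cint Q joint (\<lambda>z. indicator K z + indicator (G - K) z) \<omega> = ?c K \<omega> + ?c (G - K) \<omega>"
        by (rule cint_add) measurable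
      ultimately have "AE \<omega> in Q. ?c G \<omega> - h \<omega> \<le> ?c (G - K) \<omega>" using fin Kh
        by eventually_elim (auto simp: ennreal_minus_le_iff intro: add_right_mono)
      then have "(\<integral>\<^sup>+\<omega>. ?c G \<omega> - h \<omega> \<partial>Q) \<le> (\<integral>\<^sup>+\<omega>. ?c (G - K) \<omega> \<partial>Q)" by (rule nn_integral_mono_AE)
      also have "\<dots> = emeasure joint (G - K)" by (subst cint_integral) auto
      finally show ?thesis using Ke unfolding K_def by simp
    qed
    then have "(\<integral>\<^sup>+\<omega>. ?c G \<omega> - h \<omega> \<partial>Q) \<le> 0" by (rule ennreal_le_epsilon)
    then have "AE \<omega> in Q. ?c G \<omega> - h \<omega> = 0" by (subst (asm) le_zero_eq, subst (asm) nn_integral_0_iff_AE) measurable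
    then show "AE \<omega> in M. \<mu> P \<omega> \<le> h \<omega>"
      unfolding AE_Q P using \<mu>_gset[OF G] by eventually_elim (simp add: diff_eq_0_iff_ennreal)
  qed
qed

end

theorem theorem5p15:
  fixes M :: "'a measure"
    and L :: "(('a \<Rightarrow> real ^ 'd) \<Rightarrow> 'a \<Rightarrow> real) \<Rightarrow> 'a \<Rightarrow> real"
  assumes "prob_space M" and "complete_measure M"
    and "\<forall>f\<in>stable_seq_continuous M. L f \<in> borel_measurable M"
    and "stable_functional M (stable_seq_continuous M) L"
    and "L0_linear M (stable_seq_continuous M) L"
    and "\<forall>f\<in>stable_seq_continuous M.
           (\<forall>x\<in>borel_measurable M. AE \<omega> in M. 0 \<le> f x \<omega>) \<longrightarrow> (AE \<omega> in M. 0 \<le> L f \<omega>)"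
  shows "\<exists>\<mu> :: ('a, real ^ 'd) cset \<Rightarrow> 'a \<Rightarrow> ennreal.
           finite_stable_measure M (borel_measurable M) (stable_borel M) \<mu> \<and>
           conditionally_regular M \<mu> \<and>
           (\<forall>f\<in>stable_seq_continuous M.
              stably_integrable M (borel_measurable M) (stable_borel M) \<mu> f \<and>
              (AE \<omega> in M. L f \<omega> = stable_integral M (borel_measurable M) (stable_borel M) \<mu> f \<omega>))"
proof -
  interpret stable_positive_functional M L
    using assms
    by (intro stable_positive_functional.intro complete_prob_space.intro stable_positive_functional_axioms.intro)
      (auto simp: L0_linear_def)
  show ?thesis
    using finite_stable_measure_\<mu> conditionally_regular_\<mu> representation by blast
qed

end
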